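(* Let $\lambda,\mu$ be partitions with conjugates $\widetilde\lambda,\widetilde\mu$, where $\widetilde\mu_1\le n$, and let $v_\mu$ be the canonical highest weight vector of weight $\mu$ of the irreducible $gl(n)$-module $Schur_{\widetilde\mu}(n)$. Below, $S,S'$ denote arbitrary Young tableaux on the alphabet $\{1,\dots,n\}$. 1. If $sh(S)=sh(S')=\widetilde\lambda$ and $|\widetilde\mu|<|\widetilde\lambda|$, then $[\,\boxed{S'\,|\,S}\,]\cdot v_\mu=0$. 2. If $sh(S)=sh(S')=\widetilde\lambda$, $|\widetilde\mu|=|\widetilde\lambda|$ and $\widetilde\mu\neq\widetilde\lambda$, then $[\,\boxed{S'\,|\,S}\,]\cdot v_\mu=0$. 3. If $\widetilde\mu=\widetilde\lambda$, then $[\,\boxed{D_{\widetilde\lambda}\,|\,D_{\widetilde\lambda}}\,]\cdot v_\lambda=H(\widetilde\lambda)^2\,v_\lambda$. 4. If $sh(S)=sh(S')=\widetilde\lambda$ and $\widetilde\lambda\nsubseteq\widetilde\mu$, then $[\,\boxed{S'\,|\,S}\,]\cdot v_\mu=0$.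
   Context: Virtual symbols. Let $\mathcal L=\{1,\dots,n\}$, and let $\mathcal A_0=\{\alpha_1,\dots,\alpha_{m_0}\}$, $\mathcal A_1=\{\beta_1,\dots,\beta_{m_1}\}$ be finite sets of auxiliary (virtual) symbols, with $m_0,m_1$ sufficiently large. Put $|a|=0\in\mathbb Z_2$ for $a\in\mathcal A_0$ and $|a|=1\in\mathbb Z_2$ for $a\in\mathcal A_1\cup\mathcal L$. Let $gl(m_0|m_1+n)$ be the complex Lie superalgebra with basis $e_{a,b}$, $a,b\in\mathcal A_0\cup\mathcal A_1\cup\mathcal L$, $|e_{a,b}|=|a|+|b|$, and superbracket $[e_{a,b},e_{c,d}]=\delta_{bc}e_{a,d}-(-1)^{(|a|+|b|)(|c|+|d|)}\delta_{ad}e_{c,b}$. Its enveloping superalgebra $\mathbf U(gl(m_0|m_1+n))$ contains $\mathbf U(gl(n))$ as the subalgebra generated by $e_{i,j}$, $i,j\in\mathcal L$. Devirtualization. A product $e_{a_m,b_m}\cdots e_{a_1,b_1}$ is irregular if there are $i\le m$ and a virtual symbol $\gamma\in\mathcal A_0\cup\mathcal A_1$ with $\#\{j\le i: b_j=\gamma\}>\#\{j<i: a_j=\gamma\}$. Let $\mathbf{Irr}$ be the left ideal of $\mathbf U(gl(m_0|m_1+n))$ generated by the irregular products. The sum $Virt=\mathbf U(gl(n))+\mathbf{Irr}$ is direct and is a subalgebra, in which $\mathbf{Irr}$ is a two-sided ideal; $\mathfrak p:Virt\to\mathbf U(gl(n))$ denotes the projection with kernel $\mathbf{Irr}$ (an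 algebra epimorphism). Tableaux. A Young tableau of shape $\lambda$ over an alphabet is any filling of the cells of the Ferrers diagram of $\lambda$ (rows of lengths $\lambda_1\ge\lambda_2\ge\cdots$); $sh$ denotes shape. For tableaux $S,T$ of the same shape, $e_{S,T}$ is the product of the $e_{S(c),T(c)}$ over the cells $c$, read row by row from top to bottom, left to right in each row. $D^*_\lambda$ is the tableau of shape $\lambda$ whose $r$-th row is $\beta_1\beta_2\cdots\beta_{\lambda_r}$, and $C^*_\lambda$ the tableau of shape $\lambda$ whose $r$-th row is $\alpha_r\alpha_r\cdots\alpha_r$ (the $\alpha$'s and $\beta$'s being arbitrary distinct positive, resp. negative, virtual symbols). For tableaux $S,T$ of shape $\lambda$ over $\mathcal L$, the double Young-Capelli bitableau is $[\,\boxed{S\,|\,T}\,]=\mathfrak p\big(e_{S,C^*_\lambda}e_{C^*_\lambda,D^*_\lambda}e_{D^*_\lambda,C^*_\lambda}e_{C^*_\lambda,T}\big)\in\mathbf U(gl(n))$; the argument of $\mathfrak p$ lies in $Virt$ and the result does not depend on the choice of virtual symbols. $D_\lambda$ (for $\lambda_1\le n$) is the tableau on $\mathcal L$ whose $r$-th row is $1\,2\cdots\lambda_r$. Hooks. $H(\lambda)$ is the product of the hook lengths of all boxes of the Ferrers diagram of $\lambda$; $H(\lambda)=H(\widetilde\lambda)$. Schur modules. Let $\mathbb C[M_{n,d}]$ be the polynomial algebra in commuting variables $(i|j)$, $1\le i\le n$, $1\le j\le d$, with $gl(n)$ acting by derivations, $e_{i,j}\cdot(k|t)=\delta_{jk}(i|t)$,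 and $d$ sufficiently large. For a partition $\nu$ with $\nu_1\le n\,$, $Schur_\nu(n)\subset\mathbb C[M_{n,d}]$ is the span of all products $\prod_r\det[(X_{r,s}|t)]_{s,t=1,\dots,\nu_r}$, $X=(X_{r,s})$ any tableau of shape $\nu$ over $\mathcal L$; it is an irreducible $gl(n)$-module with highest weight $\widetilde\nu$. Its canonical highest weight vector $v_{\widetilde\nu}$ is, up to a fixed sign, $\prod_r\det[(s|t)]_{s,t=1,\dots,\nu_r}$. Thus $v_\mu\in Schur_{\widetilde\mu}(n)$ has weight $\mu$. *)

theory Defs
  imports
    Complex_Main
    "HOL-Library.Poly_Mapping"
    "HOL-Algebra.QuotRing"
    "Jordan_Normal_Form.Determinant"
begin

section \<open>Partitions, Ferrers diagrams, tableaux\<close>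

text \<open>A partition is the list of its positive parts. Cells are pairs (row, column), both
  counted from 0.\<close>

definition is_partition :: "nat list \<Rightarrow> bool" where
  "is_partition \<nu> \<longleftrightarrow> sorted_wrt (\<ge>) \<nu> \<and> 0 \<notin> set \<nu>"

definition first_part :: "nat list \<Rightarrow> nat" where
  "first_part \<nu> = (if \<nu> = [] then 0 else hd \<nu>)"

definition ferrers :: "nat list \<Rightarrow> (nat \<times> nat) set" where
  "ferrers \<nu> = {(r, s). r < length \<nu> \<and> s < \<nu> ! r}"

definition conj_part :: "nat list \<Rightarrow> nat list" where
  "conj_part \<nu> = map (\<lambda>s. card {r. (r, s) \<in> ferrers \<nu>}) [0..<first_part \<nu>]"

definition hook_length :: "nat list \<Rightarrow> nat \<times> nat \<Rightarrow> nat" where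
  "hook_length \<nu> = (\<lambda>(r, s).
     card {(r', s') \<in> ferrers \<nu>. (r' = r \<and> s \<le> s') \<or> (s' = s \<and> r \<le> r')})"

definition hook_product :: "nat list \<Rightarrow> nat" where
  "hook_product \<nu> = (\<Prod>c\<in>ferrers \<nu>. hook_length \<nu> c)"

text \<open>A tableau is the list of its rows, so it carries its shape.\<close>

type_synonym 'a tableau = "'a list list"

definition sh :: "'a tableau \<Rightarrow> nat list" where
  "sh S = map length S"

definition tableaux :: "nat \<Rightarrow> nat list \<Rightarrow> nat tableau set" where
  "tableaux n \<nu> = {S. sh S = \<nu> \<and> (\<forall>xs\<in>set S. set xs \<subseteq> {1..n})}"

definition D_tab :: "nat list \<Rightarrow> nat tableau" where
  "D_tab \<nu> = map (\<lambda>k. [1..<Suc k]) \<nu>"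

section \<open>The free algebra on the symbols $e_{a,b}$\<close>

text \<open>\<^term>\<open>Pos i\<close> is $\alpha_i$, \<^term>\<open>Neg i\<close> is $\beta_i$, and \<^term>\<open>Lett i\<close> is the proper
  letter $i$. Elements of the free algebra are finitely supported functions from words to
  \<open>complex\<close>; the multiplication is the convolution product over the monoid of words.\<close>

datatype sym = Pos nat | Neg nat | Lett (letter: nat)

fun parity :: "sym \<Rightarrow> nat" where
  "parity (Pos i) = 0"
| "parity (Neg i) = 1"
| "parity (Lett i) = 1"

definition virtuals :: "nat \<Rightarrow> nat \<Rightarrow> sym set" where
  "virtuals m0 m1 = Pos ` {1..m0} \<union> Neg ` {1..m1}"

definition letters :: "nat \<Rightarrow> sym set" where
  "letters n = Lett ` {1..n}"

definition alphabet :: "nat \<Rightarrow> nat \<Rightarrow> nat \<Rightarrow> sym set" where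
  "alphabet m0 m1 n = virtuals m0 m1 \<union> letters n"

datatype 'a free_word = FWord (word_list: "'a list")

instantiation free_word :: (type) monoid_add
begin

definition zero_free_word :: "'a free_word" where
  "0 = FWord []"

definition plus_free_word :: "'a free_word \<Rightarrow> 'a free_word \<Rightarrow> 'a free_word" where
  "v + w = FWord (word_list v @ word_list w)"

instance
  by standard (auto simp: zero_free_word_def plus_free_word_def)

end

type_synonym nc_poly = "(sym \<times> sym) free_word \<Rightarrow>\<^sub>0 complex"

definition gen :: "sym \<Rightarrow> sym \<Rightarrow> nc_poly" where
  "gen a b = Poly_Mapping.single (FWord [(a, b)]) 1"

definition free_alg :: "sym set \<Rightarrow> nc_poly ring" where
  "free_alg A = \<lparr>carrier = {x. \<forall>w\<in>Poly_Mapping.keys x. set (word_list w) \<subseteq> A \<times> A},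
     monoid.mult = (*), one = 1, zero = 0, add = (+)\<rparr>"

section \<open>The enveloping superalgebra of $gl(m_0|m_1+n)$\<close>

definition super_sign :: "sym \<Rightarrow> sym \<Rightarrow> sym \<Rightarrow> sym \<Rightarrow> nc_poly" where
  "super_sign a b c d = (- 1) ^ ((parity a + parity b) * (parity c + parity d))"

definition bracket :: "sym \<Rightarrow> sym \<Rightarrow> sym \<Rightarrow> sym \<Rightarrow> nc_poly" where
  "bracket a b c d =
     (if b = c then gen a d else 0) - super_sign a b c d * (if a = d then gen c b else 0)"

definition gl_relations :: "sym set \<Rightarrow> nc_poly set" where
  "gl_relations A = {gen a b * gen c d - super_sign a b c d * gen c d * gen a b - bracket a b c d
     | a b c d. a \<in> A \<and> b \<in> A \<and> c \<in> A \<and> d \<in> A}"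

text \<open>The tensor algebra of $gl(m_0|m_1+n)$ is the free algebra on the basis $e_{a,b}$, and by
  bilinearity the relations for basis elements suffice. All ideals, also the left ideal below,
  are closed under scalars, since the constants belong to the ring.\<close>

definition gl_ideal :: "nat \<Rightarrow> nat \<Rightarrow> nat \<Rightarrow> nc_poly set" where
  "gl_ideal m0 m1 n = genideal (free_alg (alphabet m0 m1 n)) (gl_relations (alphabet m0 m1 n))"

definition U_gl :: "nat \<Rightarrow> nat \<Rightarrow> nat \<Rightarrow> nc_poly set ring" where
  "U_gl m0 m1 n = free_alg (alphabet m0 m1 n) Quot gl_ideal m0 m1 n"

definition U_class :: "nat \<Rightarrow> nat \<Rightarrow> nat \<Rightarrow> nc_poly \<Rightarrow> nc_poly set" where
  "U_class m0 m1 n x = gl_ideal m0 m1 n +>\<^bsub>free_alg (alphabet m0 m1 n)\<^esub> x"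

definition ue :: "nat \<Rightarrow> nat \<Rightarrow> nat \<Rightarrow> sym \<Rightarrow> sym \<Rightarrow> nc_poly set" where
  "ue m0 m1 n a b = U_class m0 m1 n (gen a b)"

text \<open>\<open>U(gl(n))\<close> is the subalgebra generated by the $e_{i,j}$, that is, the set of values in
  $U(gl(m_0|m_1+n))$ of the noncommutative polynomials in the $e_{i,j}$.\<close>

definition U_gl_proper :: "nat \<Rightarrow> nat \<Rightarrow> nat \<Rightarrow> nc_poly set set" where
  "U_gl_proper m0 m1 n = U_class m0 m1 n ` carrier (free_alg (letters n))"

definition list_prod :: "('a, 'b) monoid_scheme \<Rightarrow> 'a list \<Rightarrow> 'a" where
  "list_prod R xs = foldr (\<lambda>x y. x \<otimes>\<^bsub>R\<^esub> y) xs \<one>\<^bsub>R\<^esub>"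

definition e_word :: "nat \<Rightarrow> nat \<Rightarrow> nat \<Rightarrow> (sym \<times> sym) list \<Rightarrow> nc_poly set" where
  "e_word m0 m1 n w = list_prod (U_gl m0 m1 n) (map (\<lambda>(a, b). ue m0 m1 n a b) w)"

text \<open>For tableaux of the same shape, concatenating the rows reads the cells row by row.\<close>

definition e_tab :: "nat \<Rightarrow> nat \<Rightarrow> nat \<Rightarrow> sym tableau \<Rightarrow> sym tableau \<Rightarrow> nc_poly set" where
  "e_tab m0 m1 n S T = e_word m0 m1 n (zip (concat S) (concat T))"

section \<open>Devirtualization\<close>

text \<open>The factors of a product $e_{a_m,b_m}\cdots e_{a_1,b_1}$ are numbered from right to left,
  hence the reversal.\<close>

definition irregular :: "nat \<Rightarrow> nat \<Rightarrow> (sym \<times> sym) list \<Rightarrow> bool" where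
  "irregular m0 m1 w \<longleftrightarrow>
     (\<exists>i\<in>{1..length w}. \<exists>\<gamma>\<in>virtuals m0 m1.
        card {j \<in> {1..i}. snd (rev w ! (j - 1)) = \<gamma>} >
        card {j \<in> {1..<i}. fst (rev w ! (j - 1)) = \<gamma>})"

definition left_ideal_gen :: "('a, 'b) ring_scheme \<Rightarrow> 'a set \<Rightarrow> 'a set" where
  "left_ideal_gen R X = \<Inter>{I. additive_subgroup I R \<and> X \<subseteq> I \<and>
     (\<forall>r\<in>carrier R. \<forall>x\<in>I. r \<otimes>\<^bsub>R\<^esub> x \<in> I)}"

definition Irr :: "nat \<Rightarrow> nat \<Rightarrow> nat \<Rightarrow> nc_poly set set" where
  "Irr m0 m1 n = left_ideal_gen (U_gl m0 m1 n)
     {e_word m0 m1 n w | w. set w \<subseteq> alphabet m0 m1 n \<times> alphabet m0 m1 n \<and> irregular m0 m1 w}"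

text \<open>The projection of $Virt = U(gl(n)) \oplus Irr$ onto \<open>U(gl(n))\<close>. The sum is direct, so at
  most one \<open>u\<close> qualifies, and one exists exactly when \<open>x\<close> belongs to $Virt$.\<close>

definition devirt :: "nat \<Rightarrow> nat \<Rightarrow> nat \<Rightarrow> nc_poly set \<Rightarrow> nc_poly set" where
  "devirt m0 m1 n x =
     (SOME u. u \<in> U_gl_proper m0 m1 n \<and> x \<ominus>\<^bsub>U_gl m0 m1 n\<^esub> u \<in> Irr m0 m1 n)"

section \<open>Double Young-Capelli bitableaux\<close>

text \<open>The functions \<open>\<alpha>\<close> and \<open>\<beta>\<close> choose the virtual symbols: row \<open>r\<close> (from 1) of $C^*$ is filled
  with $\alpha_{\alpha(r)}$ and column \<open>s\<close> (from 1) of $D^*$ with $\beta_{\beta(s)}$.\<close>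

definition virtual_choice ::
  "nat \<Rightarrow> nat \<Rightarrow> nat list \<Rightarrow> (nat \<Rightarrow> nat) \<Rightarrow> (nat \<Rightarrow> nat) \<Rightarrow> bool" where
  "virtual_choice m0 m1 \<nu> \<alpha> \<beta> \<longleftrightarrow>
     inj_on \<alpha> {1..length \<nu>} \<and> \<alpha> ` {1..length \<nu>} \<subseteq> {1..m0} \<and>
     inj_on \<beta> {1..first_part \<nu>} \<and> \<beta> ` {1..first_part \<nu>} \<subseteq> {1..m1}"

definition C_star :: "(nat \<Rightarrow> nat) \<Rightarrow> nat list \<Rightarrow> sym tableau" where
  "C_star \<alpha> \<nu> = map (\<lambda>r. replicate (\<nu> ! (r - 1)) (Pos (\<alpha> r))) [1..<Suc (length \<nu>)]"

definition D_star :: "(nat \<Rightarrow> nat) \<Rightarrow> nat list \<Rightarrow> sym tableau" where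
  "D_star \<beta> \<nu> = map (\<lambda>k. map (\<lambda>s. Neg (\<beta> s)) [1..<Suc k]) \<nu>"

definition double_YC ::
  "nat \<Rightarrow> nat \<Rightarrow> nat \<Rightarrow> (nat \<Rightarrow> nat) \<Rightarrow> (nat \<Rightarrow> nat) \<Rightarrow> nat tableau \<Rightarrow> nat tableau \<Rightarrow> nc_poly set"
where
  "double_YC m0 m1 n \<alpha> \<beta> S T =
     (let C = C_star \<alpha> (sh S); D = D_star \<beta> (sh S);
          S' = map (map Lett) S; T' = map (map Lett) T
      in devirt m0 m1 n (list_prod (U_gl m0 m1 n)
           [e_tab m0 m1 n S' C, e_tab m0 m1 n C D, e_tab m0 m1 n D C, e_tab m0 m1 n C T']))"

section \<open>The $gl(n)$-module $\mathbb C[M_{n,d}]$\<close>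

text \<open>Polynomials in variables $(i|t)$ for all \<open>i\<close> and \<open>t\<close>, with $\mathbb C[M_{n,d}]$ the subalgebra
  for $1 \le i \le n$, $1 \le t \le d$. Exponent vectors are finitely supported functions on the
  index pairs \<open>(i, t)\<close>.\<close>

type_synonym cpoly = "((nat \<times> nat) \<Rightarrow>\<^sub>0 nat) \<Rightarrow>\<^sub>0 complex"

definition var :: "nat \<Rightarrow> nat \<Rightarrow> cpoly" where
  "var i t = Poly_Mapping.single (Poly_Mapping.single (i, t) 1) 1"

definition scale :: "complex \<Rightarrow> cpoly \<Rightarrow> cpoly" where
  "scale c f = Poly_Mapping.single 0 c * f"

definition partial :: "nat \<times> nat \<Rightarrow> cpoly \<Rightarrow> cpoly" where
  "partial v f = (\<Sum>m\<in>Poly_Mapping.keys f. Poly_Mapping.single (m - Poly_Mapping.single v 1)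
     (Poly_Mapping.lookup f m * of_nat (Poly_Mapping.lookup m v)))"

text \<open>The derivation of $\mathbb C[M_{n,d}]$ with $(k|t) \mapsto \delta_{jk}\,(i|t)$; see
  \<open>polarization_var\<close> and \<open>polarization_mult\<close> below.\<close>

definition polarization :: "nat \<Rightarrow> nat \<Rightarrow> nat \<Rightarrow> cpoly \<Rightarrow> cpoly" where
  "polarization d i j f = (\<Sum>t = 1..d. var i t * partial (j, t) f)"

definition word_act :: "nat \<Rightarrow> (sym \<times> sym) list \<Rightarrow> cpoly \<Rightarrow> cpoly" where
  "word_act d w f = foldr (\<lambda>(a, b). polarization d (letter a) (letter b)) w f"

definition free_act :: "nat \<Rightarrow> nc_poly \<Rightarrow> cpoly \<Rightarrow> cpoly" where
  "free_act d x f =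
     (\<Sum>w\<in>Poly_Mapping.keys x. scale (Poly_Mapping.lookup x w) (word_act d (word_list w) f))"

text \<open>An element \<open>u\<close> of \<open>U(gl(n))\<close> acts through any expression of it as a noncommutative
  polynomial in the $e_{i,j}$, all of which act in the same way.\<close>

definition gl_act :: "nat \<Rightarrow> nat \<Rightarrow> nat \<Rightarrow> nat \<Rightarrow> nc_poly set \<Rightarrow> cpoly \<Rightarrow> cpoly" where
  "gl_act m0 m1 n d u f =
     the_elem {free_act d x f | x. x \<in> carrier (free_alg (letters n)) \<and> U_class m0 m1 n x = u}"

definition row_det :: "nat list \<Rightarrow> cpoly" where
  "row_det xs = det (mat (length xs) (length xs) (\<lambda>(s, t). var (xs ! s) (Suc t)))"

definition bideterminant :: "nat tableau \<Rightarrow> cpoly" where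
  "bideterminant X = prod_list (map row_det X)"

definition Schur :: "nat \<Rightarrow> nat list \<Rightarrow> cpoly set" where
  "Schur n \<nu> = Modules.module.span scale (bideterminant ` tableaux n \<nu>)"

text \<open>The canonical highest weight vector of weight \<open>\<mu>\<close> of the Schur module of the conjugate
  partition. It is fixed up to a sign that depends on conventions, so both signs are admitted.\<close>

definition canonical_hwv :: "nat \<Rightarrow> nat list \<Rightarrow> cpoly \<Rightarrow> bool" where
  "canonical_hwv n \<mu> v \<longleftrightarrow> v \<in> Schur n (conj_part \<mu>) \<and>
     (v = bideterminant (D_tab (conj_part \<mu>)) \<or> v = - bideterminant (D_tab (conj_part \<mu>)))"

subsection \<open>Checks of the definitions\<close>

lemma poly_mapping_monomial_induct [case_names single add]:
  fixes f :: cpoly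
  assumes "\<And>m c. P (Poly_Mapping.single m c)" and "\<And>f g. P f \<Longrightarrow> P g \<Longrightarrow> P (f + g)"
  shows "P f"
proof (induction f rule: Poly_Mapping.update_induct)
  case const
  show ?case using assms(1)[of 0 0] by simp
next
  case (update f a b)
  have "Poly_Mapping.update a b f = f + Poly_Mapping.single a b"
    using update(1) by (intro poly_mapping_eqI)
      (auto simp: lookup_update lookup_add lookup_single when_def in_keys_iff)
  then show ?case using assms update by simp
qed

lemma partial_superset:
  assumes "finite K" "Poly_Mapping.keys f \<subseteq> K"
  shows "partial v f = (\<Sum>m\<in>K. Poly_Mapping.single (m - Poly_Mapping.single v 1)
     (Poly_Mapping.lookup f m * of_nat (Poly_Mapping.lookup m v)))"
  unfolding partial_def using assms
  by (intro sum.mono_neutral_left) (auto simp: in_keys_iff)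

lemma partial_add: "partial v (f + g) = partial v f + partial v g"
proof -
  let ?K = "Poly_Mapping.keys f \<union> Poly_Mapping.keys g"
  have "partial v (f + g) = (\<Sum>m\<in>?K. Poly_Mapping.single (m - Poly_Mapping.single v 1)
     (Poly_Mapping.lookup (f + g) m * of_nat (Poly_Mapping.lookup m v)))"
    by (intro partial_superset) (auto simp: in_keys_iff lookup_add)
  then show ?thesis
    by (simp add: partial_superset[of ?K f] partial_superset[of ?K g] lookup_add
        distrib_right single_add sum.distrib)
qed

lemma partial_single:
  "partial v (Poly_Mapping.single m c) =
     Poly_Mapping.single (m - Poly_Mapping.single v 1) (c * of_nat (Poly_Mapping.lookup m v))"
  by (subst partial_superset[of "{m}"]) auto

lemma partial_var: "partial v (var i t) = (if v = (i, t) then 1 else 0)"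
  by (auto simp: var_def partial_single lookup_single when_def)

lemma single_exponent_shift:
  fixes m k :: "(nat \<times> nat) \<Rightarrow>\<^sub>0 nat" and c :: complex
  shows "Poly_Mapping.single (m - Poly_Mapping.single v 1 + k) (c * of_nat (Poly_Mapping.lookup m v)) =
    Poly_Mapping.single (m + k - Poly_Mapping.single v 1) (c * of_nat (Poly_Mapping.lookup m v))"
proof (cases "Poly_Mapping.lookup m v = 0")
  case False
  then have "m - Poly_Mapping.single v 1 + k = m + k - Poly_Mapping.single v 1"
    by (intro poly_mapping_eqI) (auto simp: lookup_add lookup_minus lookup_single when_def)
  then show ?thesis by simp
qed simp

lemma partial_mult_single:
  "partial v (Poly_Mapping.single m c * Poly_Mapping.single k b) =
     partial v (Poly_Mapping.single m c) * Poly_Mapping.single k b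
     + Poly_Mapping.single m c * partial v (Poly_Mapping.single k b)"
proof -
  let ?L = "\<lambda>m. of_nat (Poly_Mapping.lookup m v) :: complex"
  let ?M = "m + k - Poly_Mapping.single v 1"
  have "partial v (Poly_Mapping.single m c) * Poly_Mapping.single k b =
      Poly_Mapping.single (m - Poly_Mapping.single v 1 + k) (c * b * ?L m)"
    by (simp only: partial_single mult_single mult.assoc mult.commute[of b])
  then have 1: "partial v (Poly_Mapping.single m c) * Poly_Mapping.single k b =
      Poly_Mapping.single ?M (c * b * ?L m)"
    by (simp only: single_exponent_shift)
  have "Poly_Mapping.single m c * partial v (Poly_Mapping.single k b) =
      Poly_Mapping.single (k - Poly_Mapping.single v 1 + m) (c * b * ?L k)"
    by (simp only: partial_single mult_single mult.assoc add.commute[of m])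
  then have 2: "Poly_Mapping.single m c * partial v (Poly_Mapping.single k b) =
      Poly_Mapping.single ?M (c * b * ?L k)"
    by (simp only: single_exponent_shift add.commute[of k])
  show ?thesis
    unfolding 1 2
    by (simp only: mult_single partial_single lookup_add of_nat_add distrib_left single_add)
qed

lemma partial_mult: "partial v (f * g) = partial v f * g + f * partial v g"
proof (induction f rule: poly_mapping_monomial_induct)
  case (single m c)
  show ?case
  proof (induction g rule: poly_mapping_monomial_induct)
    case (single k b)
    show ?case by (rule partial_mult_single)
  next
    case (add g1 g2)
    then show ?case by (simp only: partial_add distrib_left add_ac)
  qed
next
  case (add f1 f2)
  then show ?case by (simp only: partial_add distrib_right add_ac)
qed

lemma polarization_var:
  assumes "t \<in> {1..d}"
  shows "polarization d i j (var k t) = (if j = k then var i t else 0)"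
proof -
  have "polarization d i j (var k t) =
      (\<Sum>t' = 1..d. if t' = t then if j = k then var i t else 0 else 0)"
    unfolding polarization_def partial_var by (intro sum.cong) auto
  then show ?thesis using assms by simp
qed

lemma polarization_add:
  "polarization d i j (f + g) = polarization d i j f + polarization d i j g"
  by (simp add: polarization_def partial_add distrib_left sum.distrib)

lemma polarization_mult:
  "polarization d i j (f * g) = polarization d i j f * g + f * polarization d i j g"
proof -
  have "(\<Sum>t = 1..d. var i t * partial (j, t) (f * g)) =
      (\<Sum>t = 1..d. var i t * partial (j, t) f * g + f * (var i t * partial (j, t) g))"
    by (intro sum.cong refl) (simp add: partial_mult distrib_left mult_ac)
  then show ?thesis
    by (simp only: polarization_def sum.distrib sum_distrib_left sum_distrib_right)
qed

lemma module_scale: "Modules.module scale"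
  apply unfold_locales
  apply (simp_all add: scale_def distrib_left distrib_right single_add mult_single mult.assoc[symmetric])
  done

lemma canonical_hwv_exists:
  assumes "first_part (conj_part \<mu>) \<le> n"
  shows "canonical_hwv n \<mu> (bideterminant (D_tab (conj_part \<mu>)))"
proof -
  let ?\<nu> = "conj_part \<mu>"
  have "sorted_wrt (\<ge>) ?\<nu>"
  proof -
    have "card {r. (r, t) \<in> ferrers \<mu>} \<le> card {r. (r, s) \<in> ferrers \<mu>}" if "s \<le> t" for s t
    proof (rule card_mono)
      show "finite {r. (r, s) \<in> ferrers \<mu>}"
        by (rule finite_subset[of _ "{..<length \<mu>}"]) (auto simp: ferrers_def)
      show "{r. (r, t) \<in> ferrers \<mu>} \<subseteq> {r. (r, s) \<in> ferrers \<mu>}"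
        using that by (auto simp: ferrers_def)
    qed
    then show ?thesis by (auto simp: conj_part_def sorted_wrt_iff_nth_less)
  qed
  then have "k \<le> n" if "k \<in> set ?\<nu>" for k
    using that assms by (cases ?\<nu>) (auto simp: first_part_def)
  then have "D_tab ?\<nu> \<in> tableaux n ?\<nu>"
    by (fastforce simp: D_tab_def tableaux_def sh_def comp_def map_idI simp del: upt_Suc)
  then show ?thesis
    using Modules.module.span_base[OF module_scale] by (auto simp: canonical_hwv_def Schur_def)
qed

end

theory Submission
  imports Defs "HOL-Library.Nat_Bijection"
begin

text \<open>
  \<open>gl(m\<^sub>0|m\<^sub>1 + n)\<close> acts on the superpolynomials in the variables \<open>(a|t)\<close>, which are odd for positive
  virtual \<open>a\<close> and even otherwise, and irregular products annihilate every polynomial without virtual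
  variables. Hence a devirtualized element acts on such polynomials like the virtual product itself,
  and \<open>e\<^bsub>S',C*\<^esub> e\<^bsub>C*,D*\<^esub> e\<^bsub>D*,C*\<^esub> e\<^bsub>C*,S\<^esub>\<close> can be applied to \<open>v\<^sub>\<mu>\<close> factor by factor.

  Write \<open>\<nu>\<close> for the shape of \<open>S\<close>. Vanishing: \<open>y = e\<^bsub>D*,C*\<^esub> e\<^bsub>C*,S\<^esub> v\<^sub>\<mu>\<close> is annihilated by the
  raising operators of the right action of \<open>gl(d)\<close>, which commute with \<open>gl(m\<^sub>0|m\<^sub>1 + n)\<close>.
  If \<open>y \<noteq> 0\<close>, it therefore has a monomial in which every \<open>(\<beta>\<^sub>s|t)\<close> satisfies \<open>t \<le> s\<close>, so the \<open>\<beta>\<close>-degrees \<open>\<rho>\<^sub>t\<close> of the columns \<open>t\<close> dominate the column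
  lengths of \<open>\<nu>\<close>. As the \<open>(\<alpha>\<^sub>r|t)\<close> are odd, \<open>\<rho>\<close> is also the vector of column sums of a 0-1 matrix
  with row sums \<open>\<nu>\<close>, so it is dominated by them. Thus \<open>\<rho>\<close> is the conjugate of \<open>\<nu>\<close>, and
  comparing column degrees with \<open>v\<^sub>\<mu>\<close> gives that \<open>\<nu>\<close> is contained in the shape of \<open>v\<^sub>\<mu>\<close>. Cases 1
  and 2 are instances of case 4.

  Eigenvalue: after reordering the anticommuting factors (the signs cancel), both
  \<open>e\<^bsub>S,C*\<^esub> e\<^bsub>C*,S\<^esub>\<close> and \<open>e\<^bsub>C*,D*\<^esub> e\<^bsub>D*,C*\<^esub>\<close> can be cancelled from the inside, one pair
  \<open>e\<^bsub>x,\<alpha>\<^esub> e\<^bsub>\<alpha>,x\<^esub>\<close> at a time; on the vectors at hand each pair acts as \<open>e\<^bsub>x,x\<^esub> + e\<^bsub>\<alpha>,\<alpha>\<^esub>\<close>, and its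
  eigenvalue is the hook length of the corresponding cell.
\<close>

section \<open>The super-oscillator module\<close>

text \<open>The order of the factors is what makes the cancellation work. A word acts from its right
  end, and pairs are nested when neighbouring words run through the cells in opposite orders. The
  order taken here turns letters into \<alpha>'s from the top row down and \<alpha>'s into \<beta>'s
  from the bottom row up. Then every unwanted commutator either removes an absent symbol, or moves
  an index to a row at least as long, or to another column of the same row; in the last two cases a
  factor of an odd word is repeated, and its square is zero.

  The eigenvalues are counts: the occurrences of the column symbol, still left or already produced,
  account for the leg, and the copies of the row symbol for the arm. Each of the two cancellations
  yields the hook product once, hence its square.

  In the vanishing part the tableaux over the letters are arbitrary, so their contents give no
  information. The places t are not touched by any word; this is why the right action is used there,
  and why column totals can be compared across words.\<close>

abbreviation "lookup \<equiv> Poly_Mapping.lookup"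
abbreviation "keys \<equiv> Poly_Mapping.keys"

text \<open>A superpolynomial is given by its coefficients \<open>amp f A\<close>, polynomials in the even variables, at the
  odd monomials \<open>A\<close>, sets of codes \<open>fermi a t\<close> of the odd variables. In the even variable \<open>(a|t)\<close> the row
  of \<open>a\<close> is \<open>row_index n a\<close>, so that polynomials in the variables of the letters keep their meaning.\<close>

datatype fock = Fock (amp: "nat set \<Rightarrow> cpoly")

lemma fock_eqI: "(\<And>A. amp f A = amp g A) \<Longrightarrow> f = g"
  by (cases f; cases g) auto

instantiation fock :: ab_group_add
begin

definition zero_fock :: fock where "0 = Fock (\<lambda>_. 0)"
definition plus_fock :: "fock \<Rightarrow> fock \<Rightarrow> fock" where "f + g = Fock (\<lambda>A. amp f A + amp g A)"
definition uminus_fock :: "fock \<Rightarrow> fock" where "- f = Fock (\<lambda>A. - amp f A)"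
definition minus_fock :: "fock \<Rightarrow> fock \<Rightarrow> fock" where "f - g = Fock (\<lambda>A. amp f A - amp g A)"

instance
  by standard
    (auto intro: fock_eqI simp: zero_fock_def plus_fock_def uminus_fock_def minus_fock_def)

end

lemma amp_simps [simp]:
  "amp 0 A = 0" "amp (f + g) A = amp f A + amp g A" "amp (- f) A = - amp f A"
  "amp (f - g) A = amp f A - amp g A"
  by (simp_all add: zero_fock_def plus_fock_def uminus_fock_def minus_fock_def)

definition scl :: "complex \<Rightarrow> fock \<Rightarrow> fock" where
  "scl c f = Fock (\<lambda>A. scale c (amp f A))"

lemma amp_scl [simp]: "amp (scl c f) A = scale c (amp f A)"
  by (simp add: scl_def)

lemma scale_add_right: "scale c (p + q) = scale c p + scale c q"
  and scale_diff_right: "scale c (p - q) = scale c p - scale c q"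
  and scale_zero_right: "scale c 0 = 0"
  and scale_zero_left: "scale 0 p = 0"
  and scale_one: "scale 1 p = p"
  and scale_minus_left: "scale (- c) p = - scale c p"
  and scale_minus_right: "scale c (- p) = - scale c p"
  and scale_scale: "scale a (scale b p) = scale (a * b) p"
  and scale_add_left: "scale (a + b) p = scale a p + scale b p"
  and scale_mult_right: "p * scale c q = scale c (p * q)"
  and scale_mult_left: "scale c p * q = scale c (p * q)"
  by (simp_all add: scale_def algebra_simps single_add single_diff mult_single single_uminus flip: mult.assoc)

lemma scl_simps:
  "scl c (f + g) = scl c f + scl c g"
  "scl c (f - g) = scl c f - scl c g"
  "scl c (- f) = - scl c f"
  "scl c 0 = 0" "scl 0 f = 0" "scl 1 f = f"
  "scl (- c) f = - scl c f"
  "scl a (scl b f) = scl (a * b) f"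
  by (auto intro!: fock_eqI simp: scale_add_right scale_diff_right scale_zero_right scale_zero_left
      scale_one scale_minus_left scale_minus_right scale_scale)

lemma scl_add_left: "scl (a + b) f = scl a f + scl b f"
  by (auto intro!: fock_eqI simp: scale_add_left)

lemma scl_sum: "scl c (\<Sum>i\<in>I. f i) = (\<Sum>i\<in>I. scl c (f i))"
  by (induction I rule: infinite_finite_induct) (auto simp: scl_simps)

definition linear_op :: "(fock \<Rightarrow> fock) \<Rightarrow> bool" where
  "linear_op T \<longleftrightarrow> (\<forall>f g. T (f + g) = T f + T g) \<and> (\<forall>c f. T (scl c f) = scl c (T f))"

lemma linear_op_add: "linear_op T \<Longrightarrow> T (f + g) = T f + T g"
  and linear_op_scl: "linear_op T \<Longrightarrow> T (scl c f) = scl c (T f)"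
  by (auto simp: linear_op_def)

lemma linear_op_zero: "linear_op T \<Longrightarrow> T 0 = 0"
  using linear_op_scl[of T 0 0] by (simp add: scl_simps)

lemma linear_op_minus: "linear_op T \<Longrightarrow> T (- f) = - T f"
  using linear_op_scl[of T "-1" f] by (simp add: scl_simps)

lemma linear_op_diff: "linear_op T \<Longrightarrow> T (f - g) = T f - T g"
  using linear_op_add[of T f "- g"] by (simp add: linear_op_minus)

lemma linear_op_sum: "linear_op T \<Longrightarrow> T (\<Sum>i\<in>I. f i) = (\<Sum>i\<in>I. T (f i))"
  by (induction I rule: infinite_finite_induct) (auto simp: linear_op_zero linear_op_add)

lemmas linear_op_simps = linear_op_add linear_op_scl linear_op_zero linear_op_minus linear_op_diff linear_op_sum

lemma linear_op_comp: "linear_op S \<Longrightarrow> linear_op T \<Longrightarrow> linear_op (\<lambda>f. S (T f))"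
  by (simp add: linear_op_def)

lemma linear_op_sumI: "(\<And>i. i \<in> I \<Longrightarrow> linear_op (T i)) \<Longrightarrow> linear_op (\<lambda>f. \<Sum>i\<in>I. T i f)"
  by (simp add: linear_op_def sum.distrib scl_sum)

section \<open>Creation and annihilation operators and their commutation relations\<close>

fun is_pos :: "sym \<Rightarrow> bool" where
  "is_pos (Pos _) = True"
| "is_pos _ = False"

text \<open>The shift by n puts the even virtual rows after the letter rows, which keeps distinct
  even symbols of the alphabet apart. The values at \<open>Pos\<close> here, and off
  \<open>Pos\<close> in \<open>fermi\<close>, are dummies: \<open>is_pos\<close> selects the
  meaningful one.\<close>

fun row_index :: "nat \<Rightarrow> sym \<Rightarrow> nat" where
  "row_index n (Pos j) = 0"
| "row_index n (Neg j) = n + j"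
| "row_index n (Lett i) = i"

fun fermi :: "sym \<Rightarrow> nat \<Rightarrow> nat" where
  "fermi (Pos j) t = prod_encode (j, t)"
| "fermi _ t = 0"

text \<open>The Jordan-Wigner sign: an odd variable entering or leaving an ordered monomial passes
  the factors with smaller code. Only codes below x are counted, so the cardinality is that of a
  finite set for every A.\<close>

definition fsign :: "nat \<Rightarrow> nat set \<Rightarrow> cpoly" where
  "fsign x A = (- 1) ^ card {y\<in>A. y < x}"

definition create :: "nat \<Rightarrow> sym \<Rightarrow> nat \<Rightarrow> fock \<Rightarrow> fock" where
  "create n a t f = Fock (\<lambda>A. if is_pos a
     then if fermi a t \<in> A then fsign (fermi a t) A * amp f (A - {fermi a t}) else 0
     else var (row_index n a) t * amp f A)"

definition annih :: "nat \<Rightarrow> sym \<Rightarrow> nat \<Rightarrow> fock \<Rightarrow> fock" where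
  "annih n a t f = Fock (\<lambda>A. if is_pos a
     then if fermi a t \<in> A then 0 else fsign (fermi a t) A * amp f (insert (fermi a t) A)
     else partial (row_index n a, t) (amp f A))"

lemma partial_scale: "partial v (scale c p) = scale c (partial v p)"
proof -
  have "partial v (Poly_Mapping.single 0 c :: cpoly) = 0"
    by (simp add: partial_single)
  then show ?thesis by (simp add: scale_def partial_mult)
qed

lemma partial_zero [simp]: "partial v 0 = 0"
  by (simp add: partial_def)

lemma linear_create: "linear_op (create n a t)"
  by (auto intro!: fock_eqI simp: linear_op_def create_def algebra_simps scale_mult_right scale_mult_left scale_zero_right)

lemma linear_annih: "linear_op (annih n a t)"
  by (auto intro!: fock_eqI simp: linear_op_def annih_def algebra_simps scale_mult_right partial_add
      partial_scale scale_zero_right)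

lemma fsign_square: "fsign x A * fsign x A = 1"
  by (simp add: fsign_def flip: power_add)

lemma fsign_square_mult: "fsign x A * (fsign x A * p) = p"
  by (simp add: fsign_square flip: mult.assoc)

lemma fsign_insert:
  assumes "x \<notin> A"
  shows "fsign y (insert x A) = (if x < y then - 1 else 1) * fsign y A"
proof -
  have *: "{z \<in> insert x A. z < y} = (if x < y then insert x {z\<in>A. z < y} else {z\<in>A. z < y})"
    by auto
  have "finite {z\<in>A. z < y}" by (rule finite_subset[of _ "{..<y}"]) auto
  with assms show ?thesis unfolding fsign_def * by simp
qed

lemma fsign_remove:
  assumes "x \<in> A"
  shows "fsign y (A - {x}) = (if x < y then - 1 else 1) * fsign y A"
  using fsign_insert[of x "A - {x}" y] assms by (auto simp: insert_absorb)

lemma partial_commute: "partial u (partial v p) = partial v (partial u p)"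
proof (induction p rule: poly_mapping_monomial_induct)
  case (single m c)
  show ?case
  proof (cases "u = v")
    case False
    have "m - Poly_Mapping.single u 1 - Poly_Mapping.single v (1::nat) =
        m - Poly_Mapping.single v 1 - Poly_Mapping.single u (1::nat)"
      by (intro poly_mapping_eqI) (simp add: lookup_minus lookup_single)
    then show ?thesis using False
      by (simp add: partial_single lookup_minus lookup_single mult_ac)
  qed simp
qed (simp add: partial_add)

lemma partial_var_mult: "partial v (var i t * p) = var i t * partial v p + (if v = (i, t) then p else 0)"
  by (simp add: partial_mult partial_var)

text \<open>The variable (a|t) has parity |a| + 1, as if the place t were odd. Hence the symbols of
  parity 0 are those whose variables anticommute.\<close>

definition swap_sign :: "sym \<Rightarrow> sym \<Rightarrow> complex" where
  "swap_sign a b = (if is_pos a \<and> is_pos b then - 1 else 1)"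

lemma fermi_inject: "is_pos a \<Longrightarrow> is_pos b \<Longrightarrow> fermi a s = fermi b t \<longleftrightarrow> a = b \<and> s = t"
  by (cases a; cases b) auto

lemma fsign_mult_partial: "partial v (fsign x A * p) = fsign x A * partial v p"
proof -
  have "partial v (- p) = - partial v p" for p
    using partial_scale[of v "-1" p] by (simp add: scale_minus_left scale_one)
  then show ?thesis by (cases "even (card {y\<in>A. y < x})") (auto simp: fsign_def)
qed

lemma create_create:
  "create n a s (create n b t f) = scl (swap_sign a b) (create n b t (create n a s f))"
proof (rule fock_eqI)
  fix A
  let ?x = "fermi a s" and ?y = "fermi b t"
  show "amp (create n a s (create n b t f)) A = amp (scl (swap_sign a b) (create n b t (create n a s f))) A"
  proof (cases "is_pos a \<and> is_pos b")
    case True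
    have "A - {?x} - {?y} = A - {?y} - {?x}" by auto
    with True show ?thesis
      by (cases "?x = ?y")
        (auto simp: create_def swap_sign_def scale_minus_left scale_one fsign_remove algebra_simps
          scale_zero_right)
  next
    case False
    then show ?thesis
      by (auto simp: create_def swap_sign_def scale_one algebra_simps)
  qed
qed

lemma annih_annih:
  "annih n a s (annih n b t f) = scl (swap_sign a b) (annih n b t (annih n a s f))"
proof (rule fock_eqI)
  fix A
  let ?x = "fermi a s" and ?y = "fermi b t"
  show "amp (annih n a s (annih n b t f)) A = amp (scl (swap_sign a b) (annih n b t (annih n a s f))) A"
  proof (cases "is_pos a \<and> is_pos b")
    case True
    have "insert ?x (insert ?y A) = insert ?y (insert ?x A)" by auto
    with True show ?thesis
      by (cases "?x = ?y")
        (auto simp: annih_def swap_sign_def scale_minus_left scale_one fsign_insert algebra_simps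
          scale_zero_right)
  next
    case False
    then show ?thesis
      by (auto simp: annih_def swap_sign_def scale_one algebra_simps partial_commute fsign_mult_partial)
  qed
qed

lemma row_index_inject:
  assumes "a \<in> alphabet m0 m1 n" "b \<in> alphabet m0 m1 n" "\<not> is_pos a" "\<not> is_pos b"
  shows "row_index n a = row_index n b \<longleftrightarrow> a = b"
  using assms by (cases a; cases b) (auto simp: alphabet_def virtuals_def letters_def)

text \<open>Canonical commutation relations, with anticommutators between odd variables. Membership
  in the alphabet gives distinct even symbols distinct rows, so that they do not contract with each
  other.\<close>

lemma annih_create:
  assumes "a \<in> alphabet m0 m1 n" "b \<in> alphabet m0 m1 n"
  shows "annih n a s (create n b t f) =
    scl (swap_sign a b) (create n b t (annih n a s f)) + (if a = b \<and> s = t then f else 0)"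
proof (rule fock_eqI)
  fix A
  let ?x = "fermi a s" and ?y = "fermi b t"
  show "amp (annih n a s (create n b t f)) A = amp
    (scl (swap_sign a b) (create n b t (annih n a s f)) + (if a = b \<and> s = t then f else 0)) A"
  proof (cases "is_pos a \<and> is_pos b")
    case True
    show ?thesis
    proof (cases "?x = ?y")
      case eq: True
      then have "a = b \<and> s = t" using True fermi_inject by blast
      then show ?thesis using True
        by (auto simp: annih_def create_def swap_sign_def scale_zero_right insert_absorb
          fsign_insert fsign_remove fsign_square_mult scale_minus_left scale_one)
    next
      case neq: False
      then have "\<not> (a = b \<and> s = t)" by auto
      moreover have "insert ?x A - {?y} = insert ?x (A - {?y})" using neq by auto
      ultimately show ?thesis using True neq
        by (auto simp: annih_def create_def swap_sign_def scale_minus_left scale_one fsign_insert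
          fsign_remove algebra_simps scale_zero_right)
    qed
  next
    case False
    show ?thesis
    proof (cases "is_pos a \<or> is_pos b")
      case True
      with False show ?thesis
        by (auto simp: annih_def create_def swap_sign_def scale_one algebra_simps fsign_mult_partial)
    next
      case False
      then show ?thesis using row_index_inject[OF assms]
        by (auto simp: annih_def create_def swap_sign_def scale_one partial_var_mult)
    qed
  qed
qed

section \<open>Polarizations satisfy the relations of the Lie superalgebra\<close>

definition polar :: "nat \<Rightarrow> nat \<Rightarrow> sym \<Rightarrow> sym \<Rightarrow> fock \<Rightarrow> fock" where
  "polar n d a b f = (\<Sum>t = 1..d. create n a t (annih n b t f))"

lemma linear_polar: "linear_op (polar n d a b)"
  unfolding polar_def by (intro linear_op_sumI linear_op_comp[OF linear_create linear_annih])

definition bracket_sign :: "sym \<Rightarrow> sym \<Rightarrow> sym \<Rightarrow> sym \<Rightarrow> complex" where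
  "bracket_sign a b c d = (- 1) ^ ((parity a + parity b) * (parity c + parity d))"

text \<open>Moving one quadratic operator past another takes four exchanges of elementary operators;
  their signs multiply to the sign in the superbracket.\<close>

lemma bracket_sign_swap_sign:
  "bracket_sign a b c d = swap_sign a c * swap_sign a d * swap_sign b c * swap_sign b d"
  by (cases a; cases b; cases c; cases d) (auto simp: bracket_sign_def swap_sign_def)

lemma swap_sign_square: "swap_sign a b * swap_sign a b = 1"
  by (simp add: swap_sign_def)

lemma create_annih:
  assumes "a \<in> alphabet m0 m1 n" "b \<in> alphabet m0 m1 n"
  shows "create n b t (annih n a s f) =
    scl (swap_sign a b) (annih n a s (create n b t f) - (if a = b \<and> s = t then f else 0))"
  unfolding annih_create[OF assms] by (simp add: scl_simps swap_sign_square)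

text \<open>The four places are kept independent because two actions are derived from this identity:
  polarizations on the left, where the places agree in each quadratic operator, and the right action
  of gl(d), where the symbols agree.\<close>

lemma bilinear_super_commute:
  assumes "{a, b, c, e} \<subseteq> alphabet m0 m1 n"
  shows "create n a s (annih n b s' (create n c t (annih n e t' f))) =
    scl (bracket_sign a b c e) (create n c t (annih n e t' (create n a s (annih n b s' f))))
    + (if b = c \<and> s' = t then create n a s (annih n e t' f) else 0)
    - scl (bracket_sign a b c e) (if a = e \<and> s = t' then create n c t (annih n b s' f) else 0)"
proof -
  have alph: "a \<in> alphabet m0 m1 n" "b \<in> alphabet m0 m1 n" "c \<in> alphabet m0 m1 n" "e \<in> alphabet m0 m1 n"
    using assms by auto
  note lin = linear_op_simps[OF linear_create] linear_op_simps[OF linear_annih]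
  have "create n a s (annih n b s' (create n c t (annih n e t' f))) =
     scl (swap_sign b c) (create n a s (create n c t (annih n b s' (annih n e t' f))))
     + (if b = c \<and> s' = t then create n a s (annih n e t' f) else 0)"
    by (subst annih_create[OF alph(2,3)]) (simp add: lin)
  also have "create n a s (create n c t (annih n b s' (annih n e t' f))) =
     scl (swap_sign a c * swap_sign b e) (create n c t (create n a s (annih n e t' (annih n b s' f))))"
    by (subst create_create, subst annih_annih) (simp add: lin scl_simps)
  also have "create n a s (annih n e t' (annih n b s' f)) =
     scl (swap_sign a e) (annih n e t' (create n a s (annih n b s' f)) -
       (if a = e \<and> s = t' then annih n b s' f else 0))"
    by (subst create_annih[OF alph(4,1)]) (auto simp: swap_sign_def)
  finally show ?thesis
    by (auto simp: lin scl_simps bracket_sign_swap_sign mult_ac)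
qed

theorem polar_super_commute:
  assumes "{a, b, c, e} \<subseteq> alphabet m0 m1 n"
  shows "polar n d a b (polar n d c e f) =
    scl (bracket_sign a b c e) (polar n d c e (polar n d a b f))
    + (if b = c then polar n d a e f else 0)
    - scl (bracket_sign a b c e) (if a = e then polar n d c b f else 0)"
proof -
  let ?s = "bracket_sign a b c e"
  note lin = linear_op_sum[OF linear_create] linear_op_sum[OF linear_annih]
  have "polar n d a b (polar n d c e f) =
    (\<Sum>s = 1..d. \<Sum>t = 1..d. create n a s (annih n b s (create n c t (annih n e t f))))"
    by (simp add: polar_def lin)
  also have "\<dots> = scl ?s (\<Sum>s = 1..d. \<Sum>t = 1..d. create n c t (annih n e t (create n a s (annih n b s f))))
     + (\<Sum>s = 1..d. \<Sum>t = 1..d. if b = c \<and> s = t then create n a s (annih n e t f) else 0)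
     - scl ?s (\<Sum>s = 1..d. \<Sum>t = 1..d. if a = e \<and> s = t then create n c t (annih n b s f) else 0)"
    by (subst bilinear_super_commute[OF assms]) (simp add: sum.distrib sum_subtractf scl_sum)
  also have "(\<Sum>s = 1..d. \<Sum>t = 1..d. if b = c \<and> s = t then create n a s (annih n e t f) else 0) =
     (if b = c then polar n d a e f else 0)"
    by (simp add: polar_def)
  also have "(\<Sum>s = 1..d. \<Sum>t = 1..d. if a = e \<and> s = t then create n c t (annih n b s f) else 0) =
     (if a = e then polar n d c b f else 0)"
    by (simp add: polar_def)
  also have "(\<Sum>s = 1..d. \<Sum>t = 1..d. create n c t (annih n e t (create n a s (annih n b s f)))) =
     polar n d c e (polar n d a b f)"
    unfolding polar_def lin by (rule sum.swap)
  finally show ?thesis .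
qed

section \<open>Degrees\<close>

lemma lookup_var_mult:
  "lookup (var i t * p) m =
    (if lookup m (i, t) = 0 then 0 else lookup p (m - Poly_Mapping.single (i, t) 1))"
proof (induction p rule: poly_mapping_monomial_induct)
  case (single k b)
  let ?e = "Poly_Mapping.single (i, t) (1::nat)"
  have *: "?e + k = m \<longleftrightarrow> lookup m (i, t) \<noteq> 0 \<and> k = m - ?e"
  proof
    assume "?e + k = m"
    then show "lookup m (i, t) \<noteq> 0 \<and> k = m - ?e"
      by (auto simp: lookup_add)
  next
    assume "lookup m (i, t) \<noteq> 0 \<and> k = m - ?e"
    then show "?e + k = m"
      by (intro poly_mapping_eqI) (auto simp: lookup_add lookup_minus lookup_single when_def)
  qed
  show ?case
    using * by (auto simp: var_def mult_single lookup_single when_def)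
qed (auto simp: distrib_left lookup_add)

lemma lookup_partial:
  "lookup (partial v p) m =
    lookup p (m + Poly_Mapping.single v 1) * of_nat (lookup m v + 1)"
proof (induction p rule: poly_mapping_monomial_induct)
  case (single k b)
  show ?case
  proof (cases "lookup k v = 0")
    case True
    then have "k \<noteq> m + Poly_Mapping.single v 1" by (auto simp: lookup_add)
    with True show ?thesis by (simp add: partial_single lookup_single)
  next
    case False
    have "k - Poly_Mapping.single v 1 = m \<longleftrightarrow> k = m + Poly_Mapping.single v 1"
    proof
      assume "k - Poly_Mapping.single v 1 = m"
      then have "m + Poly_Mapping.single v 1 = k - Poly_Mapping.single v 1 + Poly_Mapping.single v 1" by simp
      also have "\<dots> = k" using False
        by (intro poly_mapping_eqI) (auto simp: lookup_add lookup_minus lookup_single when_def)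
      finally show "k = m + Poly_Mapping.single v 1" ..
    qed simp
    then show ?thesis by (auto simp: partial_single lookup_single when_def lookup_add)
  qed
qed (simp add: partial_add lookup_add distrib_right)

definition occ :: "nat \<Rightarrow> nat set \<Rightarrow> ((nat \<times> nat) \<Rightarrow>\<^sub>0 nat) \<Rightarrow> sym \<Rightarrow> nat \<Rightarrow> nat" where
  "occ n A m a t = (if is_pos a then if fermi a t \<in> A then 1 else 0
     else lookup m (row_index n a, t))"

lemma fsign_cases: obtains "fsign x A = 1" | "fsign x A = - 1"
  by (cases "even (card {y\<in>A. y < x})") (auto simp: fsign_def)

lemma lookup_fsign_mult_eq_0: "lookup (fsign x A * p) m = 0 \<longleftrightarrow> lookup p m = 0"
  by (rule fsign_cases[of x A]) auto

lemma create_support: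
  assumes a: "a \<in> alphabet m0 m1 n" and nz: "lookup (amp (create n a t f) A) m \<noteq> 0"
  obtains A' m' where "lookup (amp f A') m' \<noteq> 0"
    "\<And>c s. c \<in> alphabet m0 m1 n \<Longrightarrow> occ n A m c s = occ n A' m' c s + (if c = a \<and> s = t then 1 else 0)"
proof (cases "is_pos a")
  case True
  from nz True have in_A: "fermi a t \<in> A" by (auto simp: create_def split: if_splits)
  from nz True in_A have "lookup (amp f (A - {fermi a t})) m \<noteq> 0"
    by (simp add: create_def lookup_fsign_mult_eq_0)
  moreover have "occ n A m c s = occ n (A - {fermi a t}) m c s + (if c = a \<and> s = t then 1 else 0)" for c s
    using True in_A fermi_inject[of c a s t] by (auto simp: occ_def)
  ultimately show ?thesis using that by blast
next
  case False
  let ?e = "Poly_Mapping.single (row_index n a, t) (1::nat)"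
  from nz False have *: "lookup m (row_index n a, t) \<noteq> 0"
      "lookup (amp f A) (m - ?e) \<noteq> 0"
    by (auto simp: create_def lookup_var_mult split: if_splits)
  have "occ n A m c s = occ n A (m - ?e) c s + (if c = a \<and> s = t then 1 else 0)"
    if "c \<in> alphabet m0 m1 n" for c s
    using False *(1) row_index_inject[OF a that]
    by (auto simp: occ_def lookup_minus lookup_single when_def)
  with *(2) show ?thesis using that by blast
qed

lemma annih_support:
  assumes a: "a \<in> alphabet m0 m1 n" and nz: "lookup (amp (annih n a t f) A) m \<noteq> 0"
  obtains A' m' where "lookup (amp f A') m' \<noteq> 0"
    "\<And>c s. c \<in> alphabet m0 m1 n \<Longrightarrow> occ n A' m' c s = occ n A m c s + (if c = a \<and> s = t then 1 else 0)"
proof (cases "is_pos a")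
  case True
  from nz True have in_A: "fermi a t \<notin> A" by (auto simp: annih_def split: if_splits)
  from nz True in_A have "lookup (amp f (insert (fermi a t) A)) m \<noteq> 0"
    by (simp add: annih_def lookup_fsign_mult_eq_0)
  moreover have "occ n (insert (fermi a t) A) m c s = occ n A m c s + (if c = a \<and> s = t then 1 else 0)" for c s
    using True in_A fermi_inject[of c a s t] by (auto simp: occ_def)
  ultimately show ?thesis using that by blast
next
  case False
  let ?e = "Poly_Mapping.single (row_index n a, t) (1::nat)"
  from nz False have *: "lookup (amp f A) (m + ?e) \<noteq> 0"
    by (auto simp: annih_def lookup_partial)
  have "occ n A (m + ?e) c s = occ n A m c s + (if c = a \<and> s = t then 1 else 0)"
    if "c \<in> alphabet m0 m1 n" for c s
    using False row_index_inject[OF a that]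
    by (auto simp: occ_def lookup_add lookup_single when_def)
  with * show ?thesis using that by blast
qed

lemma amp_sum: "amp (\<Sum>i\<in>I. f i) A = (\<Sum>i\<in>I. amp (f i) A)"
  by (induction I rule: infinite_finite_induct) auto

text \<open>Knowledge of supports is enough for both later uses. The trade of (b|t) for (a|t)
  changes the degrees of the two symbols by one and stays within the column t, so column totals over
  sets containing both symbols are preserved.\<close>

lemma polar_support:
  assumes ab: "a \<in> alphabet m0 m1 n" "b \<in> alphabet m0 m1 n"
    and nz: "lookup (amp (polar n d a b f) A) m \<noteq> 0"
  obtains A' m' t where "lookup (amp f A') m' \<noteq> 0" "t \<in> {1..d}" "occ n A' m' b t \<ge> 1"
    "\<And>c s. c \<in> alphabet m0 m1 n \<Longrightarrow> occ n A m c s + (if c = b \<and> s = t then 1 else 0)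
       = occ n A' m' c s + (if c = a \<and> s = t then 1 else 0)"
proof -
  have "(\<Sum>t = 1..d. lookup (amp (create n a t (annih n b t f)) A) m) \<noteq> 0"
    using nz by (simp add: polar_def amp_sum lookup_sum)
  then obtain t where t: "t \<in> {1..d}" "lookup (amp (create n a t (annih n b t f)) A) m \<noteq> 0"
    by (metis (no_types, lifting) sum.neutral)
  from create_support[OF ab(1) t(2)] obtain A1 m1' where 1: "lookup (amp (annih n b t f) A1) m1' \<noteq> 0"
    "\<And>c s. c \<in> alphabet m0 m1 n \<Longrightarrow> occ n A m c s = occ n A1 m1' c s + (if c = a \<and> s = t then 1 else 0)"
    by blast
  from annih_support[OF ab(2) 1(1)] obtain A' m' where 2: "lookup (amp f A') m' \<noteq> 0"
    "\<And>c s. c \<in> alphabet m0 m1 n \<Longrightarrow> occ n A' m' c s = occ n A1 m1' c s + (if c = b \<and> s = t then 1 else 0)"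
    by blast
  show ?thesis
  proof (rule that[OF 2(1) t(1)])
    show "occ n A' m' b t \<ge> 1" using 2(2)[OF ab(2), of t] by simp
    show "occ n A m c s + (if c = b \<and> s = t then 1 else 0) = occ n A' m' c s + (if c = a \<and> s = t then 1 else 0)"
      if "c \<in> alphabet m0 m1 n" for c s
      using 1(2)[OF that, of s] 2(2)[OF that, of s] by simp
  qed
qed

text \<open>The degree is an integer so that weights can be subtracted freely; the zero vector has
  every degree.\<close>

definition has_degree :: "nat \<Rightarrow> nat \<Rightarrow> sym \<Rightarrow> int \<Rightarrow> fock \<Rightarrow> bool" where
  "has_degree n d c k f \<longleftrightarrow>
     (\<forall>A m. lookup (amp f A) m \<noteq> 0 \<longrightarrow> (\<Sum>t = 1..d. int (occ n A m c t)) = k)"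

lemma has_degree_polar:
  assumes abc: "a \<in> alphabet m0 m1 n" "b \<in> alphabet m0 m1 n" "c \<in> alphabet m0 m1 n"
    and deg: "has_degree n d c k f"
  shows "has_degree n d c (k + of_bool (a = c) - of_bool (b = c)) (polar n d a b f)"
  unfolding has_degree_def
proof (intro allI impI)
  fix A m assume "lookup (amp (polar n d a b f) A) m \<noteq> 0"
  from polar_support[OF abc(1,2) this] obtain A' m' t where
    *: "lookup (amp f A') m' \<noteq> 0" "t \<in> {1..d}"
      "\<And>s. occ n A m c s + (if c = b \<and> s = t then 1 else 0) = occ n A' m' c s + (if c = a \<and> s = t then 1 else 0)"
    using abc(3) by metis
  have "int (occ n A m c s) = int (occ n A' m' c s) +
      (if s = t then of_bool (a = c) - of_bool (b = c) else 0)" for s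
    using *(3)[of s] by (auto split: if_splits)
  then have "(\<Sum>s = 1..d. int (occ n A m c s)) = (\<Sum>s = 1..d. int (occ n A' m' c s)) +
      (\<Sum>s = 1..d. if s = t then of_bool (a = c) - of_bool (b = c) else 0)"
    by (simp add: sum.distrib)
  also have "(\<Sum>s = 1..d. int (occ n A' m' c s)) = k" using deg *(1) by (auto simp: has_degree_def)
  finally show "(\<Sum>s = 1..d. int (occ n A m c s)) = k + of_bool (a = c) - of_bool (b = c)"
    using *(2) by simp
qed

lemma fock_eq_0I: "(\<And>A m. lookup (amp f A) m = 0) \<Longrightarrow> f = 0"
  by (intro fock_eqI poly_mapping_eqI) simp

lemma has_degree_nonpos_polar:
  assumes ab: "a \<in> alphabet m0 m1 n" "b \<in> alphabet m0 m1 n" and deg: "has_degree n d b k f" "k \<le> 0"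
  shows "polar n d a b f = 0"
proof (rule fock_eq_0I, rule ccontr)
  fix A m assume "lookup (amp (polar n d a b f) A) m \<noteq> 0"
  from polar_support[OF ab this] obtain A' m' t where
    *: "lookup (amp f A') m' \<noteq> 0" "t \<in> {1..d}" "occ n A' m' b t \<ge> 1"
    by metis
  have "1 \<le> int (occ n A' m' b t)" using *(3) by simp
  also have "\<dots> \<le> (\<Sum>s = 1..d. int (occ n A' m' b s))"
    using *(2) by (intro member_le_sum) auto
  also have "\<dots> = k" using deg *(1) by (auto simp: has_degree_def)
  finally show False using deg(2) by simp
qed

text \<open>The number operator. In the odd case the two signs agree because a code is not counted
  below itself.\<close>

lemma create_annih_diagonal:
  "lookup (amp (create n a t (annih n a t f)) A) m =
    of_nat (occ n A m a t) * lookup (amp f A) m"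
proof (cases "is_pos a")
  case True
  show ?thesis
  proof (cases "fermi a t \<in> A")
    case in_A: True
    have "fsign (fermi a t) (A - {fermi a t}) = fsign (fermi a t) A"
      using fsign_remove[OF in_A, of "fermi a t"] by simp
    then show ?thesis using True in_A
      by (simp add: create_def annih_def occ_def insert_absorb fsign_square_mult)
  qed (use True in \<open>simp add: create_def annih_def occ_def\<close>)
next
  case False
  let ?v = "(row_index n a, t)"
  have "lookup m ?v \<noteq> 0 \<Longrightarrow> m - Poly_Mapping.single ?v 1 + Poly_Mapping.single ?v 1 = m"
    by (intro poly_mapping_eqI) (auto simp: lookup_add lookup_minus lookup_single when_def)
  with False show ?thesis
    by (auto simp: create_def annih_def occ_def lookup_var_mult lookup_partial lookup_minus of_nat_diff)
qed

lemma lookup_scale: "lookup (scale c p) m = c * lookup p m"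
proof (induction p rule: poly_mapping_monomial_induct)
  case (single k b)
  show ?case by (simp add: scale_def mult_single lookup_single when_def)
qed (simp add: scale_add_right lookup_add distrib_left)

lemma has_degree_polar_diagonal:
  assumes "has_degree n d a k f"
  shows "polar n d a a f = scl (of_int k) f"
proof (intro fock_eqI poly_mapping_eqI)
  fix A m
  have "lookup (amp (polar n d a a f) A) m =
      of_int (\<Sum>t = 1..d. int (occ n A m a t)) * lookup (amp f A) m"
    by (simp add: polar_def amp_sum lookup_sum create_annih_diagonal sum_distrib_right)
  also have "\<dots> = of_int k * lookup (amp f A) m"
    using assms by (cases "lookup (amp f A) m = 0") (auto simp: has_degree_def)
  finally show "lookup (amp (polar n d a a f) A) m = lookup (amp (scl (of_int k) f) A) m"
    by (simp add: lookup_scale)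
qed

section \<open>Words of polarizations and irregular products\<close>

definition word_op :: "nat \<Rightarrow> nat \<Rightarrow> (sym \<times> sym) list \<Rightarrow> fock \<Rightarrow> fock" where
  "word_op n d w f = foldr (\<lambda>(a, b). polar n d a b) w f"

lemma word_op_simps [simp]:
  "word_op n d [] f = f"
  "word_op n d ((a, b) # w) f = polar n d a b (word_op n d w f)"
  "word_op n d (u @ w) f = word_op n d u (word_op n d w f)"
  by (simp_all add: word_op_def)

lemma linear_word_op: "linear_op (word_op n d w)"
proof (induction w)
  case (Cons x w)
  then show ?case using linear_op_comp[OF linear_polar Cons] by (cases x) simp
qed (simp add: linear_op_def)

lemma has_degree_word_op:
  assumes "set w \<subseteq> alphabet m0 m1 n \<times> alphabet m0 m1 n" "c \<in> alphabet m0 m1 n" "has_degree n d c k f"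
  shows "has_degree n d c (k + int (count_list (map fst w) c) - int (count_list (map snd w) c)) (word_op n d w f)"
  using assms(1)
proof (induction w)
  case (Cons x w)
  obtain a b where x: "x = (a, b)" by (cases x)
  have "has_degree n d c (k + int (count_list (map fst w) c) - int (count_list (map snd w) c)
      + of_bool (a = c) - of_bool (b = c)) (polar n d a b (word_op n d w f))"
    using Cons.prems x by (intro has_degree_polar[OF _ _ assms(2) Cons.IH]) auto
  then show ?case unfolding x by (auto split: if_splits simp: algebra_simps)
qed (use assms in simp)

lemma word_op_zero: "word_op n d w 0 = 0"
  using linear_op_zero[OF linear_word_op] .

definition emb :: "cpoly \<Rightarrow> fock" where
  "emb p = Fock (\<lambda>A. if A = {} then p else 0)"

definition proper :: "nat \<Rightarrow> cpoly \<Rightarrow> bool" where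
  "proper n p \<longleftrightarrow> (\<forall>m\<in>keys p. keys m \<subseteq> {1..n} \<times> UNIV)"

lemma has_degree_emb_virtual:
  assumes "proper n p" "c \<in> virtuals m0 m1"
  shows "has_degree n d c 0 (emb p)"
  unfolding has_degree_def
proof (intro allI impI)
  fix A m assume nz: "lookup (amp (emb p) A) m \<noteq> 0"
  then have A: "A = {}" and m: "m \<in> keys p"
    by (auto simp: emb_def in_keys_iff split: if_splits)
  have "occ n A m c t = 0" for t
  proof (cases c)
    case (Neg j)
    then have "(n + j, t) \<notin> {1..n} \<times> UNIV" using assms(2) by (auto simp: virtuals_def)
    moreover have "keys m \<subseteq> {1..n} \<times> UNIV" using m assms(1) by (simp add: proper_def)
    ultimately have "(n + j, t) \<notin> keys m" by blast
    then show ?thesis using Neg by (simp add: occ_def in_keys_iff)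
  qed (use A assms(2) in \<open>auto simp: occ_def virtuals_def\<close>)
  then show "(\<Sum>t = 1..d. int (occ n A m c t)) = 0" by simp
qed

text \<open>Irregularity in the form in which it is used: v acts first and leaves no symbol c for
  the factor (a, c) to remove.\<close>

lemma irregular_split:
  assumes "irregular m0 m1 w"
  obtains u a c v where "w = u @ (a, c) # v" "c \<in> virtuals m0 m1"
    "count_list (map fst v) c \<le> count_list (map snd v) c"
proof -
  define P where "P i \<gamma> \<longleftrightarrow> i \<in> {1..length w} \<and> \<gamma> \<in> virtuals m0 m1 \<and>
    card {j \<in> {1..i}. snd (rev w ! (j - 1)) = \<gamma>} > card {j \<in> {1..<i}. fst (rev w ! (j - 1)) = \<gamma>}" for i \<gamma>
  from assms obtain i0 \<gamma> where "P i0 \<gamma>" by (auto simp: irregular_def P_def)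
  then have ex: "\<exists>i. P i \<gamma>" by blast
  \<comment> \<open>At the least violating index the second symbol is \<gamma> itself; otherwise the
    preceding index would violate the count already.\<close>
  define i where "i = (LEAST i. P i \<gamma>)"
  have Pi: "P i \<gamma>" unfolding i_def using ex by (rule LeastI_ex)
  have least: "\<not> P k \<gamma>" if "k < i" for k using that not_less_Least unfolding i_def by blast
  obtain k where i: "i = Suc k" using Pi by (cases i) (auto simp: P_def)
  have k: "k < length w" using Pi i by (auto simp: P_def)
  have cnt: "card {j \<in> {1..<Suc l}. g (rev w ! (j - 1)) = \<gamma>} = count_list (map g (take l (rev w))) \<gamma>"
    if "l \<le> length w" for g :: "sym \<times> sym \<Rightarrow> sym" and l
    using that
  proof (induction l)
    case (Suc l)
    have "{j \<in> {1..<Suc (Suc l)}. g (rev w ! (j - 1)) = \<gamma>} =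
      {j \<in> {1..<Suc l}. g (rev w ! (j - 1)) = \<gamma>} \<union> (if g (rev w ! l) = \<gamma> then {Suc l} else {})"
      by (auto simp: less_Suc_eq)
    then have "card {j \<in> {1..<Suc (Suc l)}. g (rev w ! (j - 1)) = \<gamma>} =
      card {j \<in> {1..<Suc l}. g (rev w ! (j - 1)) = \<gamma>} + of_bool (g (rev w ! l) = \<gamma>)"
      by auto
    then show ?case using Suc by (simp add: take_Suc_conv_app_nth)
  qed simp
  let ?v = "rev (take k (rev w))"
  obtain a b where ab: "rev w ! k = (a, b)" by (cases "rev w ! k")
  have w: "w = rev (drop (Suc k) (rev w)) @ (a, b) # ?v"
  proof -
    have "rev w = take k (rev w) @ rev w ! k # drop (Suc k) (rev w)"
      using k by (intro id_take_nth_drop) simp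
    then have "rev (rev w) = rev (take k (rev w) @ rev w ! k # drop (Suc k) (rev w))" by simp
    then show ?thesis by (simp add: ab)
  qed
  have count_v: "count_list (map g ?v) \<gamma> = count_list (map g (take k (rev w))) \<gamma>" for g :: "sym \<times> sym \<Rightarrow> sym"
    by (simp flip: rev_map)
  have 1: "count_list (map snd (take (Suc k) (rev w))) \<gamma> > count_list (map fst (take k (rev w))) \<gamma>"
    using Pi k cnt[of "Suc k" snd] cnt[of k fst] unfolding P_def i
    by (simp add: atLeastLessThanSuc_atLeastAtMost)
  have 2: "count_list (map snd (take (Suc k) (rev w))) \<gamma> = count_list (map snd (take k (rev w))) \<gamma> + of_bool (b = \<gamma>)"
    using k ab by (simp add: take_Suc_conv_app_nth)
  have b: "b = \<gamma>"
  proof (rule ccontr)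
    assume "b \<noteq> \<gamma>"
    with 1 2 have 3: "count_list (map snd (take k (rev w))) \<gamma> > count_list (map fst (take k (rev w))) \<gamma>" by simp
    then obtain l where l: "k = Suc l" by (cases k) auto
    have "count_list (map fst (take l (rev w))) \<gamma> \<le> count_list (map fst (take k (rev w))) \<gamma>"
      using k l by (simp add: take_Suc_conv_app_nth)
    with 3 have "P k \<gamma>"
      using k cnt[of k snd] cnt[of l fst] Pi unfolding P_def l
      by (simp add: atLeastLessThanSuc_atLeastAtMost)
    then show False using least[of k] i by simp
  qed
  show ?thesis
  proof (rule that)
    show "w = rev (drop (Suc k) (rev w)) @ (a, \<gamma>) # ?v" using w b by simp
    show "\<gamma> \<in> virtuals m0 m1" using Pi by (simp add: P_def)
    show "count_list (map fst ?v) \<gamma> \<le> count_list (map snd ?v) \<gamma>"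
      using 1 2 b unfolding count_v by simp
  qed
qed

lemma irregular_word_op:
  assumes "irregular m0 m1 w" "set w \<subseteq> alphabet m0 m1 n \<times> alphabet m0 m1 n" "proper n p"
  shows "word_op n d w (emb p) = 0"
proof -
  from irregular_split[OF assms(1)] obtain u a c v where
    w: "w = u @ (a, c) # v" "c \<in> virtuals m0 m1" "count_list (map fst v) c \<le> count_list (map snd v) c" .
  have alph: "a \<in> alphabet m0 m1 n" "c \<in> alphabet m0 m1 n" "set v \<subseteq> alphabet m0 m1 n \<times> alphabet m0 m1 n"
    using assms(2) w(1) by auto
  have "polar n d a c (word_op n d v (emb p)) = 0"
    by (rule has_degree_nonpos_polar[OF alph(1,2)
          has_degree_word_op[OF alph(3,2) has_degree_emb_virtual[OF assms(3) w(2)]]])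
      (use w(3) in simp)
  then show ?thesis by (simp add: w(1) word_op_zero)
qed

section \<open>The action of the enveloping superalgebra and devirtualization\<close>

lemma free_alg_simps [simp]:
  "monoid.mult (free_alg A) = (*)" "one (free_alg A) = 1" "zero (free_alg A) = 0" "add (free_alg A) = (+)"
  by (simp_all add: free_alg_def)

lemma free_alg_carrier:
  "x \<in> carrier (free_alg A) \<longleftrightarrow> (\<forall>w\<in>keys x. set (word_list w) \<subseteq> A \<times> A)"
  by (simp add: free_alg_def)

lemma free_alg_mono: "A \<subseteq> B \<Longrightarrow> carrier (free_alg A) \<subseteq> carrier (free_alg B)"
  by (force simp: free_alg_carrier)

lemma free_alg_closed:
  assumes "x \<in> carrier (free_alg A)" "y \<in> carrier (free_alg A)"
  shows "x + y \<in> carrier (free_alg A)" "x * y \<in> carrier (free_alg A)" "- x \<in> carrier (free_alg A)"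
    "x - y \<in> carrier (free_alg A)"
proof -
  have add: "x + y \<in> carrier (free_alg A)" if "y \<in> carrier (free_alg A)" for y
    using assms(1) that keys_add[of x y] by (auto simp: free_alg_carrier)
  have minus: "- y \<in> carrier (free_alg A)" if "y \<in> carrier (free_alg A)" for y
    using that by (auto simp: free_alg_carrier)
  show "x + y \<in> carrier (free_alg A)" by (rule add[OF assms(2)])
  show "- x \<in> carrier (free_alg A)" by (rule minus[OF assms(1)])
  show "x - y \<in> carrier (free_alg A)" using add[OF minus[OF assms(2)]] by simp
  show "x * y \<in> carrier (free_alg A)"
    unfolding free_alg_carrier
  proof
    fix w assume "w \<in> keys (x * y)"
    then obtain u v where "u \<in> keys x" "v \<in> keys y" "w = u + v"
      using keys_mult[of x y] by blast
    with assms show "set (word_list w) \<subseteq> A \<times> A"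
      by (auto simp: free_alg_carrier plus_free_word_def)
  qed
qed

lemma free_alg_consts [simp]: "0 \<in> carrier (free_alg A)" "1 \<in> carrier (free_alg A)"
  by (auto simp: free_alg_carrier zero_free_word_def simp flip: single_one)

lemma ring_free_alg: "ring (free_alg A)"
proof (rule ringI)
  show "abelian_group (free_alg A)"
  proof (rule abelian_groupI)
    fix x assume "x \<in> carrier (free_alg A)"
    then show "\<exists>y\<in>carrier (free_alg A). y \<oplus>\<^bsub>free_alg A\<^esub> x = \<zero>\<^bsub>free_alg A\<^esub>"
      by (intro bexI[of _ "- x"]) (auto simp: free_alg_closed)
  qed (auto simp: free_alg_closed add_ac)
  show "Group.monoid (free_alg A)"
    by (rule monoidI) (auto simp: free_alg_closed mult.assoc)
qed (auto simp: algebra_simps)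

lemma free_alg_a_inv:
  assumes "y \<in> carrier (free_alg A)" shows "\<ominus>\<^bsub>free_alg A\<^esub> y = - y"
proof -
  interpret ring "free_alg A" by (rule ring_free_alg)
  show ?thesis using assms by (intro minus_equality) (auto simp: free_alg_closed)
qed

lemma free_alg_minus:
  assumes "y \<in> carrier (free_alg A)" shows "x \<ominus>\<^bsub>free_alg A\<^esub> y = x - y"
  using assms by (simp add: a_minus_def free_alg_a_inv)

section \<open>Noncommutative polynomials as operators\<close>

definition mon :: "(sym \<times> sym) list \<Rightarrow> nc_poly" where
  "mon w = Poly_Mapping.single (FWord w) 1"

lemma mon_append: "mon (u @ v) = mon u * mon v"
  by (simp add: mon_def mult_single plus_free_word_def)

lemma mon_Nil: "mon [] = 1"
  by (simp add: mon_def flip: zero_free_word_def)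

lemma gen_mon: "gen a b = mon [(a, b)]"
  by (simp add: gen_def mon_def)

lemma mon_Cons: "mon ((a, b) # w) = gen a b * mon w"
  using mon_append[of "[(a, b)]" w] by (simp add: gen_mon)

lemma mon_carrier: "set w \<subseteq> A \<times> A \<Longrightarrow> mon w \<in> carrier (free_alg A)"
  by (auto simp: free_alg_carrier mon_def)

definition nc_op :: "nat \<Rightarrow> nat \<Rightarrow> nc_poly \<Rightarrow> fock \<Rightarrow> fock" where
  "nc_op n d x f = (\<Sum>w\<in>keys x. scl (lookup x w) (word_op n d (word_list w) f))"

lemma nc_op_superset:
  assumes "finite K" "keys x \<subseteq> K"
  shows "nc_op n d x f = (\<Sum>w\<in>K. scl (lookup x w) (word_op n d (word_list w) f))"
  unfolding nc_op_def using assms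
  by (intro sum.mono_neutral_left) (auto simp: in_keys_iff scl_simps)

lemma nc_op_add: "nc_op n d (x + y) f = nc_op n d x f + nc_op n d y f"
proof -
  let ?K = "keys x \<union> keys y"
  have "nc_op n d (x + y) f = (\<Sum>w\<in>?K. scl (lookup (x + y) w) (word_op n d (word_list w) f))"
    by (intro nc_op_superset) (auto simp: in_keys_iff lookup_add)
  then show ?thesis
    by (simp add: nc_op_superset[of ?K x] nc_op_superset[of ?K y] lookup_add scl_add_left sum.distrib)
qed

lemma nc_op_single: "nc_op n d (Poly_Mapping.single w c) f = scl c (word_op n d (word_list w) f)"
  by (subst nc_op_superset[of "{w}"]) auto

lemma nc_op_mon: "nc_op n d (mon w) f = word_op n d w f"
  by (simp add: mon_def nc_op_single scl_simps)

lemma nc_op_zero: "nc_op n d 0 f = 0"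
  by (simp add: nc_op_def)

lemma nc_op_minus: "nc_op n d (- x) f = - nc_op n d x f"
  using nc_op_add[of n d x "- x" f] by (simp add: nc_op_zero eq_neg_iff_add_eq_0 add.commute)

lemma nc_op_diff: "nc_op n d (x - y) f = nc_op n d x f - nc_op n d y f"
  using nc_op_add[of n d x "- y" f] by (simp add: nc_op_minus)

lemma linear_nc_op: "linear_op (nc_op n d x)"
  unfolding nc_op_def
  by (intro linear_op_sumI) (auto simp: linear_op_def linear_op_simps[OF linear_word_op] scl_simps mult.commute)

lemma nc_poly_induct [case_names single add]:
  fixes x :: nc_poly
  assumes "\<And>w c. P (Poly_Mapping.single w c)" and "\<And>x y. P x \<Longrightarrow> P y \<Longrightarrow> P (x + y)"
  shows "P x"
proof (induction x rule: Poly_Mapping.update_induct)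
  case const
  show ?case using assms(1)[of undefined 0] by simp
next
  case (update f a b)
  have "Poly_Mapping.update a b f = f + Poly_Mapping.single a b"
    using update(1) by (intro poly_mapping_eqI)
      (auto simp: lookup_update lookup_add lookup_single when_def in_keys_iff)
  then show ?case using assms update by simp
qed

lemma nc_op_mult: "nc_op n d (x * y) f = nc_op n d x (nc_op n d y f)"
proof (induction x rule: nc_poly_induct)
  case (single u a)
  show ?case
  proof (induction y rule: nc_poly_induct)
    case (single v b)
    show ?case
      by (simp add: mult_single nc_op_single plus_free_word_def linear_op_simps[OF linear_word_op] scl_simps mult.commute)
  qed (simp add: distrib_left nc_op_add linear_op_simps[OF linear_nc_op])
qed (simp add: distrib_right nc_op_add)

lemma nc_op_super_sign: "nc_op n d (super_sign a b c e) f = scl (bracket_sign a b c e) f"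
  unfolding super_sign_def bracket_sign_def using nc_op_mon[of n d "[]" f]
  by (cases "even ((parity a + parity b) * (parity c + parity e))")
    (simp_all add: scl_simps nc_op_minus mon_Nil)

lemma nc_op_gl_relations:
  assumes "x \<in> gl_relations (alphabet m0 m1 n)"
  shows "nc_op n d x f = 0"
proof -
  from assms obtain a b c e where x: "x = gen a b * gen c e - super_sign a b c e * gen c e * gen a b - bracket a b c e"
    and alph: "{a, b, c, e} \<subseteq> alphabet m0 m1 n"
    by (auto simp: gl_relations_def)
  show ?thesis unfolding x bracket_def
    using polar_super_commute[OF alph, of d f]
    by (auto simp: nc_op_diff nc_op_super_sign mult.assoc nc_op_mult gen_mon nc_op_mon nc_op_zero scl_simps)
qed

section \<open>Descent of the action to the enveloping superalgebra\<close>

context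
  fixes m0 m1 n :: nat
begin

abbreviation "FA \<equiv> free_alg (alphabet m0 m1 n)"
abbreviation "UA \<equiv> U_gl m0 m1 n"
abbreviation "cls \<equiv> U_class m0 m1 n"

lemma gen_carrier: "a \<in> A \<Longrightarrow> b \<in> A \<Longrightarrow> gen a b \<in> carrier (free_alg A)"
  by (simp add: gen_mon mon_carrier)

lemma super_sign_carrier: "super_sign a b c e \<in> carrier (free_alg A)"
  using free_alg_closed(3)[of 1 A 1] unfolding super_sign_def
  by (cases "even ((parity a + parity b) * (parity c + parity e))") auto

lemma gl_relations_carrier: "gl_relations (alphabet m0 m1 n) \<subseteq> carrier FA"
  by (auto simp: gl_relations_def bracket_def intro!: free_alg_closed gen_carrier super_sign_carrier)

lemma ideal_gl_ideal: "ideal (gl_ideal m0 m1 n) FA"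
  unfolding gl_ideal_def
  by (rule ring.genideal_ideal[OF ring_free_alg gl_relations_carrier])

lemma gl_relations_subset: "gl_relations (alphabet m0 m1 n) \<subseteq> gl_ideal m0 m1 n"
  unfolding gl_ideal_def
  by (rule ring.genideal_self[OF ring_free_alg gl_relations_carrier])

text \<open>The polynomials acting as zero form a two-sided ideal that contains the
  relations.\<close>

lemma nc_op_gl_ideal:
  assumes "x \<in> gl_ideal m0 m1 n" shows "nc_op n d x f = 0"
proof -
  let ?I = "{x \<in> carrier FA. \<forall>f. nc_op n d x f = 0}"
  have "ideal ?I FA"
  proof (rule idealI[OF ring_free_alg])
    show "subgroup ?I (add_monoid FA)"
    proof (rule group.subgroupI)
      show "group (add_monoid FA)"
        using ring.is_abelian_group[OF ring_free_alg] abelian_group.a_group by blast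
      show "inv\<^bsub>add_monoid FA\<^esub> x \<in> ?I" if "x \<in> ?I" for x
        using that free_alg_a_inv[of x "alphabet m0 m1 n"]
        by (auto simp: a_inv_def free_alg_closed nc_op_minus)
    qed (auto simp: free_alg_closed nc_op_add nc_op_zero intro!: exI[of _ 0])
  qed (auto simp: free_alg_closed nc_op_mult linear_op_zero[OF linear_nc_op])
  then have "gl_ideal m0 m1 n \<subseteq> ?I"
    unfolding gl_ideal_def using gl_relations_carrier nc_op_gl_relations
    by (intro ring.genideal_minimal[OF ring_free_alg]) auto
  then show ?thesis using assms by auto
qed

lemma cls_hom: "cls \<in> Ring.ring_hom FA UA"
  using ideal.rcos_ring_hom[OF ideal_gl_ideal] unfolding U_gl_def
  by (simp add: U_class_def[abs_def])

lemma ring_UA: "ring UA"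
  unfolding U_gl_def by (rule ideal.quotient_is_ring[OF ideal_gl_ideal])

lemma carrier_UA: "carrier UA = cls ` carrier FA"
  by (auto simp: U_gl_def FactRing_def A_RCOSETS_def' U_class_def)

lemma cls_simps:
  assumes "x \<in> carrier FA" "y \<in> carrier FA"
  shows "cls (x * y) = cls x \<otimes>\<^bsub>UA\<^esub> cls y" "cls (x + y) = cls x \<oplus>\<^bsub>UA\<^esub> cls y"
    "cls x \<ominus>\<^bsub>UA\<^esub> cls y = cls (x - y)" "\<ominus>\<^bsub>UA\<^esub> cls x = cls (- x)"
proof -
  show "cls (x * y) = cls x \<otimes>\<^bsub>UA\<^esub> cls y" "cls (x + y) = cls x \<oplus>\<^bsub>UA\<^esub> cls y"
    using ring_hom_mult[OF cls_hom assms] ring_hom_add[OF cls_hom assms] by simp_all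
  interpret ring_hom_ring FA UA cls
    by (rule ring_hom_ringI2[OF ring_free_alg ring_UA cls_hom])
  have inv: "\<ominus>\<^bsub>UA\<^esub> cls x = cls (- x)" if "x \<in> carrier FA" for x
    using hom_a_inv[OF that] by (simp add: free_alg_a_inv[OF that])
  show "\<ominus>\<^bsub>UA\<^esub> cls x = cls (- x)" by (rule inv[OF assms(1)])
  show "cls x \<ominus>\<^bsub>UA\<^esub> cls y = cls (x - y)"
    using hom_add[OF assms(1) free_alg_closed(3)[OF assms(2) assms(2)]]
    by (simp add: a_minus_def inv[OF assms(2)])
qed

lemma cls_eq_iff:
  assumes "x \<in> carrier FA" "y \<in> carrier FA"
  shows "cls x = cls y \<longleftrightarrow> x - y \<in> gl_ideal m0 m1 n"
  using ring.quotient_eq_iff_same_a_r_cos[OF ring_free_alg ideal_gl_ideal assms]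
  by (simp add: U_class_def free_alg_minus assms)

lemma nc_op_cls:
  assumes "x \<in> carrier FA" "y \<in> carrier FA" "cls x = cls y"
  shows "nc_op n d x f = nc_op n d y f"
  using nc_op_gl_ideal[of "x - y" d f] assms by (simp add: cls_eq_iff nc_op_diff)

lemma e_word_cls: "set w \<subseteq> alphabet m0 m1 n \<times> alphabet m0 m1 n \<Longrightarrow> e_word m0 m1 n w = cls (mon w)"
proof (induction w)
  case Nil
  show ?case using ring_hom_one[OF cls_hom] by (simp add: e_word_def list_prod_def mon_Nil)
next
  case (Cons x w)
  obtain a b where x: "x = (a, b)" by (cases x)
  show ?case using Cons x
    by (simp add: mon_Cons e_word_def list_prod_def ue_def cls_simps(1) gen_carrier mon_carrier)
qed

lemma Irr_closed:
  "additive_subgroup (Irr m0 m1 n) UA"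
  "r \<in> carrier UA \<Longrightarrow> x \<in> Irr m0 m1 n \<Longrightarrow> r \<otimes>\<^bsub>UA\<^esub> x \<in> Irr m0 m1 n"
  "set w \<subseteq> alphabet m0 m1 n \<times> alphabet m0 m1 n \<Longrightarrow> irregular m0 m1 w \<Longrightarrow> cls (mon w) \<in> Irr m0 m1 n"
proof -
  let ?X = "{e_word m0 m1 n w | w. set w \<subseteq> alphabet m0 m1 n \<times> alphabet m0 m1 n \<and> irregular m0 m1 w}"
  let ?F = "{I. additive_subgroup I UA \<and> ?X \<subseteq> I \<and> (\<forall>r\<in>carrier UA. \<forall>x\<in>I. r \<otimes>\<^bsub>UA\<^esub> x \<in> I)}"
  have Irr: "Irr m0 m1 n = \<Inter>?F" by (simp add: Irr_def left_ideal_gen_def)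
  interpret ring UA by (rule ring_UA)
  \<comment> \<open>The whole ring is one of the left ideals being intersected; so the family is
    nonempty, as the subgroup property of the intersection requires.\<close>
  have "?X \<subseteq> carrier UA" by (auto simp: e_word_cls carrier_UA mon_carrier)
  moreover have "additive_subgroup (carrier UA) UA"
    by (intro additive_subgroup.intro add.subgroup_self)
  ultimately have "carrier UA \<in> ?F" by auto
  then have ne: "?F \<noteq> {}" by blast
  show "additive_subgroup (Irr m0 m1 n) UA"
    unfolding Irr
    by (intro additive_subgroup.intro add.subgroups_Inter ne) (auto simp: additive_subgroup_def)
  show "r \<otimes>\<^bsub>UA\<^esub> x \<in> Irr m0 m1 n" if "r \<in> carrier UA" "x \<in> Irr m0 m1 n"
    using that unfolding Irr by blast
  show "cls (mon w) \<in> Irr m0 m1 n"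
    if "set w \<subseteq> alphabet m0 m1 n \<times> alphabet m0 m1 n" "irregular m0 m1 w"
  proof -
    have "cls (mon w) \<in> ?X" using that e_word_cls[OF that(1), symmetric] by blast
    then show ?thesis unfolding Irr by blast
  qed
qed

text \<open>The annihilator of \<open>emb v\<close> in the enveloping superalgebra is a left ideal,
  and irregular words belong to it.\<close>

lemma Irr_annihilates:
  assumes v: "proper n v" and u: "cls x \<in> Irr m0 m1 n" "x \<in> carrier FA"
  shows "nc_op n d x (emb v) = 0"
proof -
  \<comment> \<open>Quantifying over all representatives makes this a property of the class; by
    \<open>nc_op_cls\<close> one representative decides.\<close>
  let ?I = "{u \<in> carrier UA. \<forall>x\<in>carrier FA. cls x = u \<longrightarrow> nc_op n d x (emb v) = 0}"
  have I: "cls x \<in> ?I \<longleftrightarrow> nc_op n d x (emb v) = 0" if "x \<in> carrier FA" for x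
  proof
    assume "cls x \<in> ?I"
    then show "nc_op n d x (emb v) = 0" using \<open>x \<in> carrier FA\<close> by blast
  next
    assume *: "nc_op n d x (emb v) = 0"
    show "cls x \<in> ?I"
    proof (intro CollectI conjI ballI impI)
      show "cls x \<in> carrier UA" using \<open>x \<in> carrier FA\<close> by (auto simp: carrier_UA)
      show "nc_op n d y (emb v) = 0" if "y \<in> carrier FA" "cls y = cls x" for y
        using nc_op_cls[OF that(1) \<open>x \<in> carrier FA\<close> that(2)] * by metis
    qed
  qed
  have I_cases: "\<exists>x\<in>carrier FA. u = cls x \<and> nc_op n d x (emb v) = 0" if "u \<in> ?I" for u
    using that unfolding carrier_UA by blast
  interpret ring UA by (rule ring_UA)
  have "additive_subgroup ?I UA"
  proof (intro additive_subgroup.intro add.subgroupI)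
    show "?I \<noteq> {}" using I[of 0] by (auto simp: nc_op_zero)
    show "\<ominus>\<^bsub>UA\<^esub> u \<in> ?I" if "u \<in> ?I" for u
    proof -
      from I_cases[OF that] obtain x where x: "x \<in> carrier FA" "u = cls x" "nc_op n d x (emb v) = 0" by blast
      show "\<ominus>\<^bsub>UA\<^esub> u \<in> ?I"
        using I[OF free_alg_closed(3)[OF x(1) x(1)]] x by (simp only: cls_simps nc_op_minus) simp
    qed
    show "u \<oplus>\<^bsub>UA\<^esub> u' \<in> ?I" if u: "u \<in> ?I" and u': "u' \<in> ?I" for u u'
    proof -
      from I_cases[OF u] obtain x where x: "x \<in> carrier FA" "u = cls x" "nc_op n d x (emb v) = 0" by blast
      from I_cases[OF u'] obtain y where y: "y \<in> carrier FA" "u' = cls y" "nc_op n d y (emb v) = 0" by blast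
      have "cls (x + y) \<in> ?I"
        using I[OF free_alg_closed(1)[OF x(1) y(1)]] x y by (simp only: nc_op_add) simp
      then show ?thesis using x y by (simp add: cls_simps)
    qed
  qed auto
  moreover have "e_word m0 m1 n w \<in> ?I"
    if "set w \<subseteq> alphabet m0 m1 n \<times> alphabet m0 m1 n" "irregular m0 m1 w" for w
    using I[OF mon_carrier[OF that(1)]] irregular_word_op[OF that(2,1) v]
    by (simp only: e_word_cls[OF that(1)] nc_op_mon)
  moreover have "r \<otimes>\<^bsub>UA\<^esub> u \<in> ?I" if r: "r \<in> carrier UA" and u: "u \<in> ?I" for r u
  proof -
    from I_cases[OF u] obtain x where x: "x \<in> carrier FA" "u = cls x" "nc_op n d x (emb v) = 0" by blast
    from r obtain y where y: "y \<in> carrier FA" "r = cls y" by (auto simp: carrier_UA)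
    have "cls (y * x) \<in> ?I"
      using I[OF free_alg_closed(2)[OF y(1) x(1)]] x(3)
      by (simp only: nc_op_mult linear_op_zero[OF linear_nc_op])
    then show ?thesis using x y by (simp add: cls_simps)
  qed
  ultimately have "Irr m0 m1 n \<subseteq> ?I"
    unfolding Irr_def left_ideal_gen_def by (intro Inter_lower) auto
  then show ?thesis using u I by blast
qed

section \<open>Straightening of balanced words\<close>

definition Irr_lift :: "nc_poly set" where
  "Irr_lift = {x \<in> carrier FA. cls x \<in> Irr m0 m1 n}"

definition Virt_lift :: "nc_poly set" where
  "Virt_lift = {x \<in> carrier FA. \<exists>y\<in>carrier (free_alg (letters n)). x - y \<in> Irr_lift}"

lemma letters_carrier: "carrier (free_alg (letters n)) \<subseteq> carrier FA"
  by (rule free_alg_mono) (auto simp: alphabet_def)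

lemma Irr_lift_closed:
  assumes "x \<in> Irr_lift"
  shows "y \<in> Irr_lift \<Longrightarrow> x + y \<in> Irr_lift" "- x \<in> Irr_lift" "r \<in> carrier FA \<Longrightarrow> r * x \<in> Irr_lift"
proof -
  have x: "x \<in> carrier FA" "cls x \<in> Irr m0 m1 n" using assms by (auto simp: Irr_lift_def)
  interpret ring UA by (rule ring_UA)
  interpret additive_subgroup "Irr m0 m1 n" UA by (rule Irr_closed(1))
  show "x + y \<in> Irr_lift" if "y \<in> Irr_lift"
    using that x by (simp add: Irr_lift_def free_alg_closed cls_simps)
  show "- x \<in> Irr_lift"
    using x a_inv_closed[OF x(2)] by (simp add: Irr_lift_def free_alg_closed cls_simps)
  show "r * x \<in> Irr_lift" if "r \<in> carrier FA"
    using x that Irr_closed(2)[of "cls r" "cls x"] by (simp add: Irr_lift_def free_alg_closed cls_simps carrier_UA)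
qed

text \<open>The reason for working with preimages in the free algebra: commuting two factors becomes
  a congruence of polynomials modulo \<open>Irr_lift\<close>, without any calculation with
  cosets.\<close>

lemma gl_ideal_Irr_lift: "x \<in> gl_ideal m0 m1 n \<Longrightarrow> x \<in> Irr_lift"
proof -
  assume x: "x \<in> gl_ideal m0 m1 n"
  interpret ideal "gl_ideal m0 m1 n" FA by (rule ideal_gl_ideal)
  have xc: "x \<in> carrier FA" using x by (rule Icarr)
  interpret U: ring UA by (rule ring_UA)
  interpret I: additive_subgroup "Irr m0 m1 n" UA by (rule Irr_closed(1))
  interpret ring_hom_ring FA UA cls
    by (rule ring_hom_ringI2[OF ring_free_alg ring_UA cls_hom])
  have "cls x = cls 0" using x xc by (subst cls_eq_iff) auto
  also have "\<dots> = \<zero>\<^bsub>UA\<^esub>" using hom_zero by simp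
  finally show ?thesis using xc I.zero_closed by (simp add: Irr_lift_def)
qed

lemma Virt_lift_closed:
  assumes "x \<in> Virt_lift"
  shows "y \<in> Virt_lift \<Longrightarrow> x + y \<in> Virt_lift" "- x \<in> Virt_lift"
proof -
  from assms obtain x' where x: "x \<in> carrier FA" "x' \<in> carrier (free_alg (letters n))" "x - x' \<in> Irr_lift"
    by (auto simp: Virt_lift_def)
  show "x + y \<in> Virt_lift" if y: "y \<in> Virt_lift"
  proof -
    from y obtain y' where y: "y \<in> carrier FA" "y' \<in> carrier (free_alg (letters n))" "y - y' \<in> Irr_lift"
      by (auto simp: Virt_lift_def)
    show ?thesis using x y Irr_lift_closed(1)[OF x(3) y(3)]
      by (auto simp: Virt_lift_def free_alg_closed algebra_simps intro!: bexI[of _ "x' + y'"])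
  qed
  show "- x \<in> Virt_lift"
    using x Irr_lift_closed(2)[OF x(3)]
    by (auto simp: Virt_lift_def free_alg_closed algebra_simps intro!: bexI[of _ "- x'"])
qed

lemma Irr_Virt_lift: "x \<in> Irr_lift \<Longrightarrow> x \<in> Virt_lift"
  by (auto simp: Virt_lift_def Irr_lift_def intro!: bexI[of _ 0])

lemma letters_Virt_lift: "x \<in> carrier (free_alg (letters n)) \<Longrightarrow> x \<in> Virt_lift"
proof -
  assume x: "x \<in> carrier (free_alg (letters n))"
  have "0 \<in> Irr_lift"
    using gl_ideal_Irr_lift[of 0] additive_subgroup.zero_closed[OF ideal.axioms(1)[OF ideal_gl_ideal]] by simp
  with x show ?thesis using letters_carrier by (auto simp: Virt_lift_def intro!: bexI[of _ x])
qed

lemma mon_swap: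
  assumes "{a, b, c, e} \<subseteq> alphabet m0 m1 n" "set u \<subseteq> alphabet m0 m1 n \<times> alphabet m0 m1 n"
    "set v \<subseteq> alphabet m0 m1 n \<times> alphabet m0 m1 n"
  shows "mon (u @ (a, b) # (c, e) # v)
     - (- 1) ^ ((parity a + parity b) * (parity c + parity e)) * mon (u @ (c, e) # (a, b) # v)
     - (if b = c then mon (u @ (a, e) # v) else 0)
     + (- 1) ^ ((parity a + parity b) * (parity c + parity e)) * (if a = e then mon (u @ (c, b) # v) else 0)
     \<in> gl_ideal m0 m1 n"
proof -
  define s :: nc_poly where "s = (- 1) ^ ((parity a + parity b) * (parity c + parity e))"
  let ?r = "gen a b * gen c e - s * gen c e * gen a b - bracket a b c e"
  interpret ideal "gl_ideal m0 m1 n" FA by (rule ideal_gl_ideal)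
  have "?r \<in> gl_relations (alphabet m0 m1 n)"
    using assms(1) unfolding gl_relations_def s_def super_sign_def by blast
  then have "?r \<in> gl_ideal m0 m1 n"
    using gl_relations_subset by blast
  then have "mon u * (?r * mon v) \<in> gl_ideal m0 m1 n"
    using I_l_closed I_r_closed mon_carrier[OF assms(2)] mon_carrier[OF assms(3)] by simp
  moreover have "mon u * (?r * mon v) = mon (u @ (a, b) # (c, e) # v)
     - s * mon (u @ (c, e) # (a, b) # v)
     - (if b = c then mon (u @ (a, e) # v) else 0)
     + s * (if a = e then mon (u @ (c, b) # v) else 0)"
  proof -
    have "bracket a b c e = (if b = c then gen a e else 0) - s * (if a = e then gen c b else 0)"
      by (simp add: bracket_def super_sign_def s_def)
    moreover have "s = 1 \<or> s = - 1"
      unfolding s_def by (cases "even ((parity a + parity b) * (parity c + parity e))") auto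
    ultimately show ?thesis
      by (elim disjE) (simp_all add: mon_append mon_Cons left_diff_distrib right_diff_distrib distrib_left distrib_right mult.assoc)
  qed
  ultimately show ?thesis by (simp add: s_def)
qed

text \<open>Weight zero with respect to every virtual symbol. The superbracket preserves weights, so
  this survives straightening, including its correction terms.\<close>

definition balanced :: "(sym \<times> sym) list \<Rightarrow> bool" where
  "balanced w \<longleftrightarrow> set w \<subseteq> alphabet m0 m1 n \<times> alphabet m0 m1 n \<and>
     (\<forall>c\<in>virtuals m0 m1. count_list (map fst w) c = count_list (map snd w) c)"

lemma count_list_Cons: "count_list (x # xs) c = of_bool (x = c) + count_list xs c"
  by simp

lemma balanced_append_Cons:
  "balanced (u @ (a, b) # v) \<longleftrightarrow> set u \<subseteq> alphabet m0 m1 n \<times> alphabet m0 m1 n \<and>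
     set v \<subseteq> alphabet m0 m1 n \<times> alphabet m0 m1 n \<and> a \<in> alphabet m0 m1 n \<and> b \<in> alphabet m0 m1 n \<and>
     (\<forall>c\<in>virtuals m0 m1. count_list (map fst (u @ v)) c + of_bool (a = c) =
        count_list (map snd (u @ v)) c + of_bool (b = c))"
  unfolding balanced_def by (auto simp: count_list_Cons simp del: count_list.simps)

lemma balanced_append_Cons_Cons:
  "balanced (u @ (a, b) # (c, e) # v) \<longleftrightarrow> set u \<subseteq> alphabet m0 m1 n \<times> alphabet m0 m1 n \<and>
     set v \<subseteq> alphabet m0 m1 n \<times> alphabet m0 m1 n \<and> {a, b, c, e} \<subseteq> alphabet m0 m1 n \<and>
     (\<forall>x\<in>virtuals m0 m1. count_list (map fst (u @ v)) x + of_bool (a = x) + of_bool (c = x) =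
        count_list (map snd (u @ v)) x + of_bool (b = x) + of_bool (e = x))"
  unfolding balanced_append_Cons by (auto simp: count_list_Cons ac_simps simp del: count_list.simps)

lemma Virt_lift_sign: "x \<in> Virt_lift \<Longrightarrow> (- 1) ^ k * x \<in> Virt_lift"
  by (cases "even k") (auto simp: Virt_lift_closed)

text \<open>Straightening: a factor with a virtual second index is moved to the right end, where it makes
  the word irregular; the correction terms are shorter.\<close>

lemma balanced_Virt_lift: "balanced w \<Longrightarrow> mon w \<in> Virt_lift"
proof (induction "length w" arbitrary: w rule: less_induct)
  case less
  show ?case
  proof (cases "\<exists>c\<in>virtuals m0 m1. c \<in> snd ` set w")
    case True
    then obtain c x where c: "c \<in> virtuals m0 m1" and x: "x \<in> set w" "c = snd x" by blast
    obtain a where "x = (a, c)" using x(2) by (cases x) auto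
    with split_list[OF x(1)] obtain u v where w: "w = u @ (a, c) # v" by blast
    have "mon (u @ (a, c) # v) \<in> Virt_lift" if "balanced (u @ (a, c) # v)" "length (u @ (a, c) # v) = length w"
      using that
    proof (induction v arbitrary: u)
      case Nil
      have "irregular m0 m1 (u @ [(a, c)])"
        unfolding irregular_def
      proof (intro bexI[of _ 1] bexI[of _ c])
        have "{j \<in> {1..1}. snd (rev (u @ [(a, c)]) ! (j - 1)) = c} = {1}" by auto
        then show "card {j \<in> {1..<1}. fst (rev (u @ [(a, c)]) ! (j - 1)) = c}
            < card {j \<in> {1..1}. snd (rev (u @ [(a, c)]) ! (j - 1)) = c}" by simp
      qed (use c in auto)
      then have "mon (u @ [(a, c)]) \<in> Irr_lift"
        using Irr_closed(3) Nil(1) by (auto simp: Irr_lift_def balanced_def mon_carrier)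
      then show ?case by (rule Irr_Virt_lift)
    next
      case (Cons x v)
      obtain b e where x: "x = (b, e)" by (cases x)
      let ?k = "(parity a + parity c) * (parity b + parity e)"
      have alph: "{a, c, b, e} \<subseteq> alphabet m0 m1 n" "set u \<subseteq> alphabet m0 m1 n \<times> alphabet m0 m1 n"
        "set v \<subseteq> alphabet m0 m1 n \<times> alphabet m0 m1 n"
        using Cons.prems(1) unfolding x by (auto simp: balanced_def)
      have 0: "mon (u @ (a, c) # x # v) - (- 1) ^ ?k * mon (u @ (b, e) # (a, c) # v)
         - (if c = b then mon (u @ (a, e) # v) else 0)
         + (- 1) ^ ?k * (if a = e then mon (u @ (b, c) # v) else 0) \<in> Virt_lift"
        using Irr_Virt_lift[OF gl_ideal_Irr_lift[OF mon_swap[OF alph]]] unfolding x .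
      note bal = Cons.prems(1)[unfolded x balanced_append_Cons_Cons]
      have "balanced (u @ (b, e) # (a, c) # v)"
        unfolding balanced_append_Cons_Cons using bal by (auto simp: ac_simps)
      then have "balanced ((u @ [(b, e)]) @ (a, c) # v)" by simp
      from Cons.IH[OF this] Cons.prems(2) have 1: "mon (u @ (b, e) # (a, c) # v) \<in> Virt_lift" by simp
      have zero: "0 \<in> Virt_lift" by (simp add: letters_Virt_lift)
      have 2: "(if c = b then mon (u @ (a, e) # v) else 0) \<in> Virt_lift"
      proof (cases "c = b")
        case True
        with bal have "balanced (u @ (a, e) # v)"
          unfolding balanced_append_Cons by auto
        then have "mon (u @ (a, e) # v) \<in> Virt_lift" using Cons.prems(2) by (intro less.hyps) simp_all
        with True show ?thesis by simp
      qed (use zero in simp)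
      have 3: "(if a = e then mon (u @ (b, c) # v) else 0) \<in> Virt_lift"
      proof (cases "a = e")
        case True
        with bal have "balanced (u @ (b, c) # v)"
          unfolding balanced_append_Cons by auto
        then have "mon (u @ (b, c) # v) \<in> Virt_lift" using Cons.prems(2) by (intro less.hyps) simp_all
        with True show ?thesis by simp
      qed (use zero in simp)
      from Virt_lift_closed(1)[OF 0 Virt_lift_closed(1)[OF Virt_lift_sign[OF 1, of ?k]
          Virt_lift_closed(1)[OF 2 Virt_lift_closed(2)[OF Virt_lift_sign[OF 3, of ?k]]]]]
      show ?case by (simp add: algebra_simps)
    qed
    then show ?thesis using less.prems w by blast
  next
    case False
    \<comment> \<open>No second index is virtual, so by balance no first index is virtual
      either.\<close>
    have "set w \<subseteq> letters n \<times> letters n"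
    proof
      fix x assume x: "x \<in> set w"
      then have "x \<in> alphabet m0 m1 n \<times> alphabet m0 m1 n" using less.prems by (auto simp: balanced_def)
      moreover have "snd x \<notin> virtuals m0 m1" using x False by blast
      moreover have "fst x \<notin> virtuals m0 m1"
      proof
        assume "fst x \<in> virtuals m0 m1"
        moreover from this have "count_list (map snd w) (fst x) = 0"
          using False by (auto simp: count_list_0_iff)
        ultimately have "count_list (map fst w) (fst x) = 0" using less.prems by (auto simp: balanced_def)
        then show False using x by (auto simp: count_list_0_iff)
      qed
      ultimately show "x \<in> letters n \<times> letters n" by (cases x) (auto simp: alphabet_def)
    qed
    then show ?thesis by (intro letters_Virt_lift mon_carrier)
  qed
qed

section \<open>The action of a devirtualized word\<close>

lemma emb_scale: "emb (scale c p) = scl c (emb p)"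
  by (intro fock_eqI) (simp add: emb_def scale_zero_right)

lemma emb_add: "emb (p + q) = emb p + emb q"
  by (intro fock_eqI) (simp add: emb_def)

lemma emb_zero: "emb 0 = 0"
  by (intro fock_eqI) (simp add: emb_def)

lemma emb_sum: "emb (\<Sum>i\<in>I. f i) = (\<Sum>i\<in>I. emb (f i))"
  by (induction I rule: infinite_finite_induct) (auto simp: emb_add emb_zero)

lemma polar_emb:
  assumes "\<not> is_pos a" "\<not> is_pos b"
  shows "polar n d a b (emb p) = emb (polarization d (row_index n a) (row_index n b) p)"
proof -
  have "create n a t (annih n b t (emb p)) = emb (var (row_index n a) t * partial (row_index n b, t) p)" for t
    using assms by (intro fock_eqI) (simp add: create_def annih_def emb_def)
  then show ?thesis by (simp add: polar_def polarization_def emb_sum)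
qed

lemma nc_op_emb:
  assumes "x \<in> carrier (free_alg (letters n))"
  shows "nc_op n d x (emb p) = emb (free_act d x p)"
proof -
  have "word_op n d w (emb p) = emb (word_act d w p)" if "set w \<subseteq> letters n \<times> letters n" for w
    using that by (induction w) (auto simp: word_act_def polar_emb letters_def)
  with assms show ?thesis
    unfolding nc_op_def free_act_def emb_sum emb_scale
    by (intro sum.cong) (auto simp: free_alg_carrier)
qed

text \<open>Straightening supplies an admissible value, so the choice in \<open>devirt\<close> has
  the required property. Any chosen value and any of its representatives differ from the word by an
  element of \<open>Irr\<close> and therefore act on v alike, so the set under
  \<open>the_elem\<close> is a singleton.\<close>

theorem gl_act_devirt:
  assumes "balanced w" and "proper n v"
  shows "gl_act m0 m1 n d (devirt m0 m1 n (cls (mon w))) v = amp (word_op n d w (emb v)) {}"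
proof -
  let ?u = "devirt m0 m1 n (cls (mon w))"
  have w: "mon w \<in> carrier FA" using assms(1) by (simp add: balanced_def mon_carrier)
  from balanced_Virt_lift[OF assms(1)] obtain y where y: "y \<in> carrier (free_alg (letters n))" "mon w - y \<in> Irr_lift"
    by (auto simp: Virt_lift_def)
  have "cls y \<in> U_gl_proper m0 m1 n \<and> cls (mon w) \<ominus>\<^bsub>UA\<^esub> cls y \<in> Irr m0 m1 n"
    using y w letters_carrier by (auto simp: U_gl_proper_def cls_simps Irr_lift_def)
  then have u: "?u \<in> U_gl_proper m0 m1 n" "cls (mon w) \<ominus>\<^bsub>UA\<^esub> ?u \<in> Irr m0 m1 n"
    unfolding devirt_def by (rule someI2, blast)+
  have act: "free_act d x v = amp (word_op n d w (emb v)) {}"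
    if x: "x \<in> carrier (free_alg (letters n))" "cls x = ?u" for x
  proof -
    have xc: "x \<in> carrier FA" using x letters_carrier by blast
    have "cls (mon w - x) \<in> Irr m0 m1 n" using u(2) x(2) cls_simps(3)[OF w xc] by simp
    then have "nc_op n d (mon w - x) (emb v) = 0"
      using w xc by (intro Irr_annihilates[OF assms(2)]) (auto simp: free_alg_closed)
    then have "emb (free_act d x v) = word_op n d w (emb v)"
      by (simp add: nc_op_diff nc_op_mon nc_op_emb[OF x(1)])
    then show ?thesis by (auto simp: emb_def dest!: arg_cong[of _ _ "\<lambda>f. amp f {}"])
  qed
  from u(1) obtain x where x: "x \<in> carrier (free_alg (letters n))" "cls x = ?u"
    by (auto simp: U_gl_proper_def)
  have "{free_act d x v | x. x \<in> carrier (free_alg (letters n)) \<and> cls x = ?u} =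
      {amp (word_op n d w (emb v)) {}}" (is "?L = ?R")
  proof
    show "?L \<subseteq> ?R" using act by blast
    have "free_act d x v \<in> ?L" using x by blast
    then show "?R \<subseteq> ?L" using act[OF x] by simp
  qed
  then show ?thesis by (simp add: gl_act_def)
qed

end

section \<open>Odd words and Capelli identities\<close>

text \<open>All factors are of one type, from positive to non-positive symbols or the reverse. So no
  second index equals a first index, all brackets vanish, and the factors anticommute.\<close>

definition odd_word :: "sym set \<Rightarrow> (sym \<times> sym) list \<Rightarrow> bool" where
  "odd_word A w \<longleftrightarrow> set w \<subseteq> A \<times> A \<and>
     (\<exists>p. \<forall>x\<in>set w. is_pos (fst x) = p \<and> is_pos (snd x) = (\<not> p))"

lemma odd_word_subset: "odd_word A w \<Longrightarrow> set u \<subseteq> set w \<Longrightarrow> odd_word A u"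
  unfolding odd_word_def by blast

lemma parity_is_pos: "parity a = (if is_pos a then 0 else 1)"
  by (cases a) auto

lemma bracket_sign_odd:
  "is_pos a \<noteq> is_pos b \<Longrightarrow> is_pos c \<noteq> is_pos e \<Longrightarrow> bracket_sign a b c e = - 1"
  by (auto simp: bracket_sign_def parity_is_pos)

lemma bracket_sign_even: "is_pos a = is_pos b \<Longrightarrow> bracket_sign a b c e = 1"
  by (simp add: bracket_sign_def parity_is_pos power_mult)

lemma sign_square: "(- 1 :: complex) ^ k * (- 1) ^ k = 1"
  by (simp flip: power_add)

context
  fixes m0 m1 n d :: nat
begin

abbreviation "Alph \<equiv> alphabet m0 m1 n"
abbreviation "P \<equiv> polar n d"
abbreviation "W \<equiv> word_op n d"

lemmas P_lin = linear_op_simps[OF linear_polar] and W_lin = linear_op_simps[OF linear_word_op]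

lemma odd_word_anticommute:
  assumes "odd_word Alph w" "(a, b) \<in> set w" "(c, e) \<in> set w"
  shows "P a b (P c e f) = - P c e (P a b f)"
proof -
  from assms(1) obtain p where p: "set w \<subseteq> Alph \<times> Alph" "\<forall>x\<in>set w. is_pos (fst x) = p \<and> is_pos (snd x) = (\<not> p)"
    unfolding odd_word_def by blast
  from bspec[OF p(2) assms(2)] bspec[OF p(2) assms(3)]
  have *: "is_pos a = p" "is_pos b = (\<not> p)" "is_pos c = p" "is_pos e = (\<not> p)" by simp_all
  have "b \<noteq> c" "a \<noteq> e" using * by auto
  moreover have "{a, b, c, e} \<subseteq> Alph" using p(1) assms(2,3) by auto
  moreover have "bracket_sign a b c e = - 1" using * by (intro bracket_sign_odd) auto
  ultimately show ?thesis
    using polar_super_commute[of a b c e m0 m1 n d f] by (simp add: scl_simps)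
qed

lemma odd_word_move:
  assumes "odd_word Alph ((a, b) # w)"
  shows "W w (P a b f) = scl ((- 1) ^ length w) (P a b (W w f))"
  using assms
proof (induction w)
  case (Cons x w)
  obtain c e where x: "x = (c, e)" by (cases x)
  have "odd_word Alph ((a, b) # w)" by (rule odd_word_subset[OF Cons.prems]) auto
  then show ?case
    using Cons.IH odd_word_anticommute[OF Cons.prems, of c e a b] by (simp add: x P_lin scl_simps)
qed (simp add: scl_simps)

lemma fock_double_eq_0: "(h :: fock) = - h \<Longrightarrow> h = 0"
proof -
  assume "h = - h"
  then have "h + h = 0" by (metis add.right_inverse)
  then have "scl (1 + 1) h = 0" unfolding scl_add_left by (simp add: scl_simps)
  then have "scl (1 / 2) (scl (1 + 1) h) = 0" by (simp add: scl_simps)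
  then show ?thesis by (simp add: scl_simps)
qed

text \<open>Equal factors are moved next to each other, where an odd operator anticommuting with
  itself squares to zero.\<close>

lemma odd_word_repeat:
  assumes "odd_word Alph w" "\<not> distinct w"
  shows "W w f = 0"
proof -
  from not_distinct_decomp[OF assms(2)] obtain u x v y where w: "w = u @ [x] @ v @ [x] @ y" by blast
  obtain a b where x: "x = (a, b)" by (cases x)
  have "odd_word Alph ((a, b) # v)" by (rule odd_word_subset[OF assms(1)]) (auto simp: w x)
  note move = odd_word_move[OF this]
  have "P a b (P a b h) = 0" for h
    by (rule fock_double_eq_0, rule odd_word_anticommute[OF assms(1)]) (simp_all add: w x)
  then show ?thesis by (simp add: w x move P_lin W_lin scl_simps)
qed

lemma odd_word_rev:
  assumes "odd_word Alph w"
  shows "W (rev w) f = scl ((- 1) ^ (\<Sum>{..<length w})) (W w f)"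
  using assms
proof (induction w arbitrary: f)
  case (Cons x w)
  obtain a b where x: "x = (a, b)" by (cases x)
  have "odd_word Alph w" by (rule odd_word_subset[OF Cons.prems]) auto
  then have "W (rev (x # w)) f = scl ((- 1) ^ (\<Sum>{..<length w})) (W w (P a b f))"
    using Cons.IH by (simp add: x)
  also have "\<dots> = scl ((- 1) ^ (\<Sum>{..<length w})) (scl ((- 1) ^ length w) (P a b (W w f)))"
    using odd_word_move[of a b w f] Cons.prems x by simp
  finally show ?case by (simp add: x scl_simps power_add mult.commute)
qed (simp add: scl_simps)

lemma odd_word_rev_blocks:
  assumes "odd_word Alph (concat ws)"
  shows "W (concat (map rev ws)) f = scl (\<Prod>w\<leftarrow>ws. (- 1) ^ (\<Sum>{..<length w})) (W (concat ws) f)"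
  using assms
proof (induction ws)
  case (Cons w ws)
  have "odd_word Alph w" "odd_word Alph (concat ws)" by (rule odd_word_subset[OF Cons.prems], force)+
  then show ?case using Cons.IH by (simp add: odd_word_rev W_lin scl_simps mult.commute)
qed (simp add: scl_simps)

text \<open>The even generator replaces an index in each factor of an odd word; if the new factor
  already occurs in the word, the resulting term vanishes.\<close>

lemma even_polar_commute_odd_word_aux:
  assumes "odd_word Alph (u @ w)" "a \<in> Alph" "b \<in> Alph" "is_pos a = is_pos b" "a \<noteq> b"
    and "\<And>c e. (c, e) \<in> set w \<Longrightarrow> b = c \<Longrightarrow> (a, e) \<in> set (u @ w)"
    and "\<And>c e. (c, e) \<in> set w \<Longrightarrow> a = e \<Longrightarrow> (c, b) \<in> set (u @ w)"
  shows "W u (P a b (W w f)) = W u (W w (P a b f))"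
  using assms(1,6,7)
proof (induction w arbitrary: u)
  case (Cons x w)
  obtain c e where x: "x = (c, e)" by (cases x)
  have "{a, b, c, e} \<subseteq> Alph" using Cons.prems(1) assms(2,3) by (auto simp: x odd_word_def)
  from polar_super_commute[OF this, of d "W w f"]
  have "P a b (W (x # w) f) = P c e (P a b (W w f)) + (if b = c then P a e (W w f) else 0)
      - (if a = e then P c b (W w f) else 0)"
    using assms(4) by (simp add: x bracket_sign_even scl_simps)
  \<comment> \<open>The altered factor duplicates another one, possibly in the prefix u already
    passed; the induction therefore carries u along.\<close>
  moreover have "W u (P a e (W w f)) = 0" if "b = c"
  proof -
    have "(a, e) \<in> set (u @ x # w)" using Cons.prems(2)[of c e] that by (auto simp: x)
    moreover have "(a, e) \<noteq> x" using assms(5) that by (simp add: x)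
    ultimately have "\<not> distinct (u @ (a, e) # w)" "set (u @ (a, e) # w) \<subseteq> set (u @ x # w)" by auto
    from odd_word_repeat[OF odd_word_subset[OF Cons.prems(1) this(2)] this(1)] show ?thesis by simp
  qed
  moreover have "W u (P c b (W w f)) = 0" if "a = e"
  proof -
    have "(c, b) \<in> set (u @ x # w)" using Cons.prems(3)[of c e] that by (auto simp: x)
    moreover have "(c, b) \<noteq> x" using assms(5) that by (simp add: x)
    ultimately have "\<not> distinct (u @ (c, b) # w)" "set (u @ (c, b) # w) \<subseteq> set (u @ x # w)" by auto
    from odd_word_repeat[OF odd_word_subset[OF Cons.prems(1) this(2)] this(1)] show ?thesis by simp
  qed
  moreover have "W (u @ [x]) (P a b (W w f)) = W (u @ [x]) (W w (P a b f))"
  proof (rule Cons.IH)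
    show "odd_word Alph ((u @ [x]) @ w)" using Cons.prems(1) by simp
  qed (use Cons.prems in auto)
  ultimately show ?case by (auto simp: x W_lin)
qed simp

lemma even_polar_commute_odd_word:
  assumes "odd_word Alph w" "a \<in> Alph" "b \<in> Alph" "is_pos a = is_pos b" "a \<noteq> b"
    and "\<And>c e. (c, e) \<in> set w \<Longrightarrow> b = c \<Longrightarrow> (a, e) \<in> set w"
    and "\<And>c e. (c, e) \<in> set w \<Longrightarrow> a = e \<Longrightarrow> (c, b) \<in> set w"
  shows "P a b (W w f) = W w (P a b f)"
  using even_polar_commute_odd_word_aux[of "[]" w a b f] assms by simp

section \<open>Capelli identities for a single row\<close>

lemma odd_word_right: "set xs \<subseteq> Alph \<Longrightarrow> a \<in> Alph \<Longrightarrow> is_pos a \<Longrightarrow> \<forall>x\<in>set xs. \<not> is_pos x \<Longrightarrow>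
    odd_word Alph (map (\<lambda>x. (a, x)) xs)"
  by (auto simp: odd_word_def intro!: exI[of _ True])

lemma odd_word_left: "set xs \<subseteq> Alph \<Longrightarrow> a \<in> Alph \<Longrightarrow> is_pos a \<Longrightarrow> \<forall>x\<in>set xs. \<not> is_pos x \<Longrightarrow>
    odd_word Alph (map (\<lambda>x. (x, a)) xs)"
  by (auto simp: odd_word_def intro!: exI[of _ False])

text \<open>Passing a factor (a, y) turns e_{x,a} into e_{x,y}, which commutes with the rest of the
  word and annihilates f. As x is not in xs, the diagonal term e_{a,a} does not appear.\<close>

lemma polar_odd_right_eq_0:
  assumes "set xs \<subseteq> Alph" "a \<in> Alph" "x \<in> Alph" "is_pos a" "\<not> is_pos x" "\<forall>y\<in>set xs. \<not> is_pos y"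
    and "x \<notin> set xs" "P x a f = 0" "\<forall>y\<in>set xs. P x y f = 0"
  shows "P x a (W (map (\<lambda>y. (a, y)) xs) f) = 0"
  using assms
proof (induction xs)
  case (Cons y xs)
  let ?g = "W (map (\<lambda>y. (a, y)) xs) f"
  have "x \<noteq> a" "x \<noteq> y" using Cons.prems by auto
  have "P x y ?g = W (map (\<lambda>y. (a, y)) xs) (P x y f)"
  proof (rule even_polar_commute_odd_word)
    show "odd_word Alph (map (\<lambda>y. (a, y)) xs)" using Cons.prems by (intro odd_word_right) auto
  qed (use Cons.prems in auto)
  also have "\<dots> = 0" using Cons.prems by (simp add: W_lin)
  finally have "P x y ?g = 0" .
  moreover have "P x a ?g = 0" using Cons by auto
  ultimately show ?case
    using polar_super_commute[of x a a y m0 m1 n d ?g] Cons.prems \<open>x \<noteq> y\<close>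
    by (simp add: P_lin scl_simps)
qed simp

lemma polar_odd_left_eq_0:
  assumes "set xs \<subseteq> Alph" "a \<in> Alph" "x \<in> Alph" "is_pos a" "\<not> is_pos x" "\<forall>y\<in>set xs. \<not> is_pos y"
    and "x \<notin> set xs" "P a x f = 0" "\<forall>y\<in>set xs. P y x f = 0"
  shows "P a x (W (map (\<lambda>y. (y, a)) xs) f) = 0"
  using assms
proof (induction xs)
  case (Cons y xs)
  let ?g = "W (map (\<lambda>y. (y, a)) xs) f"
  have "x \<noteq> a" "x \<noteq> y" using Cons.prems by auto
  have "P y x ?g = W (map (\<lambda>y. (y, a)) xs) (P y x f)"
  proof (rule even_polar_commute_odd_word)
    show "odd_word Alph (map (\<lambda>y. (y, a)) xs)" using Cons.prems by (intro odd_word_left) auto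
  qed (use Cons.prems in auto)
  also have "\<dots> = 0" using Cons.prems by (simp add: W_lin)
  finally have "P y x ?g = 0" .
  moreover have "P a x ?g = 0" using Cons by auto
  ultimately show ?case
    using polar_super_commute[of a x y a m0 m1 n d ?g] Cons.prems \<open>x \<noteq> y\<close>
    by (simp add: P_lin scl_simps)
qed simp

text \<open>For odd generators the superbracket is the anticommutator, e_{x,a} e_{a,x} + e_{a,x}
  e_{x,a} = e_{x,x} + e_{a,a}, and one of the two products vanishes on f.\<close>

lemma polar_pair:
  assumes "a \<in> Alph" "x \<in> Alph" "is_pos a" "\<not> is_pos x"
    and "has_degree n d a k f" "has_degree n d x l f"
  shows "P x a f = 0 \<Longrightarrow> P x a (P a x f) = scl (of_int (l + k)) f"
    and "P a x f = 0 \<Longrightarrow> P a x (P x a f) = scl (of_int (l + k)) f"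
proof -
  have deg: "P a a f = scl (of_int k) f" "P x x f = scl (of_int l) f"
    by (rule has_degree_polar_diagonal[OF assms(5)], rule has_degree_polar_diagonal[OF assms(6)])
  show "P x a f = 0 \<Longrightarrow> P x a (P a x f) = scl (of_int (l + k)) f"
    using polar_super_commute[of x a a x m0 m1 n d f] assms(1-4) deg
    by (simp add: bracket_sign_odd P_lin scl_simps scl_add_left)
  show "P a x f = 0 \<Longrightarrow> P a x (P x a f) = scl (of_int (l + k)) f"
    using polar_super_commute[of a x x a m0 m1 n d f] assms(1-4) deg
    by (simp add: bracket_sign_odd P_lin scl_simps scl_add_left add.commute)
qed

lemma count_list_map_Pair:
  "count_list (map fst (map (\<lambda>y. (a, y)) xs)) c = (if a = c then length xs else 0)"
  "count_list (map snd (map (\<lambda>y. (a, y)) xs)) c = count_list xs c"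
  "count_list (map fst (map (\<lambda>y. (y, a)) xs)) c = count_list xs c"
  "count_list (map snd (map (\<lambda>y. (y, a)) xs)) c = (if a = c then length xs else 0)"
  by (induction xs) auto

text \<open>The innermost pair belongs to the head of xs, which acts after the later entries: each
  of these has produced one copy of a, and this is the second summand of the factor. The condition
  along xs is that of a highest weight vector; it makes the other product of each pair
  vanish.\<close>

lemma capelli_create_row:
  assumes "set xs \<subseteq> Alph" "distinct xs" "a \<in> Alph" "is_pos a" "\<forall>x\<in>set xs. \<not> is_pos x"
    and "has_degree n d a 0 f" "\<forall>x\<in>set xs. has_degree n d x (wt x) f"
    and "sorted_wrt (\<lambda>x y. P x y f = 0) xs"
  shows "W (map (\<lambda>x. (x, a)) (rev xs)) (W (map (\<lambda>x. (a, x)) xs) f) =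
    scl (of_int (\<Prod>i<length xs. wt (xs ! i) + int (length xs - 1 - i))) f"
  using assms
proof (induction xs)
  case (Cons x xs)
  let ?X = "W (map (\<lambda>x. (a, x)) xs) f"
  have alph: "set (map (\<lambda>x. (a, x)) xs) \<subseteq> Alph \<times> Alph" "x \<in> Alph" using Cons.prems by auto
  have nz: "a \<notin> set xs" "x \<noteq> a" using Cons.prems by auto
  have dega: "has_degree n d a (int (length xs)) ?X"
    using has_degree_word_op[OF alph(1) Cons.prems(3,6)] nz unfolding count_list_map_Pair
    by (simp add: count_list_0_iff)
  have degx: "has_degree n d x (wt x) ?X"
    using has_degree_word_op[OF alph, of d "wt x" f] Cons.prems nz unfolding count_list_map_Pair
    by (auto simp: count_list_0_iff)
  have "P x a f = 0"
    using has_degree_nonpos_polar[OF alph(2) Cons.prems(3,6)] by simp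
  then have "P x a ?X = 0" using Cons.prems by (intro polar_odd_right_eq_0) auto
  from polar_pair(1)[OF Cons.prems(3) alph(2) Cons.prems(4) _ dega degx this]
  have pair: "P x a (P a x ?X) = scl (of_int (wt x + int (length xs))) ?X"
    using Cons.prems by auto
  have "W (map (\<lambda>x. (x, a)) (rev (x # xs))) (W (map (\<lambda>x. (a, x)) (x # xs)) f) =
      W (map (\<lambda>x. (x, a)) (rev xs)) (P x a (P a x ?X))"
    by simp
  also have "\<dots> = scl (of_int (wt x + int (length xs)))
      (scl (of_int (\<Prod>i<length xs. wt (xs ! i) + int (length xs - 1 - i))) f)"
    unfolding pair using Cons by (simp add: W_lin)
  also have "\<dots> = scl (of_int ((wt x + int (length xs)) * (\<Prod>i<length xs. wt (xs ! i) + int (length xs - 1 - i)))) f"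
    by (simp add: scl_simps)
  also have "(wt x + int (length xs)) * (\<Prod>i<length xs. wt (xs ! i) + int (length xs - 1 - i)) =
      (\<Prod>i<length (x # xs). wt ((x # xs) ! i) + int (length (x # xs) - 1 - i))"
    by (simp add: prod.lessThan_Suc_shift del: prod.lessThan_Suc)
  finally show ?case .
qed (simp add: scl_simps)

text \<open>Here the entry with index i acts after i copies of a have been spent, so k - i are left.
  The innermost pair is that of the last entry, hence the induction from the end. The product that
  has to vanish is now the one beginning with e_{a,x}, and as f may contain x, this is a hypothesis
  about f rather than a consequence of degrees.\<close>

lemma capelli_annihilate_row:
  assumes "set xs \<subseteq> Alph" "distinct xs" "a \<in> Alph" "is_pos a" "\<forall>x\<in>set xs. \<not> is_pos x"
    and "has_degree n d a k f" "\<forall>x\<in>set xs. has_degree n d x (wt x) f"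
    and "sorted_wrt (\<lambda>x y. P x y f = 0) xs" "\<forall>x\<in>set xs. P a x f = 0"
  shows "W (map (\<lambda>x. (a, x)) xs) (W (map (\<lambda>x. (x, a)) (rev xs)) f) =
    scl (of_int (\<Prod>i<length xs. wt (xs ! i) + k - int i)) f"
  using assms
proof (induction xs rule: rev_induct)
  case (snoc x xs)
  let ?X = "W (map (\<lambda>x. (x, a)) (rev xs)) f"
  have alph: "set (map (\<lambda>x. (x, a)) (rev xs)) \<subseteq> Alph \<times> Alph" "x \<in> Alph" using snoc.prems by auto
  have nz: "a \<notin> set xs" "x \<noteq> a" using snoc.prems by auto
  have dega: "has_degree n d a (k - int (length xs)) ?X"
    using has_degree_word_op[OF alph(1) snoc.prems(3,6)] nz unfolding count_list_map_Pair
    by (simp add: count_list_0_iff)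
  have degx: "has_degree n d x (wt x) ?X"
    using has_degree_word_op[OF alph, of d "wt x" f] snoc.prems nz unfolding count_list_map_Pair
    by (auto simp: count_list_0_iff)
  have "P a x ?X = 0" using snoc.prems by (intro polar_odd_left_eq_0) (auto simp: sorted_wrt_append)
  from polar_pair(2)[OF snoc.prems(3) alph(2) snoc.prems(4) _ dega degx this]
  have pair: "P a x (P x a ?X) = scl (of_int (wt x + (k - int (length xs)))) ?X"
    using snoc.prems by auto
  have "W (map (\<lambda>x. (a, x)) (xs @ [x])) (W (map (\<lambda>x. (x, a)) (rev (xs @ [x]))) f) =
      W (map (\<lambda>x. (a, x)) xs) (P a x (P x a ?X))"
    by simp
  also have "\<dots> = scl (of_int (wt x + (k - int (length xs))))
      (scl (of_int (\<Prod>i<length xs. wt (xs ! i) + k - int i)) f)"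
    unfolding pair using snoc by (simp add: W_lin sorted_wrt_append)
  also have "(\<Prod>i<length xs. wt (xs ! i) + k - int i) = (\<Prod>i<length xs. wt ((xs @ [x]) ! i) + k - int i)"
    by (intro prod.cong) (auto simp: nth_append)
  finally show ?case
    by (simp add: scl_simps mult.commute add_diff_eq del: of_int_add of_int_diff of_int_prod flip: of_int_mult)
qed (simp add: scl_simps)

end

section \<open>Double Young-Capelli bitableaux as words\<close>

text \<open>Rows count from 0 because they index lists. Columns count from 1, unlike in
  \<open>ferrers\<close>, because a column is at the same time the letter in \<open>D_tab\<close>
  and the argument of \<beta>.\<close>

definition row_cells :: "nat list \<Rightarrow> nat \<Rightarrow> (nat \<times> nat) list" where
  "row_cells \<nu> r = map (Pair r) [1..<Suc (\<nu> ! r)]"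

definition cells :: "nat list \<Rightarrow> (nat \<times> nat) list" where
  "cells \<nu> = concat (map (row_cells \<nu>) [0..<length \<nu>])"

definition pair_word :: "('c \<Rightarrow> sym) \<Rightarrow> ('c \<Rightarrow> sym) \<Rightarrow> 'c list \<Rightarrow> (sym \<times> sym) list" where
  "pair_word F G cs = map (\<lambda>c. (F c, G c)) cs"

lemma pair_word_simps [simp]:
  "map fst (pair_word F G cs) = map F cs" "map snd (pair_word F G cs) = map G cs"
  "pair_word F G (cs @ cs') = pair_word F G cs @ pair_word F G cs'"
  "rev (pair_word F G cs) = pair_word F G (rev cs)"
  "length (pair_word F G cs) = length cs"
  "set (pair_word F G cs) = (\<lambda>c. (F c, G c)) ` set cs"
  "pair_word F G [] = []" "pair_word F G (c # cs) = (F c, G c) # pair_word F G cs"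
  by (auto simp: pair_word_def rev_map)

lemma zip_map_same: "zip (map f xs) (map g xs) = map (\<lambda>x. (f x, g x)) xs"
  by (induction xs) auto

lemma set_row_cells: "set (row_cells \<nu> r) = {r} \<times> {1..\<nu> ! r}"
  by (auto simp: row_cells_def)

lemma set_cells: "set (cells \<nu>) = {(r, s). r < length \<nu> \<and> 1 \<le> s \<and> s \<le> \<nu> ! r}"
  by (auto simp: cells_def set_row_cells)

lemma concat_cells:
  assumes "length T = length \<nu>" "\<And>r. r < length \<nu> \<Longrightarrow> T ! r = map (\<lambda>s. F (r, s)) [1..<Suc (\<nu> ! r)]"
  shows "concat T = map F (cells \<nu>)"
proof -
  have "T = map (\<lambda>r. map (\<lambda>s. F (r, s)) [1..<Suc (\<nu> ! r)]) [0..<length \<nu>]"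
    using assms by (intro nth_equalityI) (auto simp del: upt_Suc)
  then show ?thesis by (simp add: cells_def row_cells_def map_concat comp_def del: upt_Suc)
qed

definition letter_of :: "nat tableau \<Rightarrow> nat \<times> nat \<Rightarrow> sym" where
  "letter_of S = (\<lambda>(r, s). Lett (S ! r ! (s - 1)))"

definition row_sym :: "(nat \<Rightarrow> nat) \<Rightarrow> nat \<times> nat \<Rightarrow> sym" where
  "row_sym \<alpha> = (\<lambda>(r, s). Pos (\<alpha> (Suc r)))"

definition col_sym :: "(nat \<Rightarrow> nat) \<Rightarrow> nat \<times> nat \<Rightarrow> sym" where
  "col_sym \<beta> = (\<lambda>(r, s). Neg (\<beta> s))"

lemma concat_letters:
  assumes "sh S = \<nu>"
  shows "concat (map (map Lett) S) = map (letter_of S) (cells \<nu>)"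
proof (rule concat_cells)
  have len: "length S = length \<nu>" using assms by (auto simp: sh_def)
  then show "length (map (map Lett) S) = length \<nu>" by simp
  fix r assume "r < length \<nu>"
  with assms len have "length (S ! r) = \<nu> ! r" by (auto simp: sh_def)
  then show "map (map Lett) S ! r = map (\<lambda>s. letter_of S (r, s)) [1..<Suc (\<nu> ! r)]"
    using \<open>r < length \<nu>\<close> len by (intro nth_equalityI) (auto simp: letter_of_def simp del: upt_Suc)
qed

lemma concat_C_star: "concat (C_star \<alpha> \<nu>) = map (row_sym \<alpha>) (cells \<nu>)"
proof (rule concat_cells)
  show "length (C_star \<alpha> \<nu>) = length \<nu>" by (simp add: C_star_def del: upt_Suc)
  fix r assume r: "r < length \<nu>"
  then show "C_star \<alpha> \<nu> ! r = map (\<lambda>s. row_sym \<alpha> (r, s)) [1..<Suc (\<nu> ! r)]"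
    by (intro nth_equalityI) (auto simp: C_star_def row_sym_def simp del: upt_Suc)
qed

lemma concat_D_star: "concat (D_star \<beta> \<nu>) = map (col_sym \<beta>) (cells \<nu>)"
  by (rule concat_cells) (auto simp: D_star_def col_sym_def simp del: upt_Suc)

lemma nth_le_first_part: "sorted_wrt (\<ge>) \<nu> \<Longrightarrow> r < length \<nu> \<Longrightarrow> \<nu> ! r \<le> first_part \<nu>"
  by (cases \<nu>; cases r) (auto simp: first_part_def)

lemma sorted_nth_mono: "sorted_wrt (\<ge>) (\<nu> :: nat list) \<Longrightarrow> r \<le> r' \<Longrightarrow> r' < length \<nu> \<Longrightarrow> \<nu> ! r' \<le> \<nu> ! r"
  by (cases "r = r'") (auto simp: sorted_wrt_iff_nth_less)

lemma row_sym_alphabet: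
  "virtual_choice m0 m1 \<nu> \<alpha> \<beta> \<Longrightarrow> r < length \<nu> \<Longrightarrow> row_sym \<alpha> (r, s) \<in> virtuals m0 m1"
  by (force simp: virtual_choice_def row_sym_def virtuals_def)

lemma col_sym_alphabet:
  "virtual_choice m0 m1 \<nu> \<alpha> \<beta> \<Longrightarrow> 1 \<le> s \<Longrightarrow> s \<le> first_part \<nu> \<Longrightarrow> col_sym \<beta> (r, s) \<in> virtuals m0 m1"
  by (force simp: virtual_choice_def col_sym_def virtuals_def)

lemma letter_of_alphabet:
  assumes "S \<in> tableaux n \<nu>" "c \<in> set (cells \<nu>)"
  shows "letter_of S c \<in> letters n"
proof -
  obtain r s where c: "c = (r, s)" "r < length \<nu>" "1 \<le> s" "s \<le> \<nu> ! r"
    using assms(2) by (auto simp: set_cells)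
  have S: "map length S = \<nu>" "\<forall>xs\<in>set S. set xs \<subseteq> {1..n}" using assms(1) by (auto simp: tableaux_def sh_def)
  then have "r < length S" "length (S ! r) = \<nu> ! r" using c by auto
  then have "S ! r ! (s - 1) \<in> set (S ! r)" "S ! r \<in> set S" using c by auto
  with S(2) show ?thesis by (auto simp: letter_of_def c letters_def)
qed

text \<open>Over the four words together each virtual symbol occurs equally often as first and as
  second index, so the product is balanced. From here on only the action of an explicit word
  matters.\<close>

theorem gl_act_double_YC:
  assumes \<nu>: "sorted_wrt (\<ge>) \<nu>" and S: "S' \<in> tableaux n \<nu>" "S \<in> tableaux n \<nu>"
    and vc: "virtual_choice m0 m1 \<nu> \<alpha> \<beta>" and v: "proper n v"
  shows "gl_act m0 m1 n d (double_YC m0 m1 n \<alpha> \<beta> S' S) v = amp (word_op n d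
    (pair_word (letter_of S') (row_sym \<alpha>) (cells \<nu>) @ pair_word (row_sym \<alpha>) (col_sym \<beta>) (cells \<nu>) @
     pair_word (col_sym \<beta>) (row_sym \<alpha>) (cells \<nu>) @ pair_word (row_sym \<alpha>) (letter_of S) (cells \<nu>)) (emb v)) {}"
    (is "_ = amp (word_op n d (?w1 @ ?w2 @ ?w3 @ ?w4) _) _")
proof -
  let ?Al = "alphabet m0 m1 n"
  have sh: "sh S' = \<nu>" "sh S = \<nu>" using S by (auto simp: tableaux_def)
  have A: "row_sym \<alpha> c \<in> ?Al" if "c \<in> set (cells \<nu>)" for c
    using that row_sym_alphabet[OF vc] by (auto simp: set_cells alphabet_def)
  have B: "col_sym \<beta> c \<in> ?Al" if cell: "c \<in> set (cells \<nu>)" for c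
  proof -
    obtain r s where c: "c = (r, s)" "r < length \<nu>" "1 \<le> s" "s \<le> \<nu> ! r"
      using cell unfolding set_cells by blast
    then have "s \<le> first_part \<nu>" using nth_le_first_part[OF \<nu>, of r] by simp
    then show ?thesis using col_sym_alphabet[OF vc, of s r] c by (simp add: alphabet_def)
  qed
  have L: "letter_of S' c \<in> ?Al" "letter_of S c \<in> ?Al" if "c \<in> set (cells \<nu>)" for c
    using that letter_of_alphabet[OF S(1)] letter_of_alphabet[OF S(2)] by (auto simp: alphabet_def)
  have sub: "set ?w1 \<subseteq> ?Al \<times> ?Al" "set ?w2 \<subseteq> ?Al \<times> ?Al" "set ?w3 \<subseteq> ?Al \<times> ?Al" "set ?w4 \<subseteq> ?Al \<times> ?Al"
    using A B L by auto
  have tabs: "e_tab m0 m1 n (map (map Lett) S') (C_star \<alpha> \<nu>) = U_class m0 m1 n (mon ?w1)"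
    "e_tab m0 m1 n (C_star \<alpha> \<nu>) (D_star \<beta> \<nu>) = U_class m0 m1 n (mon ?w2)"
    "e_tab m0 m1 n (D_star \<beta> \<nu>) (C_star \<alpha> \<nu>) = U_class m0 m1 n (mon ?w3)"
    "e_tab m0 m1 n (C_star \<alpha> \<nu>) (map (map Lett) S) = U_class m0 m1 n (mon ?w4)"
    using sub sh by (simp_all add: e_tab_def concat_letters concat_C_star concat_D_star zip_map_same
        pair_word_def e_word_cls)
  have "list_prod (U_gl m0 m1 n) [U_class m0 m1 n (mon ?w1), U_class m0 m1 n (mon ?w2),
      U_class m0 m1 n (mon ?w3), U_class m0 m1 n (mon ?w4)] = U_class m0 m1 n (mon (?w1 @ ?w2 @ ?w3 @ ?w4))"
    using ring_hom_one[OF cls_hom[of m0 m1 n]]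
      cls_simps(1)[of "mon ?w1" m0 m1 n "mon ?w2 * (mon ?w3 * mon ?w4)"]
      cls_simps(1)[of "mon ?w2" m0 m1 n "mon ?w3 * mon ?w4"]
      cls_simps(1)[of "mon ?w3" m0 m1 n "mon ?w4"] cls_simps(1)[of "mon ?w4" m0 m1 n 1] sub
    by (simp add: list_prod_def mon_append mon_carrier free_alg_closed)
  then have "double_YC m0 m1 n \<alpha> \<beta> S' S = devirt m0 m1 n (U_class m0 m1 n (mon (?w1 @ ?w2 @ ?w3 @ ?w4)))"
    by (simp add: double_YC_def sh tabs)
  moreover have "balanced m0 m1 n (?w1 @ ?w2 @ ?w3 @ ?w4)"
  proof -
    have "count_list (map (letter_of T) (cells \<nu>)) c = 0" if "c \<in> virtuals m0 m1" for c T
      using that by (auto simp: count_list_0_iff virtuals_def letter_of_def)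
    then show ?thesis using sub by (auto simp: balanced_def)
  qed
  ultimately show ?thesis using gl_act_devirt[OF _ v] by simp
qed

section \<open>Column heights, hook lengths and index counts\<close>

definition col_height :: "nat list \<Rightarrow> nat \<Rightarrow> nat" where
  "col_height \<nu> s = card {r. r < length \<nu> \<and> s \<le> \<nu> ! r}"

lemma length_filter_rows:
  "length (filter (\<lambda>r. s \<le> \<nu> ! r) [k..<length \<nu>]) + k = col_height \<nu> s"
  if "\<And>r. r < k \<Longrightarrow> s \<le> \<nu> ! r" "k \<le> length \<nu>" for s k :: nat and \<nu> :: "nat list"
proof -
  have "{r. r < length \<nu> \<and> s \<le> \<nu> ! r} = {..<k} \<union> ({r. s \<le> \<nu> ! r} \<inter> set [k..<length \<nu>])"
    using that by auto
  moreover have "card ({..<k} \<union> ({r. s \<le> \<nu> ! r} \<inter> set [k..<length \<nu>])) =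
      k + card ({r. s \<le> \<nu> ! r} \<inter> set [k..<length \<nu>])"
    by (subst card_Un_disjoint) auto
  ultimately show ?thesis by (simp add: col_height_def distinct_length_filter)
qed

text \<open>The difference of the first two terms is the leg plus one, and the last term is the arm.
  This is the shape in which the Capelli factors deliver the hook length.\<close>

lemma hook_length_eq:
  assumes "sorted_wrt (\<ge>) \<nu>" "r < length \<nu>" "i < \<nu> ! r"
  shows "int (hook_length \<nu> (r, i)) = int (col_height \<nu> (Suc i)) - int r + int (\<nu> ! r - 1 - i)"
proof -
  let ?X = "Pair r ` {i..<\<nu> ! r}" and ?Y = "(\<lambda>r'. (r', i)) ` {r'. r < r' \<and> r' < length \<nu> \<and> Suc i \<le> \<nu> ! r'}"
  let ?R = "{r'. r' < length \<nu> \<and> Suc i \<le> \<nu> ! r'}"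
  have "{(r', s') \<in> ferrers \<nu>. (r' = r \<and> i \<le> s') \<or> (s' = i \<and> r \<le> r')} = ?X \<union> ?Y" (is "?H = _")
  proof
    show "?H \<subseteq> ?X \<union> ?Y"
    proof
      fix c assume c: "c \<in> ?H"
      obtain r' s' where [simp]: "c = (r', s')" by (cases c)
      show "c \<in> ?X \<union> ?Y" using c by (cases "r' = r") (auto simp: ferrers_def image_iff)
    qed
  qed (use assms(2,3) in \<open>auto simp: ferrers_def\<close>)
  then have "hook_length \<nu> (r, i) = card (?X \<union> ?Y)" by (simp add: hook_length_def)
  also have "\<dots> = card ?X + card ?Y"
    by (intro card_Un_disjoint) auto
  also have "card ?X = \<nu> ! r - i" by (simp add: card_image inj_on_def)
  also have "card ?Y = card {r'. r < r' \<and> r' < length \<nu> \<and> Suc i \<le> \<nu> ! r'}"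
    by (intro card_image) (auto simp: inj_on_def)
  also have "{r'. r < r' \<and> r' < length \<nu> \<and> Suc i \<le> \<nu> ! r'} = ?R - {..r}" by auto
  also have "card (?R - {..r}) = card ?R - card {..r}"
  proof (intro card_Diff_subset)
    show "{..r} \<subseteq> ?R" using sorted_nth_mono[OF assms(1) _ assms(2)] assms(2,3) by force
  qed simp
  finally have "hook_length \<nu> (r, i) = \<nu> ! r - i + (col_height \<nu> (Suc i) - Suc r)"
    by (simp add: col_height_def)
  moreover have "card {..r} \<le> col_height \<nu> (Suc i)"
    unfolding col_height_def
    by (rule card_mono) (use sorted_nth_mono[OF assms(1) _ assms(2)] assms(2,3) in force)+
  ultimately show ?thesis using assms(3) by simp
qed

lemma count_list_map_upt:
  assumes "inj_on g {1..m}" "k \<le> m" "s \<in> {1..m}"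
  shows "count_list (map g [1..<Suc k]) (g s) = (if s \<le> k then 1 else 0)"
  using assms(2)
proof (induction k)
  case (Suc k)
  then have "g (Suc k) = g s \<longleftrightarrow> Suc k = s" by (intro inj_on_eq_iff[OF assms(1)] assms(3)) simp
  moreover have "[1..<Suc (Suc k)] = [1..<Suc k] @ [Suc k]" by simp
  ultimately show ?case using Suc by (simp del: upt_Suc)
qed (use assms(3) in simp)

lemma count_list_rev_blocks:
  assumes "\<And>r. r \<in> set rs \<Longrightarrow> count_list (map F (row_cells \<nu> r)) c = (if Q r then 1 else 0)"
  shows "count_list (map F (concat (map (\<lambda>r. rev (row_cells \<nu> r)) rs))) c = length (filter Q rs)"
  using assms
proof (induction rs)
  case (Cons r rs)
  have "count_list (map F (rev (row_cells \<nu> r))) c = count_list (map F (row_cells \<nu> r)) c"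
    by (simp flip: rev_map)
  then show ?case using Cons by simp
qed simp

lemma count_list_concat_zero:
  assumes "\<And>r s. r \<in> set rs \<Longrightarrow> F (r, s) \<noteq> c"
  shows "count_list (map F (concat (map (\<lambda>r. rev (row_cells \<nu> r)) rs))) c = 0"
proof -
  have "c \<notin> F ` (\<Union>r\<in>set rs. set (row_cells \<nu> r))"
  proof
    assume "c \<in> F ` (\<Union>r\<in>set rs. set (row_cells \<nu> r))"
    then obtain r x where "r \<in> set rs" "x \<in> set (row_cells \<nu> r)" "c = F x" by blast
    moreover from this have "x = (r, snd x)" by (cases x) (simp add: set_row_cells)
    ultimately show False using assms by metis
  qed
  then show ?thesis by (simp add: count_list_0_iff)
qed

lemma count_list_row_sym:
  assumes "r \<in> set rs" "distinct rs" "set rs \<subseteq> {..<l}" "inj_on \<alpha> {1..l}"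
  shows "count_list (map (row_sym \<alpha>) (concat (map (\<lambda>r. rev (row_cells \<nu> r)) rs))) (Pos (\<alpha> (Suc r))) = \<nu> ! r"
  using assms
proof (induction rs)
  case (Cons r' rs)
  have inj: "\<alpha> (Suc x) = \<alpha> (Suc y) \<longleftrightarrow> x = y" if "x < l" "y < l" for x y
    using inj_on_eq_iff[OF assms(4), of "Suc x" "Suc y"] that by simp
  have row: "map (row_sym \<alpha>) (rev (row_cells \<nu> r')) = replicate (\<nu> ! r') (Pos (\<alpha> (Suc r')))"
    by (intro nth_equalityI) (auto simp: row_cells_def row_sym_def rev_nth simp del: upt_Suc)
  have rep: "count_list (replicate k x) y = (if x = y then k else 0)" for k and x y :: sym
    by (induction k) auto
  show ?case
  proof (cases "r = r'")
    case True
    have "row_sym \<alpha> (x, s) \<noteq> Pos (\<alpha> (Suc r))" if "x \<in> set rs" for x s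
    proof -
      have "x \<noteq> r" "x < l" "r < l"
        using True that Cons.prems(2) subsetD[OF Cons.prems(3), of x] subsetD[OF Cons.prems(3,1)] by auto
      then show ?thesis by (simp add: row_sym_def inj)
    qed
    with count_list_concat_zero[of rs "row_sym \<alpha>" "Pos (\<alpha> (Suc r))" \<nu>] True
    show ?thesis by (simp add: row rep)
  next
    case False
    moreover have "r < l" "r' < l" using subsetD[OF Cons.prems(3), of r'] subsetD[OF Cons.prems(3,1)] by simp_all
    ultimately have "\<alpha> (Suc r) \<noteq> \<alpha> (Suc r')" by (simp add: inj)
    with Cons False show ?thesis by (simp add: row rep)
  qed
qed simp

section \<open>The hook coefficient\<close>

definition lett_sym :: "nat \<times> nat \<Rightarrow> sym" where
  "lett_sym = (\<lambda>(r, s). Lett s)"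

text \<open>With this list in the first and third words and its reverse in the second and fourth,
  the pairs to be cancelled are nested.\<close>

definition rev_rows :: "nat list \<Rightarrow> nat list \<Rightarrow> (nat \<times> nat) list" where
  "rev_rows \<nu> rs = concat (map (\<lambda>r. rev (row_cells \<nu> r)) rs)"

lemma rev_rows_simps [simp]:
  "rev_rows \<nu> [] = []" "rev_rows \<nu> (r # rs) = rev (row_cells \<nu> r) @ rev_rows \<nu> rs"
  "rev_rows \<nu> (rs @ rs') = rev_rows \<nu> rs @ rev_rows \<nu> rs'"
  by (simp_all add: rev_rows_def)

lemma set_rev_rows: "set (rev_rows \<nu> rs) = (\<Union>r\<in>set rs. {r} \<times> {1..\<nu> ! r})"
  by (simp add: rev_rows_def set_row_cells)

lemma count_lett_sym:
  assumes "1 \<le> s"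
  shows "count_list (map lett_sym (rev_rows \<nu> rs)) (Lett s) = length (filter (\<lambda>r. s \<le> \<nu> ! r) rs)"
  unfolding rev_rows_def
proof (rule count_list_rev_blocks)
  fix r
  have "map lett_sym (row_cells \<nu> r) = map Lett [1..<Suc (\<nu> ! r)]"
    by (simp add: row_cells_def lett_sym_def comp_def del: upt_Suc)
  then show "count_list (map lett_sym (row_cells \<nu> r)) (Lett s) = (if s \<le> \<nu> ! r then 1 else 0)"
    \<comment> \<open>The maximum makes the interval contain s even when s exceeds the row.\<close>
    using count_list_map_upt[of Lett "max s (\<nu> ! r)" "\<nu> ! r" s] assms
    by (simp add: inj_on_def del: upt_Suc)
qed

lemma inj_on_Neg: "inj_on \<beta> A \<Longrightarrow> inj_on (\<lambda>s. Neg (\<beta> s)) A"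
  by (rule inj_onI) (simp add: inj_on_eq_iff)

lemma count_col_sym:
  assumes "1 \<le> s" "s \<le> m" "inj_on \<beta> {1..m}" "\<And>r. r \<in> set rs \<Longrightarrow> \<nu> ! r \<le> m"
  shows "count_list (map (col_sym \<beta>) (rev_rows \<nu> rs)) (Neg (\<beta> s)) = length (filter (\<lambda>r. s \<le> \<nu> ! r) rs)"
  unfolding rev_rows_def
proof (rule count_list_rev_blocks)
  fix r assume r: "r \<in> set rs"
  have "map (col_sym \<beta>) (row_cells \<nu> r) = map (\<lambda>s. Neg (\<beta> s)) [1..<Suc (\<nu> ! r)]"
    by (simp add: row_cells_def col_sym_def comp_def del: upt_Suc)
  moreover have "inj_on (\<lambda>s. Neg (\<beta> s)) {1..m}" by (rule inj_on_Neg[OF assms(3)])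
  from count_list_map_upt[OF this assms(4)[OF r], of s] assms(1,2)
  have "count_list (map (\<lambda>s. Neg (\<beta> s)) [1..<Suc (\<nu> ! r)]) (Neg (\<beta> s)) = (if s \<le> \<nu> ! r then 1 else 0)"
    by (simp del: upt_Suc)
  ultimately show "count_list (map (col_sym \<beta>) (row_cells \<nu> r)) (Neg (\<beta> s)) = (if s \<le> \<nu> ! r then 1 else 0)"
    by (simp only:)
qed

lemma count_list_map_rev: "count_list (map F (rev xs)) c = count_list (map F xs) c"
  by (simp flip: rev_map)

lemma count_list_map_0: "(\<And>x. F x \<noteq> c) \<Longrightarrow> count_list (map F xs) c = 0"
  by (induction xs) simp_all

lemma odd_word_pair_word:
  assumes "\<And>c. c \<in> set cs \<Longrightarrow> F c \<in> A \<and> G c \<in> A" "\<And>c. is_pos (F c) = p" "\<And>c. is_pos (G c) = (\<not> p)"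
  shows "odd_word A (pair_word F G cs)"
  unfolding odd_word_def
proof (intro conjI exI[of _ p] ballI)
  show "set (pair_word F G cs) \<subseteq> A \<times> A" using assms(1) by auto
  fix x assume "x \<in> set (pair_word F G cs)"
  then obtain c where "x = (F c, G c)" by auto
  then show "is_pos (fst x) = p" "is_pos (snd x) = (\<not> p)" using assms(2,3) by simp_all
qed

lemma hook_product_rows:
  "hook_product \<nu> = (\<Prod>r<length \<nu>. \<Prod>i<\<nu> ! r. hook_length \<nu> (r, i))"
proof -
  have "ferrers \<nu> = Sigma {..<length \<nu>} (\<lambda>r. {..<\<nu> ! r})" by (auto simp: ferrers_def)
  then have "hook_product \<nu> = (\<Prod>(r, i)\<in>Sigma {..<length \<nu>} (\<lambda>r. {..<\<nu> ! r}). hook_length \<nu> (r, i))"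
    by (simp add: hook_product_def split_def)
  also have "\<dots> = (\<Prod>r<length \<nu>. \<Prod>i<\<nu> ! r. hook_length \<nu> (r, i))"
    by (rule prod.Sigma[symmetric]) auto
  finally show ?thesis .
qed

section \<open>The double Capelli eigenvalue on a highest weight vector\<close>

context
  fixes m0 m1 n d :: nat and \<nu> :: "nat list" and \<alpha> \<beta> :: "nat \<Rightarrow> nat" and f :: fock
  assumes \<nu>: "sorted_wrt (\<ge>) \<nu>" and vc: "virtual_choice m0 m1 \<nu> \<alpha> \<beta>" and le_n: "first_part \<nu> \<le> n"
    and virtual_free: "\<And>c. c \<in> virtuals m0 m1 \<Longrightarrow> has_degree n d c 0 f"
    and highest: "\<And>i j. 1 \<le> i \<Longrightarrow> i < j \<Longrightarrow> j \<le> first_part \<nu> \<Longrightarrow> polar n d (Lett i) (Lett j) f = 0"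
    and weight: "\<And>s. 1 \<le> s \<Longrightarrow> s \<le> first_part \<nu> \<Longrightarrow> has_degree n d (Lett s) (int (col_height \<nu> s)) f"
begin

abbreviation "Al \<equiv> alphabet m0 m1 n"
abbreviation "AS \<equiv> row_sym \<alpha>"
abbreviation "BS \<equiv> col_sym \<beta>"
abbreviation "Wd \<equiv> word_op n d"
text \<open>The stages of the calculation. In \<open>Z k\<close> the letters of the rows above row k
  have become \<alpha>'s; in \<open>Y k\<close> the \<alpha>'s of the rows from k on have become
  \<beta>'s. So Z is built downwards, and Y upwards from the completed Z.\<close>

abbreviation "Z k \<equiv> Wd (pair_word AS lett_sym (rev (rev_rows \<nu> [0..<k]))) f"
abbreviation "Y k \<equiv> Wd (pair_word BS AS (rev_rows \<nu> [k..<length \<nu>])) (Z (length \<nu>))"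

lemma AS_alph: "r < length \<nu> \<Longrightarrow> AS (r, s) \<in> Al"
  using row_sym_alphabet[OF vc] by (simp add: alphabet_def)

lemma nu_le: "r < length \<nu> \<Longrightarrow> \<nu> ! r \<le> first_part \<nu>"
  by (rule nth_le_first_part[OF \<nu>])

lemma BS_alph: "1 \<le> s \<Longrightarrow> s \<le> first_part \<nu> \<Longrightarrow> Neg (\<beta> s) \<in> Al"
  using col_sym_alphabet[OF vc, of s] by (simp add: alphabet_def col_sym_def)

lemma Lett_alph: "1 \<le> s \<Longrightarrow> s \<le> first_part \<nu> \<Longrightarrow> Lett s \<in> Al"
  using le_n by (simp add: alphabet_def letters_def)

lemma AS_inj: "r < length \<nu> \<Longrightarrow> r' < length \<nu> \<Longrightarrow> AS (r, s) = AS (r', s') \<longleftrightarrow> r = r'"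
  using vc inj_on_eq_iff[of \<alpha> "{1..length \<nu>}" "Suc r" "Suc r'"] by (simp add: virtual_choice_def row_sym_def)

lemma BS_inj: "1 \<le> s \<Longrightarrow> s \<le> first_part \<nu> \<Longrightarrow> 1 \<le> s' \<Longrightarrow> s' \<le> first_part \<nu> \<Longrightarrow> BS (r, s) = BS (r', s') \<longleftrightarrow> s = s'"
  using vc inj_on_eq_iff[of \<beta> "{1..first_part \<nu>}" s s'] by (simp add: virtual_choice_def col_sym_def)

lemma sym_classes [simp]:
  "is_pos (AS c)" "\<not> is_pos (BS c)" "\<not> is_pos (lett_sym c)"
  "AS c \<noteq> BS c'" "BS c \<noteq> AS c'" "AS c \<noteq> lett_sym c'" "lett_sym c' \<noteq> AS c" "BS c \<noteq> lett_sym c'"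
  "lett_sym c' \<noteq> BS c"
  by (auto simp: row_sym_def col_sym_def lett_sym_def split: prod.splits)

lemma cell_alph:
  assumes "set rs \<subseteq> {..<length \<nu>}" "c \<in> set (rev_rows \<nu> rs)"
  shows "AS c \<in> Al" "BS c \<in> Al" "lett_sym c \<in> Al"
proof -
  from assms obtain r s where c: "c = (r, s)" "r < length \<nu>" "1 \<le> s" "s \<le> \<nu> ! r"
    by (auto simp: set_rev_rows)
  then have "s \<le> first_part \<nu>" using nu_le[of r] by simp
  then show "AS c \<in> Al" "BS c \<in> Al" "lett_sym c \<in> Al"
    using c AS_alph BS_alph Lett_alph by (auto simp: lett_sym_def col_sym_def)
qed

lemma odd_words:
  assumes "set cs \<subseteq> set (rev_rows \<nu> rs)" "set rs \<subseteq> {..<length \<nu>}"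
  shows "odd_word Al (pair_word AS lett_sym cs)" "odd_word Al (pair_word lett_sym AS cs)"
    "odd_word Al (pair_word AS BS cs)" "odd_word Al (pair_word BS AS cs)"
proof -
  have alph: "AS c \<in> Al" "BS c \<in> Al" "lett_sym c \<in> Al" if "c \<in> set cs" for c
    using cell_alph[OF assms(2), of c] that assms(1) by blast+
  show "odd_word Al (pair_word AS lett_sym cs)" "odd_word Al (pair_word AS BS cs)"
    by (rule odd_word_pair_word[where p = True]; simp add: alph)+
  show "odd_word Al (pair_word lett_sym AS cs)" "odd_word Al (pair_word BS AS cs)"
    by (rule odd_word_pair_word[where p = False]; simp add: alph)+
qed

lemma odd_word_alph: "odd_word A w \<Longrightarrow> set w \<subseteq> A \<times> A"
  by (simp add: odd_word_def)

lemma rows_upt: "k \<le> length \<nu> \<Longrightarrow> set [0..<k] \<subseteq> {..<length \<nu>}"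
  by auto

lemma count_AS_out:
  assumes "r < length \<nu>" "set rs \<subseteq> {..<length \<nu>}" "r \<notin> set rs"
  shows "count_list (map AS (rev_rows \<nu> rs)) (AS (r, s)) = 0"
  unfolding rev_rows_def
proof (rule count_list_concat_zero)
  fix r' s' assume "r' \<in> set rs"
  then show "AS (r', s') \<noteq> AS (r, s)" using assms AS_inj[of r' r s' s] by blast
qed

lemma count_AS_in:
  assumes "r \<in> set rs" "distinct rs" "set rs \<subseteq> {..<length \<nu>}"
  shows "count_list (map AS (rev_rows \<nu> rs)) (AS (r, s)) = \<nu> ! r"
  using count_list_row_sym[OF assms, of \<alpha> \<nu>] vc
  by (simp add: virtual_choice_def rev_rows_def row_sym_def)

text \<open>The rows above k are at least as long as row k, so each of them has used up one letter
  s.\<close>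

lemma Z_degree_Lett:
  assumes "k < length \<nu>" "1 \<le> s" "s \<le> \<nu> ! k"
  shows "has_degree n d (Lett s) (int (col_height \<nu> s) - int k) (Z k)"
proof -
  have s: "s \<le> first_part \<nu>" using assms nu_le[of k] by simp
  have "s \<le> \<nu> ! r" if "r < k" for r
    using sorted_nth_mono[OF \<nu> _ assms(1), of r] that assms(3) by simp
  then have "filter (\<lambda>r. s \<le> \<nu> ! r) [0..<k] = [0..<k]"
    by (intro filter_True) simp
  then have "count_list (map lett_sym (rev_rows \<nu> [0..<k])) (Lett s) = k"
    using count_lett_sym[OF assms(2), of \<nu> "[0..<k]"] by simp
  moreover have "count_list (map AS (rev_rows \<nu> [0..<k])) (Lett s) = 0"
    by (rule count_list_map_0) (simp add: row_sym_def split: prod.splits)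
  moreover have "set (pair_word AS lett_sym (rev (rev_rows \<nu> [0..<k]))) \<subseteq> Al \<times> Al"
    by (rule odd_word_alph[OF odd_words(1)[where rs = "[0..<k]"]]) (use assms in auto)
  ultimately show ?thesis
    using has_degree_word_op[OF _ Lett_alph[OF assms(2) s] weight[OF assms(2) s],
        of "pair_word AS lett_sym (rev (rev_rows \<nu> [0..<k]))"]
    by (simp add: count_list_map_rev)
qed

lemma Z_degree_virtual:
  assumes "k \<le> length \<nu>" "c \<in> virtuals m0 m1"
  shows "has_degree n d c (int (count_list (map AS (rev_rows \<nu> [0..<k])) c)) (Z k)"
proof -
  have "count_list (map lett_sym (rev_rows \<nu> [0..<k])) c = 0"
    using assms(2) by (intro count_list_map_0) (auto simp: lett_sym_def virtuals_def)
  moreover have "set (pair_word AS lett_sym (rev (rev_rows \<nu> [0..<k]))) \<subseteq> Al \<times> Al"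
    by (rule odd_word_alph[OF odd_words(1)[where rs = "[0..<k]"]]) (use assms in auto)
  ultimately show ?thesis
    using has_degree_word_op[OF _ _ virtual_free[OF assms(2)],
        of "pair_word AS lett_sym (rev (rev_rows \<nu> [0..<k]))" m0 m1] assms(2)
    by (simp add: count_list_map_rev alphabet_def)
qed

lemma sorted_wrt_upt_map:
  assumes "\<And>i j. 1 \<le> i \<Longrightarrow> i < j \<Longrightarrow> j \<le> k \<Longrightarrow> Q (g i) (g j)"
  shows "sorted_wrt Q (map g [1..<Suc k])"
  unfolding sorted_wrt_map
proof (rule sorted_wrt_mono_rel[where P = "(<)"])
  fix x y assume "x \<in> set [1..<Suc k]" "y \<in> set [1..<Suc k]" "x < y"
  moreover from this have "1 \<le> x" "y \<le> k" by (simp_all del: upt_Suc)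
  ultimately show "Q (g x) (g y)" using assms by blast
qed (rule sorted_wrt_upt)

text \<open>The commutator with a factor that removes i is the factor of the same row that removes
  j. This row lies above k and reaches column j, so that factor is already in the word.\<close>

lemma Z_highest:
  assumes "k < length \<nu>" "1 \<le> i" "i < j" "j \<le> \<nu> ! k"
  shows "polar n d (Lett i) (Lett j) (Z k) = 0"
proof -
  have j: "j \<le> first_part \<nu>" using assms nu_le[of k] by simp
  let ?w = "pair_word AS lett_sym (rev (rev_rows \<nu> [0..<k]))"
  have "polar n d (Lett i) (Lett j) (Wd ?w f) = Wd ?w (polar n d (Lett i) (Lett j) f)"
  proof (rule even_polar_commute_odd_word)
    show "odd_word Al ?w" by (rule odd_words(1)[where rs = "[0..<k]"]) (use assms in auto)
    show "Lett i \<in> Al" "Lett j \<in> Al" using assms j Lett_alph by simp_all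
    fix c e assume ce: "(c, e) \<in> set ?w"
    show "(Lett i, e) \<in> set ?w" if "Lett j = c"
      using ce that by (auto simp: row_sym_def)
    show "(c, Lett j) \<in> set ?w" if "Lett i = e"
    proof -
      from ce that obtain r where r: "r < k" "c = AS (r, i)" "i \<le> \<nu> ! r"
        by (auto simp: set_rev_rows lett_sym_def)
      have "j \<le> \<nu> ! r" using sorted_nth_mono[OF \<nu> _ assms(1), of r] r assms by simp
      then have "(r, j) \<in> set (rev_rows \<nu> [0..<k])" using r assms by (simp add: set_rev_rows)
      moreover have "(c, Lett j) = (AS (r, j), lett_sym (r, j))" using r by (simp add: row_sym_def lett_sym_def)
      ultimately show ?thesis unfolding pair_word_simps set_rev by (rule rev_image_eqI)
    qed
  qed (use assms in auto)
  also have "\<dots> = 0" using highest assms j by (simp add: word_op_zero)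
  finally show ?thesis .
qed

lemma row_create:
  assumes "k < length \<nu>"
  shows "Wd (pair_word lett_sym AS (rev (row_cells \<nu> k))) (Wd (pair_word AS lett_sym (row_cells \<nu> k)) (Z k)) =
    scl (of_nat (\<Prod>i<\<nu> ! k. hook_length \<nu> (k, i))) (Z k)"
proof -
  let ?xs = "map Lett [1..<Suc (\<nu> ! k)]"
  let ?wt = "\<lambda>x. int (col_height \<nu> (letter x)) - int k"
  \<comment> \<open>\<open>row_sym\<close> ignores the column, so 0 is a placeholder, here and
    below.\<close>
  let ?a = "AS (k, 0)"
  have fp: "\<nu> ! k \<le> first_part \<nu>" using nu_le assms by simp
  have "AS (k, s) = ?a" for s by (simp add: row_sym_def)
  then have words: "pair_word AS lett_sym (row_cells \<nu> k) = map (\<lambda>x. (?a, x)) ?xs"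
    "pair_word lett_sym AS (rev (row_cells \<nu> k)) = map (\<lambda>x. (x, ?a)) (rev ?xs)"
    by (simp_all add: pair_word_def row_cells_def lett_sym_def comp_def rev_map del: upt_Suc)
  have "Wd (map (\<lambda>x. (x, ?a)) (rev ?xs)) (Wd (map (\<lambda>x. (?a, x)) ?xs) (Z k)) =
    scl (of_int (\<Prod>i<length ?xs. ?wt (?xs ! i) + int (length ?xs - 1 - i))) (Z k)"
  proof (rule capelli_create_row)
    show "set ?xs \<subseteq> Al" using fp Lett_alph by (force simp del: upt_Suc)
    show "distinct ?xs" by (simp add: distinct_map inj_on_def del: upt_Suc)
    show "?a \<in> Al" by (rule AS_alph[OF assms])
    show "\<forall>x\<in>set ?xs. \<not> is_pos x" by auto
    have "count_list (map AS (rev_rows \<nu> [0..<k])) ?a = 0"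
      by (rule count_AS_out) (use assms in auto)
    then show "has_degree n d ?a 0 (Z k)"
      using Z_degree_virtual[of k ?a] assms row_sym_alphabet[OF vc assms, of 0] by simp
    show "\<forall>x\<in>set ?xs. has_degree n d x (?wt x) (Z k)"
      using Z_degree_Lett[OF assms] by (simp del: upt_Suc)
    show "sorted_wrt (\<lambda>x y. polar n d x y (Z k) = 0) ?xs"
      by (rule sorted_wrt_upt_map) (rule Z_highest[OF assms])
  qed simp
  also have "(\<Prod>i<length ?xs. ?wt (?xs ! i) + int (length ?xs - 1 - i)) = int (\<Prod>i<\<nu> ! k. hook_length \<nu> (k, i))"
    unfolding of_nat_prod by (rule prod.cong) (simp_all add: hook_length_eq[OF \<nu> assms] del: upt_Suc)
  finally show ?thesis unfolding words by simp
qed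

lemma create_all:
  assumes "k \<le> length \<nu>"
  shows "Wd (pair_word lett_sym AS (rev_rows \<nu> [0..<k])) (Z k) =
    scl (of_nat (\<Prod>r<k. \<Prod>i<\<nu> ! r. hook_length \<nu> (r, i))) f"
  using assms
proof (induction k)
  case (Suc k)
  then have "Wd (pair_word lett_sym AS (rev_rows \<nu> [0..<Suc k])) (Z (Suc k)) =
      Wd (pair_word lett_sym AS (rev_rows \<nu> [0..<k]))
        (scl (of_nat (\<Prod>i<\<nu> ! k. hook_length \<nu> (k, i))) (Z k))"
    using row_create[of k] by simp
  also have "\<dots> = scl (of_nat (\<Prod>i<\<nu> ! k. hook_length \<nu> (k, i)))
      (scl (of_nat (\<Prod>r<k. \<Prod>i<\<nu> ! r. hook_length \<nu> (r, i))) f)"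
    using Suc by (simp add: linear_op_scl[OF linear_word_op])
  finally show ?case by (simp add: scl_simps mult.commute)
qed (simp add: scl_simps)

text \<open>A factor of row r would become the factor of the higher row k in the same column, which
  is already there because row k is at least as long. What remains acts on f, which contains no
  \<alpha>.\<close>

lemma Z_even_row_sym:
  assumes "k < r" "r < length \<nu>"
  shows "polar n d (AS (k, 0)) (AS (r, 0)) (Z (length \<nu>)) = 0"
proof -
  let ?w = "pair_word AS lett_sym (rev (rev_rows \<nu> [0..<length \<nu>]))"
  have k: "k < length \<nu>" using assms by simp
  have "polar n d (AS (k, 0)) (AS (r, 0)) (Wd ?w f) = Wd ?w (polar n d (AS (k, 0)) (AS (r, 0)) f)"
  proof (rule even_polar_commute_odd_word)
    show "odd_word Al ?w" by (rule odd_words(1)[where rs = "[0..<length \<nu>]"]) auto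
    show "AS (k, 0) \<in> Al" "AS (r, 0) \<in> Al" using assms k AS_alph by simp_all
    show "AS (k, 0) \<noteq> AS (r, 0)" using AS_inj[OF k assms(2)] assms by simp
    fix c e assume ce: "(c, e) \<in> set ?w"
    show "(c, AS (r, 0)) \<in> set ?w" if "AS (k, 0) = e"
      using ce that by auto
    show "(AS (k, 0), e) \<in> set ?w" if "AS (r, 0) = c"
    proof -
      from ce that obtain r' s where r': "r' < length \<nu>" "c = AS (r', s)" "e = Lett s" "1 \<le> s" "s \<le> \<nu> ! r'"
        by (auto simp: set_rev_rows lett_sym_def)
      then have "r' = r" using that AS_inj[OF assms(2) r'(1)] by simp
      then have "s \<le> \<nu> ! k" using sorted_nth_mono[OF \<nu> _ assms(2), of k] r' assms by simp
      then have "(k, s) \<in> set (rev_rows \<nu> [0..<length \<nu>])" using r' k by (simp add: set_rev_rows)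
      moreover have "(AS (k, 0), e) = (AS (k, s), lett_sym (k, s))" using r' by (simp add: row_sym_def lett_sym_def)
      ultimately show ?thesis unfolding pair_word_simps set_rev by (rule rev_image_eqI)
    qed
  qed simp
  also have "\<dots> = 0"
    using has_degree_nonpos_polar[OF AS_alph[OF k] AS_alph[OF assms(2)]
        virtual_free[OF row_sym_alphabet[OF vc assms(2)]]] by (simp add: word_op_zero)
  finally show ?thesis .
qed

text \<open>Passing a factor of a lower row r, the operator can only leave a polarization from row
  symbol r to row symbol k, with k < r. This one goes through to Z and vanishes there. At the end
  the operator itself meets Z, which contains no \<beta>. Arbitrary lists of cells from the lower
  rows allow the induction to drop one cell at a time.\<close>

lemma Y_odd_zero:
  assumes "k < length \<nu>" "1 \<le> j" "j \<le> first_part \<nu>" "set cs \<subseteq> set (rev_rows \<nu> [Suc k..<length \<nu>])"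
  shows "polar n d (AS (k, 0)) (Neg (\<beta> j)) (Wd (pair_word BS AS cs) (Z (length \<nu>))) = 0"
  using assms(4)
proof (induction cs)
  case Nil
  have "Neg (\<beta> j) \<in> virtuals m0 m1"
    using col_sym_alphabet[OF vc assms(2,3)] by (simp add: col_sym_def)
  moreover from Z_degree_virtual[OF order.refl this]
  have "has_degree n d (Neg (\<beta> j)) 0 (Z (length \<nu>))"
    using count_list_map_0[of AS "Neg (\<beta> j)"] by (simp add: row_sym_def split_def)
  ultimately show ?case
    using has_degree_nonpos_polar[OF AS_alph[OF assms(1)] BS_alph[OF assms(2,3)]] by simp
next
  case (Cons c cs)
  let ?a = "AS (k, 0)" and ?b = "Neg (\<beta> j)" and ?g = "Wd (pair_word BS AS cs) (Z (length \<nu>))"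
  from Cons.prems obtain r s where c: "c = (r, s)" "k < r" "r < length \<nu>" "1 \<le> s" "s \<le> \<nu> ! r"
    by (auto simp: set_rev_rows)
  have AS_c: "AS c = AS (r, 0)" using c by (simp add: row_sym_def)
  have ne: "?a \<noteq> AS c" unfolding AS_c using AS_inj[OF assms(1) c(3)] c by simp
  have cs: "set cs \<subseteq> set (rev_rows \<nu> [Suc k..<length \<nu>])" using Cons.prems by simp
  have "polar n d ?a (AS c) ?g = Wd (pair_word BS AS cs) (polar n d ?a (AS c) (Z (length \<nu>)))"
  proof (rule even_polar_commute_odd_word)
    show "odd_word Al (pair_word BS AS cs)" by (rule odd_words(4)[OF cs]) auto
    show "?a \<in> Al" "AS c \<in> Al" using c AS_alph assms by simp_all
    show "?a \<noteq> AS c" by (rule ne)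
    fix x y assume xy: "(x, y) \<in> set (pair_word BS AS cs)"
    show "(?a, y) \<in> set (pair_word BS AS cs)" if "AS c = x" using xy that by auto
    show "(x, AS c) \<in> set (pair_word BS AS cs)" if "?a = y"
    proof -
      from xy obtain r' s' where "y = AS (r', s')" "(r', s') \<in> set cs" by auto
      moreover from this have "k < r'" "r' < length \<nu>" using cs by (auto simp: set_rev_rows)
      ultimately have False using that AS_inj[OF assms(1), of r' 0 s'] by simp
      then show ?thesis ..
    qed
  qed simp
  also have "\<dots> = 0" unfolding AS_c using Z_even_row_sym[OF c(2,3)] by (simp add: word_op_zero)
  finally have 0: "polar n d ?a (AS c) ?g = 0" .
  have "BS c \<in> Al" using c BS_alph[of s] nu_le[of r] by (simp add: col_sym_def)
  then have "{?a, ?b, BS c, AS c} \<subseteq> Al" using c AS_alph assms BS_alph by simp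
  from polar_super_commute[OF this, of d ?g] Cons.IH[OF cs] 0 ne
  show ?case by (simp add: linear_op_simps[OF linear_polar] scl_simps)
qed

text \<open>A factor in column j of some row would become the factor in column i < j of the same
  row, which is already in the word. The row 0 in \<open>BS (0, j)\<close> is a placeholder.\<close>

lemma Y_highest:
  assumes "k < length \<nu>" "1 \<le> i" "i < j" "j \<le> \<nu> ! k"
  shows "polar n d (Neg (\<beta> i)) (Neg (\<beta> j)) (Y (Suc k)) = 0"
proof -
  have j: "j \<le> first_part \<nu>" using assms nu_le[of k] by simp
  let ?w = "pair_word BS AS (rev_rows \<nu> [Suc k..<length \<nu>])"
  have bj: "BS (0, j) \<in> virtuals m0 m1" using col_sym_alphabet[OF vc, of j] assms j by simp
  have "polar n d (BS (0, i)) (BS (0, j)) (Wd ?w (Z (length \<nu>))) = Wd ?w (polar n d (BS (0, i)) (BS (0, j)) (Z (length \<nu>)))"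
  proof (rule even_polar_commute_odd_word)
    show "odd_word Al ?w" by (rule odd_words(4)) auto
    show "BS (0, i) \<in> Al" "BS (0, j) \<in> Al" using assms j BS_alph by (simp_all add: col_sym_def)
    show "BS (0, i) \<noteq> BS (0, j)" using BS_inj[of i j 0 0] assms j by simp
    fix c e assume ce: "(c, e) \<in> set ?w"
    show "(c, BS (0, j)) \<in> set ?w" if "BS (0, i) = e"
      using ce that by auto
    show "(BS (0, i), e) \<in> set ?w" if "BS (0, j) = c"
    proof -
      from ce obtain p where p: "p \<in> set (rev_rows \<nu> [Suc k..<length \<nu>])" "c = BS p" "e = AS p"
        by auto
      obtain r s where "p = (r, s)" by (cases p)
      with p have r: "k < r" "r < length \<nu>" "c = BS (r, s)" "e = AS (r, s)" "1 \<le> s" "s \<le> \<nu> ! r"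
        by (simp_all add: set_rev_rows)
      then have "s = j" using that BS_inj[of j s 0 r] assms j nu_le[of r] by simp
      then have "(r, i) \<in> set (rev_rows \<nu> [Suc k..<length \<nu>])" using r assms by (simp add: set_rev_rows)
      moreover have "(BS (0, i), e) = (BS (r, i), AS (r, i))" using r by (simp add: row_sym_def col_sym_def)
      ultimately show ?thesis unfolding pair_word_simps by (rule rev_image_eqI)
    qed
  qed simp
  also have "polar n d (BS (0, i)) (BS (0, j)) (Z (length \<nu>)) = 0"
  proof (rule has_degree_nonpos_polar)
    show "BS (0, i) \<in> Al" "BS (0, j) \<in> Al" using assms j BS_alph by (simp_all add: col_sym_def)
    show "has_degree n d (BS (0, j)) (int (count_list (map AS (rev_rows \<nu> [0..<length \<nu>])) (BS (0, j)))) (Z (length \<nu>))"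
      by (rule Z_degree_virtual[OF order.refl bj])
    show "int (count_list (map AS (rev_rows \<nu> [0..<length \<nu>])) (BS (0, j))) \<le> 0"
      using count_list_map_0[of AS "BS (0, j)"] by simp
  qed
  finally show ?thesis by (simp add: word_op_zero col_sym_def)
qed

text \<open>Only the rows below k have been converted; the rows up to k all reach column s, so
  subtracting them from the column leaves exactly the leg.\<close>

lemma Y_degree_BS:
  assumes "k < length \<nu>" "1 \<le> s" "s \<le> \<nu> ! k"
  shows "has_degree n d (Neg (\<beta> s)) (int (col_height \<nu> s) - int (Suc k)) (Y (Suc k))"
proof -
  have s: "s \<le> first_part \<nu>" using assms nu_le[of k] by simp
  have virt: "Neg (\<beta> s) \<in> virtuals m0 m1"
    using col_sym_alphabet[OF vc assms(2) s] by (simp add: col_sym_def)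
  let ?w = "pair_word BS AS (rev_rows \<nu> [Suc k..<length \<nu>])"
  have 0: "count_list (map AS xs) (Neg (\<beta> s)) = 0" for xs
    by (rule count_list_map_0) (simp add: row_sym_def split: prod.splits)
  have "s \<le> \<nu> ! r" if "r < Suc k" for r
    using sorted_nth_mono[OF \<nu> _ assms(1), of r] that assms(3) by simp
  then have "length (filter (\<lambda>r. s \<le> \<nu> ! r) [Suc k..<length \<nu>]) + Suc k = col_height \<nu> s"
    using assms(1) by (intro length_filter_rows) simp_all
  then have height: "int (length (filter (\<lambda>r. s \<le> \<nu> ! r) [Suc k..<length \<nu>])) = int (col_height \<nu> s) - int (Suc k)"
    by simp
  have "count_list (map BS (rev_rows \<nu> [Suc k..<length \<nu>])) (Neg (\<beta> s)) =
      length (filter (\<lambda>r. s \<le> \<nu> ! r) [Suc k..<length \<nu>])"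
    using vc nu_le by (intro count_col_sym[OF assms(2) s]) (auto simp: virtual_choice_def)
  moreover have "set ?w \<subseteq> Al \<times> Al" by (rule odd_word_alph[OF odd_words(4)]) auto
  moreover have "has_degree n d (Neg (\<beta> s)) 0 (Z (length \<nu>))"
    using Z_degree_virtual[OF order.refl virt] by (simp add: 0)
  ultimately have "has_degree n d (Neg (\<beta> s)) (int (length (filter (\<lambda>r. s \<le> \<nu> ! r) [Suc k..<length \<nu>]))) (Y (Suc k))"
    using has_degree_word_op[of ?w m0 m1 n "Neg (\<beta> s)" d 0 "Z (length \<nu>)"] BS_alph[OF assms(2) s]
    by (simp add: 0)
  then show ?thesis by (simp only: height)
qed

lemma Y_degree_AS:
  assumes "k < length \<nu>"
  shows "has_degree n d (AS (k, 0)) (int (\<nu> ! k)) (Y (Suc k))"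
proof -
  let ?w = "pair_word BS AS (rev_rows \<nu> [Suc k..<length \<nu>])"
  have "count_list (map BS (rev_rows \<nu> [Suc k..<length \<nu>])) (AS (k, 0)) = 0"
    by (rule count_list_map_0) simp
  moreover have "count_list (map AS (rev_rows \<nu> [Suc k..<length \<nu>])) (AS (k, 0)) = 0"
    by (rule count_AS_out) (use assms in auto)
  moreover have "count_list (map AS (rev_rows \<nu> [0..<length \<nu>])) (AS (k, 0)) = \<nu> ! k"
    by (rule count_AS_in) (use assms in auto)
  moreover have "set ?w \<subseteq> Al \<times> Al" by (rule odd_word_alph[OF odd_words(4)]) auto
  ultimately show ?thesis
    using has_degree_word_op[OF _ AS_alph[OF assms, of 0] Z_degree_virtual[OF order.refl row_sym_alphabet[OF vc assms, of 0]], of ?w]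
    by simp
qed

lemma row_annihilate:
  assumes "k < length \<nu>"
  shows "Wd (pair_word AS BS (row_cells \<nu> k)) (Wd (pair_word BS AS (rev (row_cells \<nu> k))) (Y (Suc k))) =
    scl (of_nat (\<Prod>i<\<nu> ! k. hook_length \<nu> (k, i))) (Y (Suc k))"
proof -
  let ?b = "\<lambda>s. Neg (\<beta> s)"
  let ?xs = "map ?b [1..<Suc (\<nu> ! k)]"
  \<comment> \<open>The weight has to be a function of the symbol, so the column is recovered by
    inverting \<beta> where it is injective.\<close>
  let ?wt = "\<lambda>x. int (col_height \<nu> (inv_into {1..first_part \<nu>} ?b x)) - int (Suc k)"
  let ?a = "AS (k, 0)"
  have fp: "\<nu> ! k \<le> first_part \<nu>" using nu_le assms by simp
  have inj: "inj_on ?b {1..first_part \<nu>}"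
    using vc unfolding virtual_choice_def by (intro inj_on_Neg) blast
  have inv: "inv_into {1..first_part \<nu>} ?b (?b s) = s" if "1 \<le> s" "s \<le> \<nu> ! k" for s
    using inv_into_f_f[OF inj, of s] that fp by simp
  have "AS (k, s) = ?a" for s by (simp add: row_sym_def)
  then have words: "pair_word AS BS (row_cells \<nu> k) = map (\<lambda>x. (?a, x)) ?xs"
    "pair_word BS AS (rev (row_cells \<nu> k)) = map (\<lambda>x. (x, ?a)) (rev ?xs)"
    by (simp_all add: pair_word_def row_cells_def col_sym_def comp_def rev_map del: upt_Suc)
  have "Wd (map (\<lambda>x. (?a, x)) ?xs) (Wd (map (\<lambda>x. (x, ?a)) (rev ?xs)) (Y (Suc k))) =
    scl (of_int (\<Prod>i<length ?xs. ?wt (?xs ! i) + int (\<nu> ! k) - int i)) (Y (Suc k))"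
  proof (rule capelli_annihilate_row)
    show "set ?xs \<subseteq> Al" using fp BS_alph by (force simp del: upt_Suc)
    show "distinct ?xs" using inj_on_subset[OF inj, of "set [1..<Suc (\<nu> ! k)]"] fp
      by (simp add: distinct_map atLeastLessThanSuc_atLeastAtMost del: upt_Suc)
    show "?a \<in> Al" by (rule AS_alph[OF assms])
    show "\<forall>x\<in>set ?xs. \<not> is_pos x" by auto
    show "has_degree n d ?a (int (\<nu> ! k)) (Y (Suc k))" by (rule Y_degree_AS[OF assms])
    show "\<forall>x\<in>set ?xs. has_degree n d x (?wt x) (Y (Suc k))"
      using Y_degree_BS[OF assms] inv by (simp del: upt_Suc)
    show "sorted_wrt (\<lambda>x y. polar n d x y (Y (Suc k)) = 0) ?xs"
      by (rule sorted_wrt_upt_map) (rule Y_highest[OF assms])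
    show "\<forall>x\<in>set ?xs. polar n d ?a x (Y (Suc k)) = 0"
      using Y_odd_zero[OF assms] fp by (simp del: upt_Suc)
  qed simp
  also have "(\<Prod>i<length ?xs. ?wt (?xs ! i) + int (\<nu> ! k) - int i) = int (\<Prod>i<\<nu> ! k. hook_length \<nu> (k, i))"
    unfolding of_nat_prod
    by (rule prod.cong) (simp_all add: hook_length_eq[OF \<nu> assms] inv[unfolded One_nat_def] of_nat_diff del: upt_Suc)
  finally show ?thesis unfolding words by simp
qed

lemma annihilate_all:
  assumes "k \<le> length \<nu>"
  shows "Wd (pair_word AS BS (rev (rev_rows \<nu> [k..<length \<nu>]))) (Y k) =
    scl (of_nat (\<Prod>r=k..<length \<nu>. \<Prod>i<\<nu> ! r. hook_length \<nu> (r, i))) (Z (length \<nu>))"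
  using assms
proof (induction rule: inc_induct)
  case (step k)
  then have "[k..<length \<nu>] = k # [Suc k..<length \<nu>]" by (simp add: upt_conv_Cons)
  then have "Wd (pair_word AS BS (rev (rev_rows \<nu> [k..<length \<nu>]))) (Y k) =
      Wd (pair_word AS BS (rev (rev_rows \<nu> [Suc k..<length \<nu>])))
        (scl (of_nat (\<Prod>i<\<nu> ! k. hook_length \<nu> (k, i))) (Y (Suc k)))"
    using row_annihilate[OF step(2)] by simp
  also have "\<dots> = scl (of_nat (\<Prod>i<\<nu> ! k. hook_length \<nu> (k, i)))
      (scl (of_nat (\<Prod>r=Suc k..<length \<nu>. \<Prod>i<\<nu> ! r. hook_length \<nu> (r, i))) (Z (length \<nu>)))"
    using step.IH by (simp add: linear_op_scl[OF linear_word_op])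
  finally show ?case using step by (simp add: scl_simps prod.atLeast_Suc_lessThan)
qed (simp add: scl_simps)

definition row_rev_sign :: complex where
  "row_rev_sign = (\<Prod>r\<leftarrow>[0..<length \<nu>]. (- 1) ^ (\<Sum>{..<length (row_cells \<nu> r)}))"

lemma row_rev_sign_square: "row_rev_sign * row_rev_sign = 1"
proof -
  have "(\<Prod>r\<leftarrow>rs. (- 1) ^ k r) * (\<Prod>r\<leftarrow>rs. (- 1) ^ k r) = (1 :: complex)" for rs :: "nat list" and k :: "nat \<Rightarrow> nat"
    by (induction rs) (auto simp: algebra_simps sign_square mult.assoc[symmetric])
  then show ?thesis by (simp add: row_rev_sign_def)
qed

text \<open>Reversing every row gives \<open>rev_rows\<close>, and reversing the result as a whole
  gives the second order. The signs depend on \<nu> alone, not on the symbols, so those of different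
  words can cancel.\<close>

lemma reorder:
  assumes "odd_word Al (pair_word F G (cells \<nu>))"
  shows "Wd (pair_word F G (cells \<nu>)) g = scl row_rev_sign (Wd (pair_word F G (rev_rows \<nu> [0..<length \<nu>])) g)"
    "Wd (pair_word F G (cells \<nu>)) g = scl (row_rev_sign * (- 1) ^ (\<Sum>{..<length (cells \<nu>)}))
      (Wd (pair_word F G (rev (rev_rows \<nu> [0..<length \<nu>]))) g)"
proof -
  let ?ws = "map (\<lambda>r. pair_word F G (row_cells \<nu> r)) [0..<length \<nu>]"
  have c: "concat ?ws = pair_word F G (cells \<nu>)"
    by (simp add: cells_def pair_word_def map_concat comp_def)
  have r: "concat (map rev ?ws) = pair_word F G (rev_rows \<nu> [0..<length \<nu>])"
    by (simp add: rev_rows_def pair_word_def map_concat comp_def rev_map)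
  have "Wd (pair_word F G (rev_rows \<nu> [0..<length \<nu>])) g = scl row_rev_sign (Wd (pair_word F G (cells \<nu>)) g)"
    using odd_word_rev_blocks[of m0 m1 n ?ws d g] assms unfolding c r
    by (simp add: row_rev_sign_def comp_def)
  then show 1: "Wd (pair_word F G (cells \<nu>)) g = scl row_rev_sign (Wd (pair_word F G (rev_rows \<nu> [0..<length \<nu>])) g)"
    by (simp add: scl_simps row_rev_sign_square)
  have "length (rev_rows \<nu> [0..<length \<nu>]) = length (cells \<nu>)"
    by (simp add: rev_rows_def cells_def length_concat comp_def)
  moreover have "odd_word Al (pair_word F G (rev_rows \<nu> [0..<length \<nu>]))"
    by (rule odd_word_subset[OF assms]) (auto simp: set_rev_rows set_cells)
  ultimately have "Wd (pair_word F G (rev (rev_rows \<nu> [0..<length \<nu>]))) g =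
      scl ((- 1) ^ (\<Sum>{..<length (cells \<nu>)})) (Wd (pair_word F G (rev_rows \<nu> [0..<length \<nu>])) g)"
    using odd_word_rev[of m0 m1 n "pair_word F G (rev_rows \<nu> [0..<length \<nu>])" d g] by simp
  then show "Wd (pair_word F G (cells \<nu>)) g = scl (row_rev_sign * (- 1) ^ (\<Sum>{..<length (cells \<nu>)}))
      (Wd (pair_word F G (rev (rev_rows \<nu> [0..<length \<nu>]))) g)"
    by (simp add: 1 scl_simps mult.assoc sign_square)
qed

theorem double_capelli:
  "Wd (pair_word lett_sym AS (cells \<nu>) @ pair_word AS BS (cells \<nu>) @
     pair_word BS AS (cells \<nu>) @ pair_word AS lett_sym (cells \<nu>)) f =
   scl (of_nat (hook_product \<nu>) ^ 2) f"
proof -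
  let ?R = "rev_rows \<nu> [0..<length \<nu>]"
  let ?e = "(- 1 :: complex) ^ (\<Sum>{..<length (cells \<nu>)})"
  have sub: "set (cells \<nu>) \<subseteq> set ?R" by (auto simp: set_rev_rows set_cells)
  note odd = odd_words[OF sub rows_upt[OF order.refl]]
  \<comment> \<open>All four words contribute the row sign and two of them the sign of the full
    reversal, so every sign occurs an even number of times.\<close>
  have "row_rev_sign * (row_rev_sign * ?e) * (row_rev_sign * (row_rev_sign * ?e)) =
      (row_rev_sign * row_rev_sign) * (row_rev_sign * row_rev_sign) * (?e * ?e)"
    by (simp only: mult_ac)
  also have "\<dots> = 1" by (simp only: row_rev_sign_square sign_square mult_1)
  finally have sign: "row_rev_sign * (row_rev_sign * ?e * (row_rev_sign * (row_rev_sign * ?e))) = 1"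
    by (simp only: mult_ac)
  have "Wd (pair_word lett_sym AS (cells \<nu>) @ pair_word AS BS (cells \<nu>) @
     pair_word BS AS (cells \<nu>) @ pair_word AS lett_sym (cells \<nu>)) f =
     Wd (pair_word lett_sym AS ?R) (Wd (pair_word AS BS (rev ?R)) (Wd (pair_word BS AS ?R) (Z (length \<nu>))))"
    using sign
    by (simp only: word_op_simps reorder(1)[OF odd(2)] reorder(1)[OF odd(4)] reorder(2)[OF odd(1)]
        reorder(2)[OF odd(3)] linear_op_scl[OF linear_word_op] scl_simps mult_ac)
  also have "Wd (pair_word AS BS (rev ?R)) (Wd (pair_word BS AS ?R) (Z (length \<nu>))) =
      scl (of_nat (hook_product \<nu>)) (Z (length \<nu>))"
    using annihilate_all[of 0] by (simp add: hook_product_rows atLeast0LessThan)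
  also have "Wd (pair_word lett_sym AS ?R) (scl (of_nat (hook_product \<nu>)) (Z (length \<nu>))) =
      scl (of_nat (hook_product \<nu>)) (scl (of_nat (hook_product \<nu>)) f)"
    using create_all[OF order.refl] by (simp only: linear_op_scl[OF linear_word_op] hook_product_rows)
  finally show ?thesis by (simp add: scl_simps power2_eq_square)
qed

end

section \<open>Highest weight vectors\<close>

definition derivation :: "(cpoly \<Rightarrow> cpoly) \<Rightarrow> bool" where
  "derivation D \<longleftrightarrow> (\<forall>p q. D (p + q) = D p + D q) \<and> (\<forall>p q. D (p * q) = D p * q + p * D q)"

lemma derivation_add: "derivation D \<Longrightarrow> D (p + q) = D p + D q"
  and derivation_mult: "derivation D \<Longrightarrow> D (p * q) = D p * q + p * D q"
  by (simp_all add: derivation_def)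

lemma derivation_0: "derivation D \<Longrightarrow> D 0 = 0"
  using derivation_add[of D 0 0] by simp

lemma derivation_1: "derivation D \<Longrightarrow> D 1 = 0"
  using derivation_mult[of D 1 1] by simp

lemma derivation_minus: "derivation D \<Longrightarrow> D (- p) = - D p"
  using derivation_add[of D p "- p"] by (simp add: derivation_0 eq_neg_iff_add_eq_0 add.commute)

lemma derivation_sum: "derivation D \<Longrightarrow> D (\<Sum>i\<in>I. f i) = (\<Sum>i\<in>I. D (f i))"
  by (induction I rule: infinite_finite_induct) (simp_all add: derivation_0 derivation_add)

lemma derivation_prod:
  assumes "derivation D" "finite I"
  shows "D (\<Prod>i\<in>I. f i) = (\<Sum>l\<in>I. \<Prod>i\<in>I. if i = l then D (f i) else f i)"
  using assms(2)
proof (induction I)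
  case (insert x I)
  have "(\<Prod>i\<in>insert x I. if i = x then D (f i) else f i) = D (f x) * (\<Prod>i\<in>I. f i)"
    using insert by (simp, intro arg_cong[of _ _ "(*) _"] prod.cong) auto
  moreover have "(\<Sum>l\<in>I. \<Prod>i\<in>insert x I. if i = l then D (f i) else f i) =
      f x * (\<Sum>l\<in>I. \<Prod>i\<in>I. if i = l then D (f i) else f i)"
    unfolding sum_distrib_left using insert by (intro sum.cong) auto
  ultimately show ?case using insert by (simp add: derivation_mult[OF assms(1)])
qed (simp add: derivation_1[OF assms(1)])

lemma derivation_prod_list_0:
  assumes "derivation D" "\<And>p. p \<in> set ps \<Longrightarrow> D p = 0"
  shows "D (prod_list ps) = 0"
  using assms(2) by (induction ps) (simp_all add: derivation_1[OF assms(1)] derivation_mult[OF assms(1)])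

lemma derivation_det:
  assumes D: "derivation D" and A: "A \<in> carrier_mat k k"
  shows "D (det A) = (\<Sum>l<k. det (mat k k (\<lambda>(i, j). if i = l then D (A $$ (i, j)) else A $$ (i, j))))"
proof -
  let ?B = "\<lambda>l. mat k k (\<lambda>(i, j). if i = l then D (A $$ (i, j)) else A $$ (i, j))"
  have sign: "D (signof p * x) = signof p * D x" for p and x
    by (simp add: sign_def derivation_minus[OF D])
  have "D (det A) = (\<Sum>p | p permutes {0..<k}. signof p * D (\<Prod>i = 0..<k. A $$ (i, p i)))"
    by (simp add: det_def'[OF A] derivation_sum[OF D] sign)
  also have "\<dots> = (\<Sum>p | p permutes {0..<k}. \<Sum>l<k. signof p * (\<Prod>i = 0..<k. ?B l $$ (i, p i)))"
  proof (rule sum.cong[OF refl])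
    fix p assume "p \<in> {p. p permutes {0..<k}}"
    then have p: "p i < k" if "i < k" for i using permutes_in_image[of p "{0..<k}" i] that by simp
    have "D (\<Prod>i = 0..<k. A $$ (i, p i)) = (\<Sum>l<k. \<Prod>i = 0..<k. if i = l then D (A $$ (i, p i)) else A $$ (i, p i))"
      by (simp add: derivation_prod[OF D] atLeast0LessThan)
    also have "\<dots> = (\<Sum>l<k. \<Prod>i = 0..<k. ?B l $$ (i, p i))"
      using p by (intro sum.cong prod.cong) auto
    finally show "signof p * D (\<Prod>i = 0..<k. A $$ (i, p i)) = (\<Sum>l<k. signof p * (\<Prod>i = 0..<k. ?B l $$ (i, p i)))"
      by (simp only: sum_distrib_left)
  qed
  also have "\<dots> = (\<Sum>l<k. \<Sum>p | p permutes {0..<k}. signof p * (\<Prod>i = 0..<k. ?B l $$ (i, p i)))"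
    by (rule sum.swap)
  also have "\<dots> = (\<Sum>l<k. det (?B l))"
    by (intro sum.cong refl det_def'[symmetric]) simp
  finally show ?thesis .
qed

text \<open>By the Leibniz rule the determinant is differentiated row by row, and each summand has a
  zero row or two equal rows.\<close>

lemma derivation_det_0:
  assumes D: "derivation D" and A: "A \<in> carrier_mat k k"
    and rows: "\<And>l. l < k \<Longrightarrow> (\<forall>j<k. D (A $$ (l, j)) = 0) \<or>
      (\<exists>l'<k. l' \<noteq> l \<and> (\<forall>j<k. D (A $$ (l, j)) = A $$ (l', j)))"
  shows "D (det A) = 0"
  unfolding derivation_det[OF D A]
proof (rule sum.neutral, rule ballI)
  fix l assume "l \<in> {..<k}"
  then have l: "l < k" by simp
  let ?B = "mat k k (\<lambda>(i, j). if i = l then D (A $$ (i, j)) else A $$ (i, j))"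
  have B: "?B \<in> carrier_mat k k" by simp
  from rows[OF l] show "det ?B = 0"
  proof
    assume 0: "\<forall>j<k. D (A $$ (l, j)) = 0"
    have "(\<Prod>i = 0..<k. ?B $$ (i, p i)) = 0" if p: "p permutes {0..<k}" for p
    proof (rule prod_zero)
      have "p l < k" using permutes_in_image[OF p, of l] l by simp
      then show "\<exists>i\<in>{0..<k}. ?B $$ (i, p i) = 0" using l 0 by (intro bexI[of _ l]) auto
    qed simp
    then show ?thesis unfolding det_def'[OF B] by (intro sum.neutral) simp
  next
    assume "\<exists>l'<k. l' \<noteq> l \<and> (\<forall>j<k. D (A $$ (l, j)) = A $$ (l', j))"
    then obtain l' where l': "l' < k" "l' \<noteq> l" "\<forall>j<k. D (A $$ (l, j)) = A $$ (l', j)" by blast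
    have "row ?B l = row ?B l'" using l l' by (intro eq_vecI) auto
    then show ?thesis using det_identical_rows[OF B l'(2)[symmetric] l l'(1)] by simp
  qed
qed

section \<open>Initial minors under left and right polarizations\<close>

definition initial_mat :: "nat \<Rightarrow> cpoly mat" where
  "initial_mat k = mat k k (\<lambda>(s, t). var (Suc s) (Suc t))"

lemma row_det_upt: "row_det [1..<Suc k] = det (initial_mat k)"
proof -
  have "mat k k (\<lambda>(s, t). var ([1..<Suc k] ! s) (Suc t)) = initial_mat k"
    unfolding initial_mat_def by (intro eq_matI) (simp_all del: upt_Suc)
  then show ?thesis by (simp add: row_det_def del: upt_Suc)
qed

lemma bideterminant_D_tab: "bideterminant (D_tab \<nu>) = prod_list (map (\<lambda>k. det (initial_mat k)) \<nu>)"
  unfolding bideterminant_def D_tab_def map_map comp_def row_det_upt ..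

lemma derivation_polarization: "derivation (polarization d i j)"
  by (simp add: derivation_def polarization_add polarization_mult)

text \<open>In each initial minor row j is replaced by the earlier row i, which is then repeated.
  The bound by d guarantees that the polarization, a sum over d places, reaches every column of the
  minor.\<close>

lemma polarization_hwv:
  assumes "1 \<le> i" "i < j" "\<And>k. k \<in> set \<nu> \<Longrightarrow> k \<le> d"
  shows "polarization d i j (bideterminant (D_tab \<nu>)) = 0"
  unfolding bideterminant_D_tab
proof (rule derivation_prod_list_0[OF derivation_polarization])
  fix p assume "p \<in> set (map (\<lambda>k. det (initial_mat k)) \<nu>)"
  then obtain k where k: "p = det (initial_mat k)" "k \<le> d" using assms(3) by auto
  show "polarization d i j p = 0"
    unfolding k(1)
  proof (rule derivation_det_0[OF derivation_polarization])
    show "initial_mat k \<in> carrier_mat k k" by (simp add: initial_mat_def)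
    fix l assume l: "l < k"
    have entry: "polarization d i j (initial_mat k $$ (l, c)) = (if j = Suc l then var i (Suc c) else 0)" if "c < k" for c
      using that l k(2) by (simp add: initial_mat_def polarization_var)
    show "(\<forall>c<k. polarization d i j (initial_mat k $$ (l, c)) = 0) \<or>
      (\<exists>l'<k. l' \<noteq> l \<and> (\<forall>c<k. polarization d i j (initial_mat k $$ (l, c)) = initial_mat k $$ (l', c)))"
    proof (cases "j = Suc l")
      case True
      then have "i - 1 < k" "i - 1 \<noteq> l" "Suc (i - 1) = i" using assms(1,2) l by auto
      then show ?thesis using l entry True
        by (intro disjI2 exI[of _ "i - 1"]) (simp add: initial_mat_def)
    qed (simp add: entry)
  qed
qed

text \<open>The right action of \<open>gl(d)\<close>: \<open>(a|t')\<close> is replaced by \<open>(a|t)\<close>.\<close>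

definition right_polarization :: "nat \<Rightarrow> nat \<Rightarrow> nat \<Rightarrow> cpoly \<Rightarrow> cpoly" where
  "right_polarization N t t' p = (\<Sum>i = 1..N. var i t * partial (i, t') p)"

lemma derivation_right_polarization: "derivation (right_polarization N t t')"
proof -
  have "(\<Sum>i = 1..N. var i t * partial (i, t') (p * q)) =
      (\<Sum>i = 1..N. var i t * partial (i, t') p * q + p * (var i t * partial (i, t') q))" for p q
    by (intro sum.cong refl) (simp add: partial_mult distrib_left mult_ac)
  then show ?thesis
    by (simp add: derivation_def right_polarization_def partial_add distrib_left sum.distrib
        sum_distrib_left sum_distrib_right)
qed

lemma right_polarization_var:
  assumes "a \<in> {1..N}"
  shows "right_polarization N t t' (var a b) = (if b = t' then var a t else 0)"
proof -
  have "right_polarization N t t' (var a b) = (\<Sum>i = 1..N. if i = a then if b = t' then var a t else 0 else 0)"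
    unfolding right_polarization_def partial_var by (intro sum.cong) auto
  then show ?thesis using assms by simp
qed

text \<open>Now a column is replaced by an earlier one; transposing the minor reduces this to the
  statement about rows.\<close>

lemma right_polarization_hwv:
  assumes "1 \<le> t" "t < t'" "\<And>k. k \<in> set \<nu> \<Longrightarrow> k \<le> N"
  shows "right_polarization N t t' (bideterminant (D_tab \<nu>)) = 0"
  unfolding bideterminant_D_tab
proof (rule derivation_prod_list_0[OF derivation_right_polarization])
  fix p assume "p \<in> set (map (\<lambda>k. det (initial_mat k)) \<nu>)"
  then obtain k where k: "p = det (initial_mat k)" "k \<le> N" using assms(3) by auto
  let ?A = "transpose_mat (initial_mat k)"
  have A: "initial_mat k \<in> carrier_mat k k" "?A \<in> carrier_mat k k" by (simp_all add: initial_mat_def)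
  have "p = det ?A" using det_transpose[OF A(1)] k(1) by simp
  moreover have "right_polarization N t t' (det ?A) = 0"
  proof (rule derivation_det_0[OF derivation_right_polarization A(2)])
    fix l assume l: "l < k"
    have entry: "right_polarization N t t' (?A $$ (l, c)) = (if t' = Suc l then var (Suc c) t else 0)" if "c < k" for c
      using that l k(2) by (simp add: initial_mat_def right_polarization_var)
    show "(\<forall>c<k. right_polarization N t t' (?A $$ (l, c)) = 0) \<or>
      (\<exists>l'<k. l' \<noteq> l \<and> (\<forall>c<k. right_polarization N t t' (?A $$ (l, c)) = ?A $$ (l', c)))"
    proof (cases "t' = Suc l")
      case True
      then have "t - 1 < k" "t - 1 \<noteq> l" "Suc (t - 1) = t" using assms(1,2) l by auto
      then show ?thesis using l entry True
        by (intro disjI2 exI[of _ "t - 1"]) (simp add: initial_mat_def)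
    qed (simp add: entry)
  qed
  ultimately show "right_polarization N t t' p = 0" by simp
qed

section \<open>Degrees of the highest weight vector\<close>

definition additive_degree :: "(((nat \<times> nat) \<Rightarrow>\<^sub>0 nat) \<Rightarrow> nat) \<Rightarrow> bool" where
  "additive_degree \<phi> \<longleftrightarrow> \<phi> 0 = 0 \<and> (\<forall>m m'. \<phi> (m + m') = \<phi> m + \<phi> m')"

text \<open>The degree is left abstract so that one argument covers row degrees, column degrees and
  the exponents of single variables.\<close>

definition homogeneous :: "(((nat \<times> nat) \<Rightarrow>\<^sub>0 nat) \<Rightarrow> nat) \<Rightarrow> nat \<Rightarrow> cpoly \<Rightarrow> bool" where
  "homogeneous \<phi> a p \<longleftrightarrow> (\<forall>m\<in>keys p. \<phi> m = a)"

lemma homogeneous_mult: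
  assumes "additive_degree \<phi>" "homogeneous \<phi> a p" "homogeneous \<phi> b q"
  shows "homogeneous \<phi> (a + b) (p * q)"
  unfolding homogeneous_def
proof
  fix m assume "m \<in> keys (p * q)"
  then obtain u v where "u \<in> keys p" "v \<in> keys q" "m = u + v"
    using keys_mult[of p q] by blast
  with assms show "\<phi> m = a + b" by (simp add: homogeneous_def additive_degree_def)
qed

lemma homogeneous_1: "additive_degree \<phi> \<Longrightarrow> homogeneous \<phi> 0 1"
  by (simp add: homogeneous_def additive_degree_def)

lemma homogeneous_prod:
  assumes "additive_degree \<phi>" "finite I" "\<And>i. i \<in> I \<Longrightarrow> homogeneous \<phi> (a i) (f i)"
  shows "homogeneous \<phi> (\<Sum>i\<in>I. a i) (\<Prod>i\<in>I. f i)"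
  using assms(2,3)
  by (induction I) (simp_all add: homogeneous_1[OF assms(1)] homogeneous_mult[OF assms(1)])

lemma homogeneous_prod_list:
  assumes "additive_degree \<phi>" "\<And>k. k \<in> set ks \<Longrightarrow> homogeneous \<phi> (a k) (f k)"
  shows "homogeneous \<phi> (sum_list (map a ks)) (prod_list (map f ks))"
  using assms(2)
  by (induction ks) (simp_all add: homogeneous_1[OF assms(1)] homogeneous_mult[OF assms(1)])

lemma homogeneous_var: "homogeneous \<phi> (\<phi> (Poly_Mapping.single (a, b) 1)) (var a b)"
  by (simp add: homogeneous_def var_def)

lemma homogeneous_sum:
  assumes "\<And>i. i \<in> I \<Longrightarrow> homogeneous \<phi> a (f i)"
  shows "homogeneous \<phi> a (\<Sum>i\<in>I. f i)"
  unfolding homogeneous_def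
proof
  fix m assume "m \<in> keys (\<Sum>i\<in>I. f i)"
  then have "(\<Sum>i\<in>I. lookup (f i) m) \<noteq> 0" by (simp add: in_keys_iff lookup_sum)
  then obtain i where "i \<in> I" "lookup (f i) m \<noteq> 0" by (metis (no_types, lifting) sum.neutral)
  with assms show "\<phi> m = a" by (simp add: homogeneous_def in_keys_iff)
qed

lemma homogeneous_initial_det:
  assumes \<phi>: "additive_degree \<phi>"
    and a: "\<And>p. p permutes {0..<k} \<Longrightarrow> (\<Sum>i = 0..<k. \<phi> (Poly_Mapping.single (Suc i, Suc (p i)) 1)) = a"
  shows "homogeneous \<phi> a (det (initial_mat k))"
proof -
  have A: "initial_mat k \<in> carrier_mat k k" by (simp add: initial_mat_def)
  show ?thesis unfolding det_def'[OF A]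
  proof (rule homogeneous_sum)
    fix p assume p: "p \<in> {p. p permutes {0..<k}}"
    then have lt: "p i < k" if "i < k" for i using permutes_in_image[of p "{0..<k}" i] that by simp
    have "homogeneous \<phi> a (\<Prod>i = 0..<k. var (Suc i) (Suc (p i)))"
      using homogeneous_prod[OF \<phi>, of "{0..<k}" "\<lambda>i. \<phi> (Poly_Mapping.single (Suc i, Suc (p i)) 1)"] homogeneous_var[of \<phi>] a p
      by fastforce
    moreover have "(\<Prod>i = 0..<k. initial_mat k $$ (i, p i)) = (\<Prod>i = 0..<k. var (Suc i) (Suc (p i)))"
      using lt by (intro prod.cong) (simp_all add: initial_mat_def)
    ultimately show "homogeneous \<phi> a (signof p * (\<Prod>i = 0..<k. initial_mat k $$ (i, p i)))"
      by (auto simp: sign_def homogeneous_def)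
  qed
qed

lemma sum_list_indicator: "sum_list (map (\<lambda>k. if s \<le> k then 1 else 0) \<nu>) = col_height \<nu> s"
proof -
  have "sum_list (map (\<lambda>k. if s \<le> k then 1 else 0) \<nu>) = (\<Sum>r<length \<nu>. if s \<le> \<nu> ! r then 1 else 0 :: nat)"
    by (simp add: sum_list_sum_nth atLeast0LessThan)
  also have "\<dots> = card ({..<length \<nu>} \<inter> {r. s \<le> \<nu> ! r})"
    by (simp add: sum.If_cases)
  also have "{..<length \<nu>} \<inter> {r. s \<le> \<nu> ! r} = {r. r < length \<nu> \<and> s \<le> \<nu> ! r}" by auto
  finally show ?thesis by (simp add: col_height_def)
qed

lemma hwv_row_degree:
  assumes "1 \<le> s" "\<And>k. k \<in> set \<nu> \<Longrightarrow> k \<le> d"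
  shows "homogeneous (\<lambda>m. \<Sum>t = 1..d. lookup m (s, t)) (col_height \<nu> s) (bideterminant (D_tab \<nu>))"
  unfolding bideterminant_D_tab sum_list_indicator[symmetric]
proof (rule homogeneous_prod_list)
  let ?\<phi> = "\<lambda>m :: (nat \<times> nat) \<Rightarrow>\<^sub>0 nat. \<Sum>t = 1..d. lookup m (s, t)"
  show \<phi>: "additive_degree ?\<phi>" by (simp add: additive_degree_def lookup_add sum.distrib)
  fix k assume "k \<in> set \<nu>"
  then have k: "k \<le> d" by (rule assms(2))
  show "homogeneous ?\<phi> (if s \<le> k then 1 else 0) (det (initial_mat k))"
  proof (rule homogeneous_initial_det[OF \<phi>])
    fix p assume p: "p permutes {0..<k}"
    have "(\<Sum>i = 0..<k. ?\<phi> (Poly_Mapping.single (Suc i, Suc (p i)) 1)) = (\<Sum>i = 0..<k. if i = s - 1 then 1 else 0)"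
    proof (rule sum.cong[OF refl])
      fix i assume i: "i \<in> {0..<k}"
      then have "Suc (p i) \<in> {1..d}" using permutes_in_image[OF p, of i] k by auto
      then have 1: "(\<Sum>t = 1..d. if t = Suc (p i) then if Suc i = s then 1 else 0 else 0) = (if Suc i = s then 1 else 0 :: nat)"
        by simp
      have "?\<phi> (Poly_Mapping.single (Suc i, Suc (p i)) 1) =
          (\<Sum>t = 1..d. if t = Suc (p i) then if Suc i = s then 1 else 0 else 0)"
        by (intro sum.cong) (auto simp: lookup_single when_def)
      also note 1
      also have "(if Suc i = s then 1 else 0 :: nat) = (if i = s - 1 then 1 else 0)"
        using assms(1) by auto
      finally show "?\<phi> (Poly_Mapping.single (Suc i, Suc (p i)) 1) = (if i = s - 1 then 1 else 0)" .
    qed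
    also have "\<dots> = (if s \<le> k then 1 else 0)" using assms(1) by auto
    finally show "(\<Sum>i = 0..<k. ?\<phi> (Poly_Mapping.single (Suc i, Suc (p i)) 1)) = (if s \<le> k then 1 else 0)" .
  qed
qed

lemma hwv_col_degree:
  assumes "1 \<le> t" "\<And>k. k \<in> set \<nu> \<Longrightarrow> k \<le> N"
  shows "homogeneous (\<lambda>m. \<Sum>i = 1..N. lookup m (i, t)) (col_height \<nu> t) (bideterminant (D_tab \<nu>))"
  unfolding bideterminant_D_tab sum_list_indicator[symmetric]
proof (rule homogeneous_prod_list)
  let ?\<phi> = "\<lambda>m :: (nat \<times> nat) \<Rightarrow>\<^sub>0 nat. \<Sum>i = 1..N. lookup m (i, t)"
  show \<phi>: "additive_degree ?\<phi>" by (simp add: additive_degree_def lookup_add sum.distrib)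
  fix k assume "k \<in> set \<nu>"
  then have k: "k \<le> N" by (rule assms(2))
  show "homogeneous ?\<phi> (if t \<le> k then 1 else 0) (det (initial_mat k))"
  proof (rule homogeneous_initial_det[OF \<phi>])
    fix p assume p: "p permutes {0..<k}"
    let ?g = "\<lambda>c. if c = t - 1 then 1 else 0 :: nat"
    have "(\<Sum>i = 0..<k. ?\<phi> (Poly_Mapping.single (Suc i, Suc (p i)) 1)) = (\<Sum>i = 0..<k. ?g (p i))"
    proof (rule sum.cong[OF refl])
      fix i assume i: "i \<in> {0..<k}"
      then have "Suc i \<in> {1..N}" using k by auto
      then have 1: "(\<Sum>a = 1..N. if a = Suc i then if Suc (p i) = t then 1 else 0 else 0) = (if Suc (p i) = t then 1 else 0 :: nat)"
        by simp
      have "?\<phi> (Poly_Mapping.single (Suc i, Suc (p i)) 1) =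
          (\<Sum>a = 1..N. if a = Suc i then if Suc (p i) = t then 1 else 0 else 0)"
        by (intro sum.cong) (auto simp: lookup_single when_def)
      also note 1
      also have "(if Suc (p i) = t then 1 else 0 :: nat) = ?g (p i)"
        using assms(1) by auto
      finally show "?\<phi> (Poly_Mapping.single (Suc i, Suc (p i)) 1) = ?g (p i)" .
    qed
    \<comment> \<open>A permutation meets each column exactly once.\<close>
    also have "\<dots> = (\<Sum>c = 0..<k. ?g c)"
      using sum.permute[OF p, of ?g] by (simp add: comp_def)
    also have "\<dots> = (if t \<le> k then 1 else 0)" using assms(1) by auto
    finally show "(\<Sum>i = 0..<k. ?\<phi> (Poly_Mapping.single (Suc i, Suc (p i)) 1)) = (if t \<le> k then 1 else 0)" .
  qed
qed

lemma hwv_proper: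
  assumes "\<And>k. k \<in> set \<nu> \<Longrightarrow> k \<le> N"
  shows "proper N (bideterminant (D_tab \<nu>))"
proof -
  have zero: "homogeneous (\<lambda>m. lookup m (a, b)) 0 (bideterminant (D_tab \<nu>))" if "a \<notin> {1..N}" for a b
  proof -
    let ?\<phi> = "\<lambda>m :: (nat \<times> nat) \<Rightarrow>\<^sub>0 nat. lookup m (a, b)"
    have \<phi>: "additive_degree ?\<phi>" by (simp add: additive_degree_def lookup_add)
    have "homogeneous ?\<phi> 0 (det (initial_mat k))" if "k \<in> set \<nu>" for k
    proof (rule homogeneous_initial_det[OF \<phi>], rule sum.neutral, rule ballI)
      fix p i assume "i \<in> {0..<k}"
      then have "Suc i \<in> {1..N}" using assms[OF \<open>k \<in> set \<nu>\<close>] by simp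
      then have "Suc i \<noteq> a" using \<open>a \<notin> {1..N}\<close> by blast
      then show "?\<phi> (Poly_Mapping.single (Suc i, Suc (p i)) 1) = 0" by (simp add: lookup_single)
    qed
    from homogeneous_prod_list[OF \<phi> this, of \<nu>] show ?thesis
      by (simp add: bideterminant_D_tab)
  qed
  show ?thesis
    unfolding proper_def
  proof (intro ballI subsetI)
    fix m x assume m: "m \<in> keys (bideterminant (D_tab \<nu>))" and x: "x \<in> keys m"
    obtain a b where ab: "x = (a, b)" by (cases x)
    have "lookup m (a, b) = 0" if "a \<notin> {1..N}"
      using zero[OF that] m unfolding homogeneous_def by blast
    then have "a \<in> {1..N}" using x unfolding ab in_keys_iff by blast
    then show "x \<in> {1..N} \<times> UNIV" using ab by simp
  qed
qed

section \<open>Right polarizations and vanishing\<close>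

text \<open>Among the monomials of \<open>p\<close> that are triangular in the first \<open>k\<close> rows, take one with the
  fewest factors \<open>(r|t')\<close>, \<open>t' > k + 1\<close>, in the next row \<open>r\<close>. If there is one left, trading it for
  \<open>(r|k + 1)\<close> gives a monomial of the right polarization of \<open>p\<close> that cannot cancel.\<close>

lemma triangular_monomial:
  assumes p: "p \<noteq> 0" and \<rho>: "inj_on \<rho> {1..q}" "\<rho> ` {1..q} \<subseteq> {1..N}"
    and killed: "\<And>t t'. 1 \<le> t \<Longrightarrow> t < t' \<Longrightarrow> t' \<le> d \<Longrightarrow> right_polarization N t t' p = 0"
    and "k \<le> q"
  shows "\<exists>m\<in>keys p. \<forall>s t. 1 \<le> s \<longrightarrow> s \<le> k \<longrightarrow> s < t \<longrightarrow> t \<le> d \<longrightarrow> lookup m (\<rho> s, t) = 0"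
  using \<open>k \<le> q\<close>
proof (induction k)
  case 0
  have "\<exists>m. m \<in> keys p" using p by (metis all_not_in_conv keys_eq_empty)
  then show ?case by auto
next
  case (Suc k)
  define G where "G m \<longleftrightarrow> (\<forall>s t. 1 \<le> s \<longrightarrow> s \<le> k \<longrightarrow> s < t \<longrightarrow> t \<le> d \<longrightarrow> lookup m (\<rho> s, t) = 0)"
    for m :: "(nat \<times> nat) \<Rightarrow>\<^sub>0 nat"
  define r where "r = \<rho> (Suc k)"
  define X where "X m = (\<Sum>t\<in>{Suc (Suc k)..d}. lookup m (r, t))" for m :: "(nat \<times> nat) \<Rightarrow>\<^sub>0 nat"
  let ?S = "{m \<in> keys p. G m}"
  have "?S \<noteq> {}" using Suc by (auto simp: G_def)
  then obtain m where m: "m \<in> ?S" and least: "\<And>m'. m' \<in> ?S \<Longrightarrow> X m \<le> X m'"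
    using ex_min_if_finite[of "X ` ?S"] by (auto simp: not_less)
  have r: "r \<in> {1..N}" using subsetD[OF \<rho>(2) imageI, of "Suc k"] Suc.prems by (simp add: r_def)
  have r_neq: "\<rho> s \<noteq> r" if "1 \<le> s" "s \<le> k" for s
    using inj_on_eq_iff[OF \<rho>(1), of s "Suc k"] that Suc.prems by (simp add: r_def)
  have "X m = 0"
  proof (rule ccontr)
    assume "X m \<noteq> 0"
    then obtain t' where t': "t' \<in> {Suc (Suc k)..d}" "lookup m (r, t') \<noteq> 0"
      unfolding X_def by (metis (no_types, lifting) sum.neutral)
    let ?t = "Suc k"
    let ?e = "\<lambda>i t. Poly_Mapping.single (i, t) (1::nat)"
    define m' where "m' = m - ?e r t' + ?e r ?t"
    have look: "lookup m' (i, u) =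
        lookup m (i, u) - (if i = r \<and> u = t' then 1 else 0) + (if i = r \<and> u = ?t then 1 else 0)" for i u
      by (simp add: m'_def lookup_add lookup_minus lookup_single when_def)
    have coeff: "lookup (var i ?t * partial (i, t') p) m' =
      (if lookup m' (i, ?t) = 0 then 0 else lookup p (m' - ?e i ?t + ?e i t') *
         of_nat (lookup (m' - ?e i ?t) (i, t') + 1))" for i
      by (simp add: lookup_var_mult lookup_partial)
    \<comment> \<open>A contribution of another row i to \<open>m'\<close> would come from a
      monomial of p that is still triangular in the first k rows and has one factor (r|t') fewer
      than m, against the minimality of m.\<close>
    have other: "lookup (var i ?t * partial (i, t') p) m' = 0" if "i \<noteq> r" for i
    proof (rule ccontr)
      let ?m = "m' - ?e i ?t + ?e i t'"
      assume "lookup (var i ?t * partial (i, t') p) m' \<noteq> 0"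
      then have nz: "lookup m' (i, ?t) \<noteq> 0" "?m \<in> keys p"
        unfolding coeff in_keys_iff by (auto split: if_splits)
      have "G ?m"
        unfolding G_def
      proof (intro allI impI)
        fix s u assume s: "1 \<le> s" "s \<le> k" "s < u" "u \<le> d"
        have Gm: "lookup m (\<rho> s, v) = 0" if "s < v" "v \<le> d" for v
          using m s that by (simp add: G_def)
        have "lookup m' (\<rho> s, ?t) = 0"
          using Gm[of ?t] r_neq[OF s(1,2)] s(2) t'(1) by (simp add: look)
        then have "\<rho> s \<noteq> i" using nz(1) by blast
        then show "lookup ?m (\<rho> s, u) = 0"
          using Gm[OF s(3,4)] r_neq[OF s(1,2)] by (simp add: lookup_add lookup_minus lookup_single look)
      qed
      then have "X m \<le> X ?m" using nz(2) by (intro least) simp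
      moreover have "X ?m < X m"
        unfolding X_def
      proof (rule sum_strict_mono_ex1)
        show "\<forall>u\<in>{Suc (Suc k)..d}. lookup ?m (r, u) \<le> lookup m (r, u)"
          using \<open>i \<noteq> r\<close> by (simp add: lookup_add lookup_minus lookup_single look)
        have "lookup ?m (r, t') < lookup m (r, t')"
          using t' \<open>i \<noteq> r\<close> by (simp add: lookup_add lookup_minus lookup_single look)
        then show "\<exists>u\<in>{Suc (Suc k)..d}. lookup ?m (r, u) < lookup m (r, u)"
          using t'(1) by blast
      qed simp
      ultimately show False by simp
    qed
    have "m' - ?e r ?t + ?e r t' = m"
      using t'(2) by (intro poly_mapping_eqI) (auto simp: lookup_add lookup_minus lookup_single when_def m'_def)
    then have "lookup (var r ?t * partial (r, t') p) m' \<noteq> 0"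
      using m by (simp add: coeff look in_keys_iff del: of_nat_add of_nat_Suc)
    moreover have "lookup (right_polarization N ?t t' p) m' =
        (\<Sum>i = 1..N. if i = r then lookup (var r ?t * partial (r, t') p) m' else 0)"
      unfolding right_polarization_def lookup_sum using other by (intro sum.cong) auto
    ultimately have "lookup (right_polarization N ?t t' p) m' \<noteq> 0" using r by simp
    moreover have "right_polarization N ?t t' p = 0" using t'(1) by (intro killed) auto
    ultimately show False by simp
  qed
  then have "lookup m (r, t) = 0" if "Suc k < t" "t \<le> d" for t
    using that by (simp add: X_def)
  then have "\<forall>s t. 1 \<le> s \<longrightarrow> s \<le> Suc k \<longrightarrow> s < t \<longrightarrow> t \<le> d \<longrightarrow> lookup m (\<rho> s, t) = 0"
    using m by (auto simp: G_def r_def le_Suc_eq)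
  then show ?case using m by blast
qed

text \<open>By triangularity the rows 1..k lie within the columns 1..k, so the first k column totals
  sum to at least the first k row totals. The assumed bound is the opposite inequality; equality
  holds for every k, and differences give the single columns.\<close>

lemma young_squeeze:
  fixes c :: "nat \<Rightarrow> nat \<Rightarrow> nat"
  assumes rows: "\<And>s. s \<in> {1..q} \<Longrightarrow> (\<Sum>t = 1..d. c s t) = l s"
    and tri: "\<And>s t. s \<in> {1..q} \<Longrightarrow> s < t \<Longrightarrow> c s t = 0"
    and cols: "\<And>k. k \<le> q \<Longrightarrow> (\<Sum>t = 1..k. \<Sum>s = 1..q. c s t) \<le> (\<Sum>s = 1..k. l s)"
    and k: "k \<in> {1..q}"
  shows "(\<Sum>s = 1..q. c s k) = l k"
proof -
  have le: "(\<Sum>s = 1..k. l s) \<le> (\<Sum>t = 1..k. \<Sum>s = 1..q. c s t)" if "k \<le> q" for k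
  proof -
    have "l s \<le> (\<Sum>t = 1..k. c s t)" if s: "s \<in> {1..k}" for s
    proof -
      have "l s = (\<Sum>t = 1..d. c s t)" using rows[of s] s \<open>k \<le> q\<close> by simp
      also have "\<dots> = (\<Sum>t \<in> {1..d} \<inter> {1..k}. c s t)"
        using tri[of s] s \<open>k \<le> q\<close> by (intro sum.mono_neutral_right) auto
      also have "\<dots> \<le> (\<Sum>t = 1..k. c s t)" by (rule sum_mono2) auto
      finally show ?thesis .
    qed
    then have "(\<Sum>s = 1..k. l s) \<le> (\<Sum>s = 1..k. \<Sum>t = 1..k. c s t)" by (rule sum_mono)
    also have "\<dots> \<le> (\<Sum>s = 1..q. \<Sum>t = 1..k. c s t)"
      using that by (intro sum_mono2) auto
    also have "\<dots> = (\<Sum>t = 1..k. \<Sum>s = 1..q. c s t)" by (rule sum.swap)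
    finally show ?thesis .
  qed
  have eq: "(\<Sum>t = 1..k. \<Sum>s = 1..q. c s t) = (\<Sum>s = 1..k. l s)" if "k \<le> q" for k
    using le[OF that] cols[OF that] by simp
  obtain j where j: "k = Suc j" using k by (cases k) auto
  show ?thesis using eq[of k] eq[of j] k by (simp add: j)
qed

text \<open>The cells in the first k columns, counted by columns and by rows.\<close>

lemma sum_col_height: "(\<Sum>s = 1..k. col_height \<nu> s) = (\<Sum>r<length \<nu>. min k (\<nu> ! r))"
proof -
  have "col_height \<nu> s = (\<Sum>r<length \<nu>. if s \<le> \<nu> ! r then 1 else 0)" for s
    unfolding sum_list_indicator[symmetric] by (simp add: sum_list_sum_nth atLeast0LessThan)
  then have "(\<Sum>s = 1..k. col_height \<nu> s) = (\<Sum>s = 1..k. \<Sum>r<length \<nu>. if s \<le> \<nu> ! r then 1 else 0)" by simp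
  also have "\<dots> = (\<Sum>r<length \<nu>. \<Sum>s = 1..k. if s \<le> \<nu> ! r then 1 else 0)" by (rule sum.swap)
  also have "\<dots> = (\<Sum>r<length \<nu>. min k (\<nu> ! r))"
  proof (rule sum.cong[OF refl])
    fix r
    have "(\<Sum>s = 1..k. if s \<le> \<nu> ! r then 1 else 0) = card ({1..k} \<inter> {s. s \<le> \<nu> ! r})"
      by (simp add: sum.If_cases)
    also have "{1..k} \<inter> {s. s \<le> \<nu> ! r} = {1..min k (\<nu> ! r)}" by auto
    finally show "(\<Sum>s = 1..k. if s \<le> \<nu> ! r then 1 else 0) = min k (\<nu> ! r)" by simp
  qed
  finally show ?thesis .
qed

lemma ferrers_subset_col_height:
  assumes \<nu>: "sorted_wrt (\<ge>) \<nu>" and \<kappa>: "sorted_wrt (\<ge>) \<kappa>"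
    and le: "\<And>s. s \<in> {1..first_part \<nu>} \<Longrightarrow> col_height \<nu> s \<le> col_height \<kappa> s"
  shows "ferrers \<nu> \<subseteq> ferrers \<kappa>"
proof (rule subsetI)
  fix c assume "c \<in> ferrers \<nu>"
  then obtain r s where c: "c = (r, s)" "r < length \<nu>" "s < \<nu> ! r" by (auto simp: ferrers_def)
  have "{..r} \<subseteq> {r'. r' < length \<nu> \<and> Suc s \<le> \<nu> ! r'}"
  proof
    fix r' assume "r' \<in> {..r}"
    then show "r' \<in> {r'. r' < length \<nu> \<and> Suc s \<le> \<nu> ! r'}"
      using sorted_nth_mono[OF \<nu> _ c(2), of r'] c by simp
  qed
  then have "card {..r} \<le> col_height \<nu> (Suc s)" unfolding col_height_def by (intro card_mono) auto
  also have "\<dots> \<le> col_height \<kappa> (Suc s)" using nth_le_first_part[OF \<nu> c(2)] c(3) by (intro le) simp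
  finally have *: "r < col_height \<kappa> (Suc s)" by simp
  have "\<exists>r'. r \<le> r' \<and> r' < length \<kappa> \<and> Suc s \<le> \<kappa> ! r'"
  proof (rule ccontr)
    assume "\<not> ?thesis"
    then have "{r'. r' < length \<kappa> \<and> Suc s \<le> \<kappa> ! r'} \<subseteq> {..<r}" by (auto simp: not_le)
    then have "col_height \<kappa> (Suc s) \<le> card {..<r}" unfolding col_height_def by (intro card_mono) auto
    with * show False by simp
  qed
  then obtain r' where r': "r \<le> r'" "r' < length \<kappa>" "Suc s \<le> \<kappa> ! r'" by blast
  then have "Suc s \<le> \<kappa> ! r" using sorted_nth_mono[OF \<kappa> r'(1,2)] by simp
  then show "c \<in> ferrers \<kappa>" using r' c by (simp add: ferrers_def)
qed

section \<open>The right action of gl(d) on superpolynomials\<close>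

lemma finite_alphabet: "finite (alphabet m0 m1 n)"
  by (simp add: alphabet_def virtuals_def letters_def)

lemma bij_row_index: "bij_betw (row_index n) {c \<in> alphabet m0 m1 n. \<not> is_pos c} {1..n + m1}"
proof (rule bij_betw_imageI)
  show "inj_on (row_index n) {c \<in> alphabet m0 m1 n. \<not> is_pos c}"
    using row_index_inject by (intro inj_onI) blast
  show "row_index n ` {c \<in> alphabet m0 m1 n. \<not> is_pos c} = {1..n + m1}"
  proof
    show "row_index n ` {c \<in> alphabet m0 m1 n. \<not> is_pos c} \<subseteq> {1..n + m1}"
      by (auto simp: alphabet_def virtuals_def letters_def)
    show "{1..n + m1} \<subseteq> row_index n ` {c \<in> alphabet m0 m1 n. \<not> is_pos c}"
    proof
      fix i assume i: "i \<in> {1..n + m1}"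
      show "i \<in> row_index n ` {c \<in> alphabet m0 m1 n. \<not> is_pos c}"
      proof (cases "i \<le> n")
        case True
        then show ?thesis using i
          by (intro image_eqI[of _ _ "Lett i"]) (simp_all add: alphabet_def letters_def)
      next
        case False
        then have "Suc 0 \<le> i - n" "i - n \<le> m1" using i by auto
        then show ?thesis using False
          by (intro image_eqI[of _ _ "Neg (i - n)"]) (simp_all add: alphabet_def virtuals_def image_iff)
      qed
    qed
  qed
qed

lemma sum_row_index:
  "(\<Sum>c\<in>alphabet m0 m1 n. if is_pos c then 0 else g (row_index n c)) = (\<Sum>i = 1..n + m1. g i)"
proof -
  have "(\<Sum>c\<in>alphabet m0 m1 n. if is_pos c then 0 else g (row_index n c)) =
      (\<Sum>c\<in>{c \<in> alphabet m0 m1 n. \<not> is_pos c}. g (row_index n c))"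
    by (rule sum.mono_neutral_cong_right) (auto simp: finite_alphabet)
  also have "\<dots> = (\<Sum>i = 1..n + m1. g i)" by (rule sum.reindex_bij_betw[OF bij_row_index])
  finally show ?thesis .
qed

text \<open>The super form of \<open>right_polarization\<close>. The sum includes the odd variables,
  because it has to commute also with polarizations between even and odd symbols.\<close>

definition right_op :: "sym set \<Rightarrow> nat \<Rightarrow> nat \<Rightarrow> nat \<Rightarrow> fock \<Rightarrow> fock" where
  "right_op A n t t' f = (\<Sum>a\<in>A. create n a t (annih n a t' f))"

text \<open>The contractions at a = c and at a = b leave the same operator, which creates (c|t) and
  removes (b|t'), with opposite signs.\<close>

lemma right_op_polar:
  assumes ab: "c \<in> alphabet m0 m1 n" "b \<in> alphabet m0 m1 n" and t: "t \<in> {1..d}" "t' \<in> {1..d}"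
  shows "right_op (alphabet m0 m1 n) n t t' (polar n d c b f) = polar n d c b (right_op (alphabet m0 m1 n) n t t' f)"
proof -
  let ?A = "alphabet m0 m1 n"
  note lin = linear_op_sum[OF linear_create] linear_op_sum[OF linear_annih]
  have "right_op ?A n t t' (polar n d c b f) =
      (\<Sum>a\<in>?A. \<Sum>s = 1..d. create n a t (annih n a t' (create n c s (annih n b s f))))"
    by (simp add: right_op_def polar_def lin)
  also have "\<dots> = (\<Sum>a\<in>?A. \<Sum>s = 1..d. create n c s (annih n b s (create n a t (annih n a t' f)))
      + (if s = t' then if a = c then create n a t (annih n b s f) else 0 else 0)
      - (if s = t then if a = b then create n c s (annih n a t' f) else 0 else 0))"
  proof (intro sum.cong refl)
    fix a s assume "a \<in> ?A"
    then have alph: "{a, a, c, b} \<subseteq> ?A" using ab by simp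
    show "create n a t (annih n a t' (create n c s (annih n b s f))) =
      create n c s (annih n b s (create n a t (annih n a t' f)))
      + (if s = t' then if a = c then create n a t (annih n b s f) else 0 else 0)
      - (if s = t then if a = b then create n c s (annih n a t' f) else 0 else 0)"
      unfolding bilinear_super_commute[OF alph] bracket_sign_even[OF refl] scl_simps by simp
  qed
  also have "\<dots> = (\<Sum>a\<in>?A. \<Sum>s = 1..d. create n c s (annih n b s (create n a t (annih n a t' f))))
      + (\<Sum>a\<in>?A. if a = c then create n a t (annih n b t' f) else 0)
      - (\<Sum>a\<in>?A. if a = b then create n c t (annih n a t' f) else 0)"
    using t by (simp add: sum.distrib sum_subtractf)
  also have "\<dots> = (\<Sum>a\<in>?A. \<Sum>s = 1..d. create n c s (annih n b s (create n a t (annih n a t' f))))"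
    using ab by (simp add: finite_alphabet)
  also have "\<dots> = polar n d c b (right_op ?A n t t' f)"
    unfolding right_op_def polar_def lin by (rule sum.swap)
  finally show ?thesis .
qed

lemma right_op_word_op:
  assumes "set w \<subseteq> alphabet m0 m1 n \<times> alphabet m0 m1 n" and t: "t \<in> {1..d}" "t' \<in> {1..d}"
  shows "right_op (alphabet m0 m1 n) n t t' (word_op n d w f) = word_op n d w (right_op (alphabet m0 m1 n) n t t' f)"
  using assms(1)
proof (induction w)
  case (Cons x w)
  obtain a b where x: "x = (a, b)" by (cases x)
  then show ?case using Cons right_op_polar[OF _ _ t, of a m0 m1 n b] by simp
qed simp

lemma annih_degree_0:
  assumes a: "a \<in> alphabet m0 m1 n" and deg: "has_degree n d a 0 f" and t: "t \<in> {1..d}"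
  shows "annih n a t f = 0"
proof (rule fock_eq_0I, rule ccontr)
  fix A m assume "lookup (amp (annih n a t f) A) m \<noteq> 0"
  from annih_support[OF a this] obtain A' m' where
    nz: "lookup (amp f A') m' \<noteq> 0"
    and occ: "\<And>c s. c \<in> alphabet m0 m1 n \<Longrightarrow> occ n A' m' c s = occ n A m c s + (if c = a \<and> s = t then 1 else 0)"
    by blast
  have *: "lookup (amp f A') m' \<noteq> 0" "occ n A' m' a t = occ n A m a t + 1"
    using nz occ[OF a, of t] by simp_all
  from deg *(1) have "(\<Sum>t = 1..d. int (occ n A' m' a t)) = 0" by (simp add: has_degree_def)
  then have "int (occ n A' m' a t) = 0" using t by (subst (asm) sum_nonneg_eq_0_iff) auto
  with *(2) show False by simp
qed

text \<open>Where no odd variable occurs, the operator acts on each coefficient separately as an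
  ordinary right polarization. This carries annihilation over to the polynomials treated in
  \<open>triangular_monomial\<close>.\<close>

lemma right_op_amp:
  assumes deg: "\<And>a. a \<in> alphabet m0 m1 n \<Longrightarrow> is_pos a \<Longrightarrow> has_degree n d a 0 f" and t': "t' \<in> {1..d}"
  shows "amp (right_op (alphabet m0 m1 n) n t t' f) A = right_polarization (n + m1) t t' (amp f A)"
proof -
  have "amp (right_op (alphabet m0 m1 n) n t t' f) A =
      (\<Sum>c\<in>alphabet m0 m1 n. if is_pos c then 0 else var (row_index n c) t * partial (row_index n c, t') (amp f A))"
    unfolding right_op_def amp_sum
  proof (rule sum.cong[OF refl])
    fix c assume c: "c \<in> alphabet m0 m1 n"
    show "amp (create n c t (annih n c t' f)) A =
        (if is_pos c then 0 else var (row_index n c) t * partial (row_index n c, t') (amp f A))"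
    proof (cases "is_pos c")
      case True
      then have "annih n c t' f = 0" using annih_degree_0[OF c deg[OF c True] t'] by simp
      then show ?thesis using True linear_op_zero[OF linear_create] by simp
    qed (simp add: create_def annih_def)
  qed
  also have "\<dots> = (\<Sum>i = 1..n + m1. var i t * partial (i, t') (amp f A))"
    by (rule sum_row_index[where g = "\<lambda>i. var i t * partial (i, t') (amp f A)"])
  finally show ?thesis by (simp only: right_polarization_def)
qed

text \<open>Each polarization trades variables within one column. The set V is a parameter because
  totals are traced twice: over the whole alphabet back to the highest weight vector, and over the
  virtual symbols back through the outer word alone.\<close>

lemma word_support_columns:
  assumes V: "V \<subseteq> alphabet m0 m1 n" and w: "set w \<subseteq> V \<times> V"
    and nz: "lookup (amp (word_op n d w f) A) m \<noteq> 0"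
  shows "\<exists>A' m'. lookup (amp f A') m' \<noteq> 0 \<and>
    (\<forall>s. (\<Sum>c\<in>V. occ n A m c s) = (\<Sum>c\<in>V. occ n A' m' c s))"
  using w nz
proof (induction w arbitrary: A m)
  case Nil
  then show ?case by auto
next
  case (Cons x w)
  obtain a b where x: "x = (a, b)" by (cases x)
  have ab: "a \<in> V" "b \<in> V" using Cons.prems(1) by (simp_all add: x)
  have "lookup (amp (polar n d a b (word_op n d w f)) A) m \<noteq> 0"
    using Cons.prems(2) by (simp add: x)
  from polar_support[OF subsetD[OF V ab(1)] subsetD[OF V ab(2)] this] obtain A1 m1' t where
    1: "lookup (amp (word_op n d w f) A1) m1' \<noteq> 0"
      "\<And>c s. c \<in> alphabet m0 m1 n \<Longrightarrow> occ n A m c s + (if c = b \<and> s = t then 1 else 0)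
         = occ n A1 m1' c s + (if c = a \<and> s = t then 1 else 0)"
    by metis
  have fin: "finite V" using finite_subset[OF V finite_alphabet] .
  have "(\<Sum>c\<in>V. occ n A m c s) = (\<Sum>c\<in>V. occ n A1 m1' c s)" for s
  proof -
    have "(\<Sum>c\<in>V. occ n A m c s + (if c = b then if s = t then 1 else 0 else 0)) =
        (\<Sum>c\<in>V. occ n A1 m1' c s + (if c = a then if s = t then 1 else 0 else 0))"
    proof (rule sum.cong[OF refl])
      fix c assume "c \<in> V"
      then show "occ n A m c s + (if c = b then if s = t then 1 else 0 else 0) =
          occ n A1 m1' c s + (if c = a then if s = t then 1 else 0 else 0)"
        using 1(2)[OF subsetD[OF V], of c s] by auto
    qed
    then show ?thesis using ab fin by (simp add: sum.distrib)
  qed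
  moreover have "set w \<subseteq> V \<times> V" using Cons.prems(1) by simp
  ultimately show ?case using Cons.IH[OF _ 1(1)] by simp
qed

lemma count_list_cells: "count_list (map F (cells \<nu>)) c = count_list (map F (rev_rows \<nu> [0..<length \<nu>])) c"
proof -
  have "count_list (map F (concat (map (row_cells \<nu>) rs))) c = count_list (map F (rev_rows \<nu> rs)) c" for rs
    by (induction rs) (simp_all add: count_list_map_rev)
  then show ?thesis by (simp add: cells_def)
qed

lemma emb_support:
  assumes "lookup (amp (emb p) A) m \<noteq> 0"
  shows "A = {}" "m \<in> keys p"
  using assms by (auto simp: emb_def in_keys_iff split: if_splits)

theorem skew_vanishing:
  assumes \<nu>: "sorted_wrt (\<ge>) \<nu>" and \<kappa>: "sorted_wrt (\<ge>) \<kappa>" and vc: "virtual_choice m0 m1 \<nu> \<alpha> \<beta>"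
    and le_n: "\<And>k. k \<in> set \<kappa> \<Longrightarrow> k \<le> n" and le_d: "\<And>k. k \<in> set \<kappa> \<Longrightarrow> k \<le> d"
    and T: "\<And>c. c \<in> set (cells \<nu>) \<Longrightarrow> T c \<in> letters n"
    and not_sub: "\<not> ferrers \<nu> \<subseteq> ferrers \<kappa>"
  shows "word_op n d (pair_word (col_sym \<beta>) (row_sym \<alpha>) (cells \<nu>) @ pair_word (row_sym \<alpha>) T (cells \<nu>))
    (emb (bideterminant (D_tab \<kappa>))) = 0"
proof (rule ccontr)
  let ?Al = "alphabet m0 m1 n" and ?V = "virtuals m0 m1" and ?q = "first_part \<nu>"
  let ?w1 = "pair_word (col_sym \<beta>) (row_sym \<alpha>) (cells \<nu>)" and ?w2 = "pair_word (row_sym \<alpha>) T (cells \<nu>)"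
  let ?v = "bideterminant (D_tab \<kappa>)"
  let ?z = "word_op n d ?w2 (emb ?v)"
  let ?y = "word_op n d (?w1 @ ?w2) (emb ?v)"
  assume "?y \<noteq> 0"
  have AS: "row_sym \<alpha> c \<in> ?V" if "c \<in> set (cells \<nu>)" for c
    using row_sym_alphabet[OF vc, of "fst c" "snd c"] that unfolding set_cells by (simp add: case_prod_beta)
  have BS: "col_sym \<beta> c \<in> ?V" if "c \<in> set (cells \<nu>)" for c
  proof -
    have "fst c < length \<nu>" "1 \<le> snd c" "snd c \<le> \<nu> ! fst c"
      using that unfolding set_cells by (simp_all add: case_prod_beta)
    with nth_le_first_part[OF \<nu>, of "fst c"] col_sym_alphabet[OF vc, of "snd c" "fst c"] show ?thesis by simp
  qed
  have VA: "?V \<subseteq> ?Al" and finV: "finite ?V" by (auto simp: alphabet_def virtuals_def)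
  have w1: "set ?w1 \<subseteq> ?V \<times> ?V" using AS BS by auto
  have w2: "set ?w2 \<subseteq> ?Al \<times> ?Al" using AS T VA by (auto simp: alphabet_def)
  have w: "set (?w1 @ ?w2) \<subseteq> ?Al \<times> ?Al" using w1 w2 VA by auto
  have proper: "proper n ?v" by (rule hwv_proper) (rule le_n)

  define NA where "NA c = count_list (map (row_sym \<alpha>) (cells \<nu>)) c" for c
  have T0: "count_list (map T (cells \<nu>)) c = 0" if "c \<in> ?V" for c
  proof -
    have "letters n \<inter> ?V = {}" by (auto simp: virtuals_def letters_def)
    then have "c \<notin> T ` set (cells \<nu>)" using T that by blast
    then show ?thesis by (simp add: count_list_0_iff)
  qed
  have NA_Neg: "NA (Neg j) = 0" for j
    unfolding NA_def by (rule count_list_map_0) (simp add: row_sym_def split: prod.splits)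
  have NB_Pos: "count_list (map (col_sym \<beta>) (cells \<nu>)) (Pos j) = 0" for j
    by (rule count_list_map_0) (simp add: col_sym_def split: prod.splits)
  have z_deg: "has_degree n d c (int (NA c)) ?z" if "c \<in> ?V" for c
    using has_degree_word_op[OF w2 subsetD[OF VA that] has_degree_emb_virtual[OF proper that], of d] T0[OF that]
    by (simp add: NA_def)
  have y_deg: "has_degree n d c (int (count_list (map (col_sym \<beta>) (cells \<nu>)) c)) ?y" if "c \<in> ?V" for c
    using has_degree_word_op[OF w subsetD[OF VA that] has_degree_emb_virtual[OF proper that], of d] T0[OF that]
    by (simp add: NA_def)
  have NB: "count_list (map (col_sym \<beta>) (cells \<nu>)) (Neg (\<beta> s)) = col_height \<nu> s" if s: "s \<in> {1..?q}" for s
  proof -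
    have "count_list (map (col_sym \<beta>) (rev_rows \<nu> [0..<length \<nu>])) (Neg (\<beta> s)) =
        length (filter (\<lambda>r. s \<le> \<nu> ! r) [0..<length \<nu>])"
      using s vc nth_le_first_part[OF \<nu>] by (intro count_col_sym[where m = ?q]) (auto simp: virtual_choice_def)
    with length_filter_rows[of 0 s \<nu>] show ?thesis by (simp add: count_list_cells)
  qed
  have \<beta>V: "Neg (\<beta> s) \<in> ?V" if "s \<in> {1..?q}" for s
    using col_sym_alphabet[OF vc, of s 0] that by (simp add: col_sym_def)

  have y_right: "right_op ?Al n t t' ?y = 0" if t: "1 \<le> t" "t < t'" "t' \<le> d" for t t'
  proof -
    have td: "t \<in> {1..d}" "t' \<in> {1..d}" using t by auto
    have "amp (right_op ?Al n t t' (emb ?v)) A = 0" for A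
    proof -
      have "has_degree n d a 0 (emb ?v)" if "a \<in> ?Al" "is_pos a" for a
        using has_degree_emb_virtual[OF proper, of a m0 m1] that by (auto simp: alphabet_def letters_def)
      from right_op_amp[OF this td(2)]
      have "amp (right_op ?Al n t t' (emb ?v)) A = right_polarization (n + m1) t t' (amp (emb ?v) A)" .
      also have "\<dots> = 0"
        using right_polarization_hwv[OF t(1,2), of \<kappa> "n + m1"] le_n
          derivation_0[OF derivation_right_polarization] by (simp add: emb_def trans_le_add1)
      finally show ?thesis .
    qed
    then have "right_op ?Al n t t' (emb ?v) = 0" by (intro fock_eqI) simp
    then show ?thesis using right_op_word_op[OF w td, of "emb ?v"] by (simp add: word_op_zero)
  qed
  obtain A where A: "amp ?y A \<noteq> 0" using \<open>?y \<noteq> 0\<close> fock_eqI[of ?y 0] by auto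
  have inj: "inj_on (\<lambda>s. n + \<beta> s) {1..?q}"
    using vc unfolding virtual_choice_def by (intro inj_onI) (auto dest: inj_onD)
  have range: "(\<lambda>s. n + \<beta> s) ` {1..?q} \<subseteq> {1..n + m1}"
    using vc unfolding virtual_choice_def by force
  have killed: "right_polarization (n + m1) t t' (amp ?y A) = 0" if t: "1 \<le> t" "t < t'" "t' \<le> d" for t t'
  proof -
    have "has_degree n d a 0 ?y" if a: "a \<in> ?Al" "is_pos a" for a
    proof -
      obtain j where j: "a = Pos j" using a(2) by (cases a) auto
      have "a \<in> ?V" using a by (auto simp: alphabet_def letters_def)
      from y_deg[OF this] show ?thesis by (simp add: j NB_Pos)
    qed
    then have "amp (right_op ?Al n t t' ?y) A = right_polarization (n + m1) t t' (amp ?y A)"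
      using t by (intro right_op_amp) auto
    then show ?thesis by (simp only: y_right[OF t] amp_simps)
  qed
  from triangular_monomial[OF A inj range killed order.refl] obtain m where
    m: "m \<in> keys (amp ?y A)" and
    tri: "\<And>s t. 1 \<le> s \<Longrightarrow> s \<le> ?q \<Longrightarrow> s < t \<Longrightarrow> t \<le> d \<Longrightarrow> lookup m (n + \<beta> s, t) = 0"
    by blast
  have nz: "lookup (amp ?y A) m \<noteq> 0" using m by (simp add: in_keys_iff)

  \<comment> \<open>\<open>has_degree\<close> counts only the columns up to d, so the matrix is cut
    off there; this permits partial sums that run beyond d.\<close>
  define c where "c s t = (if t \<in> {1..d} then occ n A m (Neg (\<beta> s)) t else 0)" for s t
  have rows: "(\<Sum>t = 1..d. c s t) = col_height \<nu> s" if s: "s \<in> {1..?q}" for s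
  proof -
    have "(\<Sum>t = 1..d. int (occ n A m (Neg (\<beta> s)) t)) = int (col_height \<nu> s)"
      using y_deg[OF \<beta>V[OF s]] nz by (simp add: has_degree_def NB[OF s])
    then have "(\<Sum>t = 1..d. occ n A m (Neg (\<beta> s)) t) = col_height \<nu> s" by (simp flip: of_nat_sum)
    then show ?thesis by (simp add: c_def)
  qed
  have c_tri: "c s t = 0" if "s \<in> {1..?q}" "s < t" for s t
    using tri[of s t] that by (simp add: c_def occ_def)
  have inj_Neg: "inj_on (\<lambda>s. Neg (\<beta> s)) {1..?q}"
    using vc unfolding virtual_choice_def by (intro inj_on_Neg) blast
  have sub_sum: "(\<Sum>s = 1..?q. c s t) \<le> (\<Sum>a\<in>X. occ n A m a t)" if "t \<in> {1..d}" "?V \<subseteq> X" "finite X" for t X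
  proof -
    have "(\<Sum>s = 1..?q. c s t) = (\<Sum>a\<in>(\<lambda>s. Neg (\<beta> s)) ` {1..?q}. occ n A m a t)"
      using that(1) sum.reindex[OF inj_Neg, of "\<lambda>a. occ n A m a t"] by (simp add: c_def)
    also have "\<dots> \<le> (\<Sum>a\<in>X. occ n A m a t)"
      using that \<beta>V by (intro sum_mono2) auto
    finally show ?thesis .
  qed

  \<comment> \<open>The column totals over the whole alphabet are those of the highest weight
    vector, and the \<beta>'s are only a part of them.\<close>
  have cols_\<kappa>: "(\<Sum>s = 1..?q. c s t) \<le> col_height \<kappa> t" if t: "t \<in> {1..d}" for t
  proof -
    from word_support_columns[OF order.refl w nz] obtain A' m' where
      *: "lookup (amp (emb ?v) A') m' \<noteq> 0" "\<And>s. (\<Sum>a\<in>?Al. occ n A m a s) = (\<Sum>a\<in>?Al. occ n A' m' a s)"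
      by blast
    note A' = emb_support[OF *(1)]
    have "(\<Sum>s = 1..?q. c s t) \<le> (\<Sum>a\<in>?Al. occ n A m a t)" by (rule sub_sum[OF t VA finite_alphabet])
    also have "\<dots> = (\<Sum>a\<in>?Al. occ n A' m' a t)" by (rule *(2))
    also have "\<dots> = (\<Sum>a\<in>?Al. if is_pos a then 0 else lookup m' (row_index n a, t))"
      by (intro sum.cong) (auto simp: occ_def A'(1))
    also have "\<dots> = (\<Sum>i = 1..n + m1. lookup m' (i, t))"
      by (rule sum_row_index[where g = "\<lambda>i. lookup m' (i, t)"])
    also have "\<dots> = col_height \<kappa> t"
      using hwv_col_degree[of t \<kappa> "n + m1"] le_n t A'(2) by (simp add: homogeneous_def trans_le_add1)
    finally show ?thesis .
  qed

  \<comment> \<open>Traced back through the outer word, the \<beta>'s of a column come from virtual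
    symbols of z, where only \<alpha>'s occur. An odd variable occurs at most once, so the symbol of
    row r supplies at most min k (\<nu> ! r) of them to the first k columns.\<close>
  have cols_\<nu>: "(\<Sum>t = 1..k. \<Sum>s = 1..?q. c s t) \<le> (\<Sum>s = 1..k. col_height \<nu> s)" for k
  proof -
    have "lookup (amp (word_op n d ?w1 ?z) A) m \<noteq> 0" using nz by simp
    from word_support_columns[OF VA w1 this] obtain A' m' where
      z: "lookup (amp ?z A') m' \<noteq> 0"
      and cols: "\<And>s. (\<Sum>a\<in>?V. occ n A m a s) = (\<Sum>a\<in>?V. occ n A' m' a s)"
      by blast
    define o' where "o' a t = (if t \<in> {1..d} then occ n A' m' a t else 0)" for a t
    have o_row: "(\<Sum>t = 1..d. o' a t) = NA a" if "a \<in> ?V" for a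
    proof -
      have "(\<Sum>t = 1..d. int (occ n A' m' a t)) = int (NA a)"
        using z_deg[OF that] z by (simp add: has_degree_def)
      then have "(\<Sum>t = 1..d. occ n A' m' a t) = NA a" by (simp flip: of_nat_sum)
      then show ?thesis by (simp add: o'_def)
    qed
    have bound: "(\<Sum>t = 1..k. o' a t) \<le> min k (NA a)" if a: "a \<in> ?V" for a
    proof -
      have "(\<Sum>t = 1..k. o' a t) \<le> (\<Sum>t \<in> {1..k} \<union> {1..d}. o' a t)" by (rule sum_mono2) auto
      also have "\<dots> = (\<Sum>t = 1..d. o' a t)" by (rule sum.mono_neutral_right) (auto simp: o'_def)
      finally have 1: "(\<Sum>t = 1..k. o' a t) \<le> NA a" unfolding o_row[OF a] .
      show ?thesis
      proof (cases "is_pos a")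
        case True
        then have "(\<Sum>t = 1..k. o' a t) \<le> (\<Sum>t = 1..k. 1)" by (intro sum_mono) (simp add: o'_def occ_def)
        with 1 show ?thesis by simp
      next
        case False
        then have "NA a = 0" using a NA_Neg by (auto simp: virtuals_def)
        with 1 show ?thesis by simp
      qed
    qed
    have "(\<Sum>t = 1..k. \<Sum>s = 1..?q. c s t) \<le> (\<Sum>t = 1..k. \<Sum>a\<in>?V. o' a t)"
    proof (rule sum_mono)
      fix t
      show "(\<Sum>s = 1..?q. c s t) \<le> (\<Sum>a\<in>?V. o' a t)"
      proof (cases "t \<in> {1..d}")
        case True
        then show ?thesis using sub_sum[OF True order.refl finV] cols[of t] by (simp add: o'_def)
      next
        case False
        then have "(\<Sum>s = 1..?q. c s t) = 0" by (intro sum.neutral) (auto simp: c_def)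
        then show ?thesis by simp
      qed
    qed
    also have "\<dots> = (\<Sum>a\<in>?V. \<Sum>t = 1..k. o' a t)" by (rule sum.swap)
    also have "\<dots> \<le> (\<Sum>a\<in>?V. min k (NA a))" by (rule sum_mono) (rule bound)
    also have "\<dots> = (\<Sum>a\<in>(\<lambda>r. Pos (\<alpha> (Suc r))) ` {..<length \<nu>}. min k (NA a))"
    proof (rule sum.mono_neutral_right[OF finV])
      show "(\<lambda>r. Pos (\<alpha> (Suc r))) ` {..<length \<nu>} \<subseteq> ?V"
        using row_sym_alphabet[OF vc] by (auto simp: row_sym_def)
      show "\<forall>a\<in>?V - (\<lambda>r. Pos (\<alpha> (Suc r))) ` {..<length \<nu>}. min k (NA a) = 0"
      proof
        fix a assume a: "a \<in> ?V - (\<lambda>r. Pos (\<alpha> (Suc r))) ` {..<length \<nu>}"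
        have "a \<notin> row_sym \<alpha> ` set (cells \<nu>)"
        proof
          assume "a \<in> row_sym \<alpha> ` set (cells \<nu>)"
          then obtain r s where "a = row_sym \<alpha> (r, s)" "r < length \<nu>" unfolding set_cells by blast
          then show False using a by (auto simp: row_sym_def)
        qed
        then show "min k (NA a) = 0" by (simp add: NA_def count_list_0_iff)
      qed
    qed
    also have "\<dots> = (\<Sum>r<length \<nu>. min k (NA (Pos (\<alpha> (Suc r)))))"
    proof (subst sum.reindex)
      have "inj_on \<alpha> {1..length \<nu>}" using vc by (simp add: virtual_choice_def)
      then show "inj_on (\<lambda>r. Pos (\<alpha> (Suc r))) {..<length \<nu>}"
        by (intro inj_onI) (auto dest: inj_onD)
    qed simp
    also have "\<dots> = (\<Sum>r<length \<nu>. min k (\<nu> ! r))"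
    proof (rule sum.cong[OF refl])
      fix r assume "r \<in> {..<length \<nu>}"
      then have "NA (Pos (\<alpha> (Suc r))) = \<nu> ! r"
        using count_list_row_sym[of r "[0..<length \<nu>]" "length \<nu>" \<alpha> \<nu>] vc
        by (simp add: NA_def count_list_cells rev_rows_def virtual_choice_def atLeast0LessThan)
      then show "min k (NA (Pos (\<alpha> (Suc r)))) = min k (\<nu> ! r)" by simp
    qed
    also have "\<dots> = (\<Sum>s = 1..k. col_height \<nu> s)" by (rule sum_col_height[symmetric])
    finally show ?thesis .
  qed

  have "ferrers \<nu> \<subseteq> ferrers \<kappa>"
  proof (rule ferrers_subset_col_height[OF \<nu> \<kappa>])
    fix k assume k: "k \<in> {1..?q}"
    have eq: "(\<Sum>s = 1..?q. c s k) = col_height \<nu> k"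
      by (rule young_squeeze[where d = d]) (use rows c_tri cols_\<nu> k in auto)
    show "col_height \<nu> k \<le> col_height \<kappa> k"
    proof (cases "k \<in> {1..d}")
      case True
      then show ?thesis using cols_\<kappa>[of k] eq by (simp only:)
    next
      case False
      \<comment> \<open>Beyond d the matrix is zero, and \<open>eq\<close> then makes the column k
        of \<nu> empty.\<close>
      then have "(\<Sum>s = 1..?q. c s k) = 0" by (intro sum.neutral) (auto simp: c_def)
      then show ?thesis using eq by simp
    qed
  qed
  with not_sub show False ..
qed

section \<open>Conjugate partitions and the four statements\<close>

lemma sorted_conj_part: "sorted_wrt (\<ge>) (conj_part \<mu>)"
proof -
  have "card {r. (r, t) \<in> ferrers \<mu>} \<le> card {r. (r, s) \<in> ferrers \<mu>}" if "s \<le> t" for s t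
  proof (rule card_mono)
    show "finite {r. (r, s) \<in> ferrers \<mu>}"
      by (rule finite_subset[of _ "{..<length \<mu>}"]) (auto simp: ferrers_def)
    show "{r. (r, t) \<in> ferrers \<mu>} \<subseteq> {r. (r, s) \<in> ferrers \<mu>}"
      using that by (auto simp: ferrers_def)
  qed
  then show ?thesis by (auto simp: conj_part_def sorted_wrt_iff_nth_less)
qed

lemma conj_part_pos: "0 < conj_part \<mu> ! i" if "i < length (conj_part \<mu>)"
proof -
  have i: "i < first_part \<mu>" using that by (simp add: conj_part_def)
  then have "(0, i) \<in> ferrers \<mu>" by (cases \<mu>) (auto simp: ferrers_def first_part_def)
  moreover have "finite {r. (r, i) \<in> ferrers \<mu>}"
    by (rule finite_subset[of _ "{..<length \<mu>}"]) (auto simp: ferrers_def)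
  ultimately have "0 < card {r. (r, i) \<in> ferrers \<mu>}" by (auto simp: card_gt_0_iff)
  with i show ?thesis by (simp add: conj_part_def)
qed

lemma ferrers_Sigma: "ferrers \<nu> = Sigma {..<length \<nu>} (\<lambda>r. {..<\<nu> ! r})"
  by (auto simp: ferrers_def)

lemma card_ferrers: "card (ferrers \<nu>) = sum_list \<nu>"
  by (simp add: ferrers_Sigma sum_list_sum_nth atLeast0LessThan)

lemma finite_ferrers: "finite (ferrers \<nu>)"
  by (simp add: ferrers_Sigma)

lemma ferrers_inject:
  assumes "\<And>i. i < length \<nu> \<Longrightarrow> 0 < \<nu> ! i" "\<And>i. i < length \<kappa> \<Longrightarrow> 0 < \<kappa> ! i" "ferrers \<nu> = ferrers \<kappa>"
  shows "\<nu> = \<kappa>"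
proof (rule nth_equalityI)
  have "i < length \<nu> \<longleftrightarrow> i < length \<kappa>" for i
  proof -
    have "(i, 0) \<in> ferrers \<nu> \<longleftrightarrow> (i, 0) \<in> ferrers \<kappa>" using assms(3) by simp
    then show ?thesis using assms(1)[of i] assms(2)[of i] by (auto simp: ferrers_def)
  qed
  then show len: "length \<nu> = length \<kappa>" by (metis linorder_neq_iff)
  fix i assume i: "i < length \<nu>"
  have "s < \<nu> ! i \<longleftrightarrow> s < \<kappa> ! i" for s
  proof -
    have "(i, s) \<in> ferrers \<nu> \<longleftrightarrow> (i, s) \<in> ferrers \<kappa>" using assms(3) by simp
    then show ?thesis using i len by (simp add: ferrers_def)
  qed
  then show "\<nu> ! i = \<kappa> ! i" by (metis linorder_neq_iff)
qed

lemma le_first_part: "sorted_wrt (\<ge>) \<nu> \<Longrightarrow> k \<in> set \<nu> \<Longrightarrow> k \<le> first_part \<nu>"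
  using nth_le_first_part by (metis in_set_conv_nth)

lemma emb_minus: "emb (- p) = - emb p"
  by (intro fock_eqI) (simp add: emb_def)

theorem theorem3p9:
  fixes n d m0 m1 :: nat and lam mu :: "nat list" and \<alpha> \<beta> :: "nat \<Rightarrow> nat" and v :: cpoly
  assumes "is_partition lam" and "is_partition mu"
    and "first_part (conj_part mu) \<le> n"
    and "first_part (conj_part mu) \<le> d"
    and "virtual_choice m0 m1 (conj_part lam) \<alpha> \<beta>"
    and "canonical_hwv n mu v"
  shows
    "(\<forall>S\<in>tableaux n (conj_part lam). \<forall>S'\<in>tableaux n (conj_part lam).
        sum_list (conj_part mu) < sum_list (conj_part lam) \<longrightarrow>
        gl_act m0 m1 n d (double_YC m0 m1 n \<alpha> \<beta> S' S) v = 0)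
   \<and> (\<forall>S\<in>tableaux n (conj_part lam). \<forall>S'\<in>tableaux n (conj_part lam).
        sum_list (conj_part mu) = sum_list (conj_part lam) \<and> conj_part mu \<noteq> conj_part lam \<longrightarrow>
        gl_act m0 m1 n d (double_YC m0 m1 n \<alpha> \<beta> S' S) v = 0)
   \<and> (conj_part mu = conj_part lam \<longrightarrow>
        gl_act m0 m1 n d
          (double_YC m0 m1 n \<alpha> \<beta> (D_tab (conj_part lam)) (D_tab (conj_part lam))) v =
        scale (of_nat (hook_product (conj_part lam)) ^ 2) v)
   \<and> (\<forall>S\<in>tableaux n (conj_part lam). \<forall>S'\<in>tableaux n (conj_part lam).
        \<not> ferrers (conj_part lam) \<subseteq> ferrers (conj_part mu) \<longrightarrow>
        gl_act m0 m1 n d (double_YC m0 m1 n \<alpha> \<beta> S' S) v = 0)"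
proof -
  let ?\<nu> = "conj_part lam" and ?\<kappa> = "conj_part mu"
  let ?b = "bideterminant (D_tab ?\<kappa>)"
  note vc = assms(5)
  note \<nu> = sorted_conj_part[of lam] and \<kappa> = sorted_conj_part[of mu]
  have le_n: "k \<le> n" and le_d: "k \<le> d" if "k \<in> set ?\<kappa>" for k
    using le_first_part[OF \<kappa> that] assms(3,4) by simp_all
  have v: "v = ?b \<or> v = - ?b" using assms(6) by (simp add: canonical_hwv_def)
  have proper_b: "proper n ?b" by (rule hwv_proper) (rule le_n)
  then have proper: "proper n v" using v by (auto simp: proper_def)
  have "emb v = scl 1 (emb ?b) \<or> emb v = scl (- 1) (emb ?b)"
    using v by (auto simp: scl_simps emb_minus)
  \<comment> \<open>Turning the sign convention into a scalar lets both parts pass from the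
    bideterminant to v by linearity.\<close>
  then have signed: "\<exists>e. emb v = scl e (emb ?b)" by blast

  have vanish: "gl_act m0 m1 n d (double_YC m0 m1 n \<alpha> \<beta> S' S) v = 0"
    if S: "S \<in> tableaux n ?\<nu>" "S' \<in> tableaux n ?\<nu>" and not_sub: "\<not> ferrers ?\<nu> \<subseteq> ferrers ?\<kappa>" for S S'
  proof -
    have "word_op n d (pair_word (col_sym \<beta>) (row_sym \<alpha>) (cells ?\<nu>) @ pair_word (row_sym \<alpha>) (letter_of S) (cells ?\<nu>)) (emb ?b) = 0"
      by (rule skew_vanishing[OF \<nu> \<kappa> vc le_n le_d letter_of_alphabet[OF S(1)] not_sub])
    then have "word_op n d (pair_word (col_sym \<beta>) (row_sym \<alpha>) (cells ?\<nu>) @ pair_word (row_sym \<alpha>) (letter_of S) (cells ?\<nu>)) (emb v) = 0"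
      using signed linear_op_scl[OF linear_word_op] scl_simps(4) by metis
    then show ?thesis
      unfolding gl_act_double_YC[OF \<nu> S(2,1) vc proper] by (simp add: word_op_zero)
  qed

  have hook: "gl_act m0 m1 n d (double_YC m0 m1 n \<alpha> \<beta> (D_tab ?\<nu>) (D_tab ?\<nu>)) v =
      scale (of_nat (hook_product ?\<nu>) ^ 2) v" if eq: "?\<kappa> = ?\<nu>"
  proof -
    have D: "D_tab ?\<nu> \<in> tableaux n ?\<nu>"
      using le_n unfolding eq
      by (fastforce simp: D_tab_def tableaux_def sh_def comp_def map_idI simp del: upt_Suc)
    have letters: "letter_of (D_tab ?\<nu>) c = lett_sym c" if "c \<in> set (cells ?\<nu>)" for c
      using that unfolding set_cells
      by (auto simp: letter_of_def lett_sym_def D_tab_def simp del: upt_Suc)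
    have words: "pair_word (letter_of (D_tab ?\<nu>)) G (cells ?\<nu>) = pair_word lett_sym G (cells ?\<nu>)"
      "pair_word G (letter_of (D_tab ?\<nu>)) (cells ?\<nu>) = pair_word G lett_sym (cells ?\<nu>)" for G
      by (simp_all add: pair_word_def letters)
    have fp: "first_part ?\<nu> \<le> n" "first_part ?\<nu> \<le> d" using assms(3,4) eq by simp_all
    have "word_op n d (pair_word lett_sym (row_sym \<alpha>) (cells ?\<nu>) @ pair_word (row_sym \<alpha>) (col_sym \<beta>) (cells ?\<nu>) @
        pair_word (col_sym \<beta>) (row_sym \<alpha>) (cells ?\<nu>) @ pair_word (row_sym \<alpha>) lett_sym (cells ?\<nu>)) (emb ?b) =
      scl (of_nat (hook_product ?\<nu>) ^ 2) (emb ?b)"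
    proof (rule double_capelli[OF \<nu> vc fp(1)])
      show "has_degree n d c 0 (emb ?b)" if "c \<in> virtuals m0 m1" for c
        by (rule has_degree_emb_virtual[OF proper_b that])
      show "polar n d (Lett i) (Lett j) (emb ?b) = 0" if "1 \<le> i" "i < j" "j \<le> first_part ?\<nu>" for i j
        using polarization_hwv[OF that(1,2) le_d] by (simp add: polar_emb emb_zero)
      show "has_degree n d (Lett s) (int (col_height ?\<nu> s)) (emb ?b)" if s: "1 \<le> s" "s \<le> first_part ?\<nu>" for s
        unfolding has_degree_def
      proof (intro allI impI)
        fix A m assume "lookup (amp (emb ?b) A) m \<noteq> 0"
        from emb_support(2)[OF this] hwv_row_degree[OF s(1) le_d]
        have "(\<Sum>t = 1..d. lookup m (s, t)) = col_height ?\<kappa> s" by (simp add: homogeneous_def)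
        then show "(\<Sum>t = 1..d. int (occ n A m (Lett s) t)) = int (col_height ?\<nu> s)"
          by (simp add: occ_def eq flip: of_nat_sum)
      qed
    qed
    moreover obtain e where "emb v = scl e (emb ?b)" using signed by blast
    ultimately have "word_op n d (pair_word lett_sym (row_sym \<alpha>) (cells ?\<nu>) @ pair_word (row_sym \<alpha>) (col_sym \<beta>) (cells ?\<nu>) @
        pair_word (col_sym \<beta>) (row_sym \<alpha>) (cells ?\<nu>) @ pair_word (row_sym \<alpha>) lett_sym (cells ?\<nu>)) (emb v) =
      scl (of_nat (hook_product ?\<nu>) ^ 2) (emb v)"
      by (simp only: linear_op_scl[OF linear_word_op] scl_simps mult.commute)
    then show ?thesis
      unfolding gl_act_double_YC[OF \<nu> D D vc proper] words by (simp add: emb_def)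
  qed

  \<comment> \<open>An inclusion of diagrams bounds the number of cells, and with equally many cells
    it is an equality of diagrams; so both size conditions exclude inclusion.\<close>
  have lt: "\<not> ferrers ?\<nu> \<subseteq> ferrers ?\<kappa>" if "sum_list ?\<kappa> < sum_list ?\<nu>"
    using card_mono[OF finite_ferrers[of ?\<kappa>], of "ferrers ?\<nu>"] that by (auto simp: card_ferrers)
  have eq: "\<not> ferrers ?\<nu> \<subseteq> ferrers ?\<kappa>" if "sum_list ?\<kappa> = sum_list ?\<nu>" "?\<kappa> \<noteq> ?\<nu>"
  proof
    assume "ferrers ?\<nu> \<subseteq> ferrers ?\<kappa>"
    then have "ferrers ?\<nu> = ferrers ?\<kappa>"
      using that(1) by (intro card_subset_eq finite_ferrers) (simp_all add: card_ferrers)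
    then have "?\<nu> = ?\<kappa>" by (intro ferrers_inject conj_part_pos)
    with that(2) show False by simp
  qed
  show ?thesis using vanish hook lt eq by blast
qed

end
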